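(* Let $f\in L^2(\mathcal X,\mu)$ with $\mathbb V_\mu[f]>0$, and suppose the design points $x_1,\dots,x_n$ ($n\ge2$) are sampled i.i.d. from $\mu$ and the observations are noiseless, i.e. $y_i=f(x_i)$ ($\sigma^2=0$). Let $r>0$ be fixed and suppose that $N$ and $n$ satisfy $$K_N\le\kappa_r\cdot\frac{n}{\ln n},\qquad\kappa_r=\frac{3\ln(3/2)-1}{2+2r}.$$ Let $\hat f^{LS}$ be the ordinary least squares approximation of $f$ with truncation set $\mathcal L_N$, and let $(S_U,\hat S^{LS}_U)$ denote either the Sobol' indices of $f$ and $\hat f^{LS}$ for $U$, or the total-effect indices of $f$ and $\hat f^{LS}$ for $U$. Then in both cases, for every $U\subseteq\{1,\dots,d\}$, $$\mathbb E\big(S_U-\hat S_U^{LS}\big)^2\le\frac{1.2}{\mathbb V_\mu[f]}\|e_N\|_\mu^2+2n^{-r},$$ $$\mathbb E\big|S_U-\hat S_U^{LS}\big|\le\frac{1.2}{\mathbb V_\mu[f]}\|e_N\|_\mu^2+\frac{2.2\cdot S_U^{1/2}}{\mathbb V_\mu^{1/2}[f]}\|e_N\|_\mu+2n^{-r}.$$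
   Context: $\mathcal X=\mathcal X_1\times\dots\times\mathcal X_d$ with $\mathcal X_i\subseteq\mathbb R$, and $\mu=\mu_1\otimes\dots\otimes\mu_d$ is a product of probability measures $\mu_i$ on $\mathcal X_i$. $\|g\|_\mu$ is the $L^2(\mathcal X,\mu)$ norm; $\mathbb E_\mu,\mathbb V_\mu$ are mean and variance under $\mu$. Every $f\in L^2(\mathcal X,\mu)$ has a unique Sobol-Hoeffding decomposition $f(x)=\sum_{U\subseteq\{1,\dots,d\}}f_U(x_U)$, where $f_U$ depends only on $x_U=(x_i)_{i\in U}$, $f_\emptyset=\mathbb E_\mu[f]$, and $\int_{\mathcal X_i}f_U(x_U)\,d\mu_i(x_i)=0$ for every $i\in U$. When $\mathbb V_\mu[f]>0$, the Sobol' index of $U$ is $S_U=\mathbb V_\mu[f_U]/\mathbb V_\mu[f]$, and the total-effect index is $T_U=\sum_{V:\,V\cap U\ne\emptyset}S_V$ ($S_\emptyset=T_\emptyset=0$). If an approximation $\hat f$ has $\mathbb V_\mu[\hat f]=0$, its indices are by convention all set equal to $2^{-d}$. Regressors: for each $i$, $\{\psi^{(i)}_\alpha\}_{\alpha\in\mathbb N}$ ($\mathbb N=\{0,1,2,\dots\}$) is a $\mu_i$-orthonormal family with $\psi^{(i)}_0=1$, and $\Psi_\alpha(x)=\prod_{i=1}^d\psi^{(i)}_{\alpha_i}(x_i)$ for $\alpha\in\mathbb N^d$. Fixed nested sets $\{\mathbf 0\}=\mathcal L_1\subset\mathcal L_2\subset\dots\subset\mathbb N^d$ with $|\mathcal L_N|=N$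 are given; $V_N=\mathrm{span}\{\Psi_\alpha:\alpha\in\mathcal L_N\}$; $f_N$ is the $\mu$-orthogonal projection of $f$ onto $V_N$ and $e_N=f-f_N$. $K_N=\sup_{x\in\mathcal X}\sum_{\alpha\in\mathcal L_N}\Psi_\alpha^2(x)$. With $Y=(y_1,\dots,y_n)^T$ and the design matrix $\Phi\in\mathbb R^{n\times N}$ with entries $\Psi_\alpha(x_i)$ ($\alpha\in\mathcal L_N$), ordinary least squares gives $\hat f^{LS}=\sum_{\alpha\in\mathcal L_N}\hat c_\alpha\Psi_\alpha$ with $\hat c=(\Phi^T\Phi)^{-1}\Phi^TY$ if $\det(\Phi^T\Phi)\ne0$, and $\hat c=0$ otherwise. $\mathbb E$ without subscript is expectation over the random design. *)

theory Defs
  imports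
    "HOL-Probability.Probability"
    "HOL-Library.Countable_Set"
    "Jordan_Normal_Form.Gauss_Jordan_Elimination"
    "Jordan_Normal_Form.Determinant"
begin

text \<open>The coordinates \<open>1,\<dots>,d\<close> are the elements of a finite type \<open>'i\<close>, so \<open>d = CARD('i)\<close>, and
  the product of the marginals \<open>\<mu> i\<close> is a measure on functions \<open>'i \<Rightarrow> real\<close>.\<close>

abbreviation prodm :: "('i::finite \<Rightarrow> real measure) \<Rightarrow> ('i \<Rightarrow> real) measure" where
  "prodm \<mu> \<equiv> PiM UNIV \<mu>"

definition L2 :: "'a measure \<Rightarrow> ('a \<Rightarrow> real) set" where
  "L2 M = {g \<in> borel_measurable M. integrable M (\<lambda>x. (g x)\<^sup>2)}"

definition L2_norm :: "'a measure \<Rightarrow> ('a \<Rightarrow> real) \<Rightarrow> real" where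
  "L2_norm M g = sqrt (\<integral>x. (g x)\<^sup>2 \<partial>M)"

text \<open>Elements of \<open>L2\<close> are genuine functions rather than equivalence classes, so the
  decomposition identity and the vanishing of partial integrals are required almost everywhere.\<close>

definition sobol_decomposition ::
  "('i::finite \<Rightarrow> real measure) \<Rightarrow> (('i \<Rightarrow> real) \<Rightarrow> real) \<Rightarrow> ('i set \<Rightarrow> ('i \<Rightarrow> real) \<Rightarrow> real) \<Rightarrow> bool"
where
  "sobol_decomposition \<mu> f F \<longleftrightarrow>
     (\<forall>U. F U \<in> L2 (prodm \<mu>)) \<and>
     (AE x in prodm \<mu>. f x = (\<Sum>U\<in>UNIV. F U x)) \<and>
     (\<forall>U. \<forall>x\<in>space (prodm \<mu>). \<forall>y\<in>space (prodm \<mu>). (\<forall>i\<in>U. x i = y i) \<longrightarrow> F U x = F U y) \<and>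
     (\<forall>x\<in>space (prodm \<mu>). F {} x = (\<integral>y. f y \<partial>prodm \<mu>)) \<and>
     (\<forall>U. \<forall>i\<in>U. AE x in prodm \<mu>. (\<integral>t. F U (x(i := t)) \<partial>\<mu> i) = 0)"

text \<open>The components are unique up to null sets, so their variances do not depend on the choice.\<close>

definition sobol_component ::
  "('i::finite \<Rightarrow> real measure) \<Rightarrow> (('i \<Rightarrow> real) \<Rightarrow> real) \<Rightarrow> 'i set \<Rightarrow> ('i \<Rightarrow> real) \<Rightarrow> real" where
  "sobol_component \<mu> f = (SOME F. sobol_decomposition \<mu> f F)"

abbreviation Var :: "'a measure \<Rightarrow> ('a \<Rightarrow> real) \<Rightarrow> real" where
  "Var M g \<equiv> prob_space.variance M g"

text \<open>By convention all indices, of both kinds, of a function with variance zero equal \<open>2\<^sup>-\<^sup>d\<close>.\<close>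

definition sobol_index ::
  "('i::finite \<Rightarrow> real measure) \<Rightarrow> (('i \<Rightarrow> real) \<Rightarrow> real) \<Rightarrow> 'i set \<Rightarrow> real" where
  "sobol_index \<mu> f U =
     (if Var (prodm \<mu>) f = 0 then 1 / 2 ^ CARD('i)
      else Var (prodm \<mu>) (sobol_component \<mu> f U) / Var (prodm \<mu>) f)"

definition total_effect_index ::
  "('i::finite \<Rightarrow> real measure) \<Rightarrow> (('i \<Rightarrow> real) \<Rightarrow> real) \<Rightarrow> 'i set \<Rightarrow> real" where
  "total_effect_index \<mu> f U =
     (if Var (prodm \<mu>) f = 0 then 1 / 2 ^ CARD('i)
      else (\<Sum>V | V \<inter> U \<noteq> {}. sobol_index \<mu> f V))"

definition orthonormal_family :: "'a measure \<Rightarrow> ('b \<Rightarrow> 'a \<Rightarrow> real) \<Rightarrow> bool" where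
  "orthonormal_family M \<phi> \<longleftrightarrow>
     (\<forall>a. \<phi> a \<in> L2 M) \<and> (\<forall>a b. (\<integral>x. \<phi> a x * \<phi> b x \<partial>M) = (if a = b then 1 else 0))"

definition tensor :: "('i::finite \<Rightarrow> nat \<Rightarrow> real \<Rightarrow> real) \<Rightarrow> ('i \<Rightarrow> nat) \<Rightarrow> ('i \<Rightarrow> real) \<Rightarrow> real" where
  "tensor \<psi> \<alpha> x = (\<Prod>i\<in>UNIV. \<psi> i (\<alpha> i) (x i))"

definition fun_span :: "('b \<Rightarrow> 'a \<Rightarrow> real) \<Rightarrow> 'b set \<Rightarrow> ('a \<Rightarrow> real) set" where
  "fun_span \<Psi> A = {g. \<exists>c. g = (\<lambda>x. \<Sum>\<alpha>\<in>A. c \<alpha> * \<Psi> \<alpha> x)}"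

definition orth_projection :: "'a measure \<Rightarrow> ('a \<Rightarrow> real) set \<Rightarrow> ('a \<Rightarrow> real) \<Rightarrow> 'a \<Rightarrow> real" where
  "orth_projection M V f = (SOME p. p \<in> V \<and> (\<forall>g\<in>V. (\<integral>x. (f x - p x) * g x \<partial>M) = 0))"

definition sup_kernel :: "'a set \<Rightarrow> ('b \<Rightarrow> 'a \<Rightarrow> real) \<Rightarrow> 'b set \<Rightarrow> ereal" where
  "sup_kernel X \<Psi> A = (SUP x\<in>X. ereal (\<Sum>\<alpha>\<in>A. (\<Psi> \<alpha> x)\<^sup>2))"

text \<open>The columns of the design matrix are indexed by \<open>0,\<dots>,card A - 1\<close> through the enumeration
  \<open>from_nat_into A\<close> of the finite set \<open>A\<close>; the least squares approximation does not depend on it.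
  Sample points are indexed by \<open>0,\<dots>,n - 1\<close>.\<close>

definition design_matrix :: "('b \<Rightarrow> 'a \<Rightarrow> real) \<Rightarrow> 'b set \<Rightarrow> nat \<Rightarrow> (nat \<Rightarrow> 'a) \<Rightarrow> real Matrix.mat" where
  "design_matrix \<Psi> A n xs = Matrix.mat n (card A) (\<lambda>(j, k). \<Psi> (from_nat_into A k) (xs j))"

definition ls_coeffs ::
  "('b \<Rightarrow> 'a \<Rightarrow> real) \<Rightarrow> 'b set \<Rightarrow> nat \<Rightarrow> (nat \<Rightarrow> 'a) \<Rightarrow> (nat \<Rightarrow> real) \<Rightarrow> real Matrix.vec" where
  "ls_coeffs \<Psi> A n xs ys =
     (let \<Phi> = design_matrix \<Psi> A n xs; G = transpose_mat \<Phi> * \<Phi>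
      in if Determinant.det G \<noteq> 0
         then the (mat_inverse G) *\<^sub>v (transpose_mat \<Phi> *\<^sub>v Matrix.vec n ys)
         else 0\<^sub>v (card A))"

definition ls_approx ::
  "('b \<Rightarrow> 'a \<Rightarrow> real) \<Rightarrow> 'b set \<Rightarrow> nat \<Rightarrow> (nat \<Rightarrow> 'a) \<Rightarrow> (nat \<Rightarrow> real) \<Rightarrow> 'a \<Rightarrow> real" where
  "ls_approx \<Psi> A n xs ys x =
     (\<Sum>k<card A. vec_index (ls_coeffs \<Psi> A n xs ys) k * \<Psi> (from_nat_into A k) x)"

end

theory Submission
  imports Defs
begin

text \<open>
  The error of an index is controlled by the error of the function. Split the centred function
  \<open>f\<close> into the part \<open>f'\<close> carried by a family \<open>W\<close> of coordinate sets and the rest; both kinds of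
  index have the form \<open>\<parallel>f'\<parallel>\<^sup>2 / \<parallel>f\<parallel>\<^sup>2\<close>, the squared cosine of the angle between \<open>f\<close> and a fixed
  closed subspace. If \<open>g\<close> is another function, the sine of the angle between \<open>f\<close> and \<open>g\<close> is at most
  \<open>\<parallel>f - g\<parallel> / \<parallel>f\<parallel>\<close>, and elementary trigonometry bounds the difference of the indices
  (\<open>angle_comparison\<close>, \<open>group_index_stable\<close>). This rests on the existence and the orthogonality of
  the Sobol-Hoeffding components (\<open>anova_decomposition\<close>, \<open>sobol_orthogonal\<close>).

  It remains to bound \<open>\<parallel>f - fhat\<parallel>\<close>. Let \<open>S\<close> be the Gram matrix of the design, the sum over the
  \<open>n\<close> sample points of the rank-one matrices \<open>v v\<^sup>T\<close> with \<open>v = (\<Psi>\<^sub>\<alpha> (x\<^sub>j))\<^sub>\<alpha>\<close>; its mean is \<open>n\<close>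
  times the identity. When the smallest eigenvalue of \<open>S\<close> is at least \<open>n / 2\<close>, the normal
  equations bound the coefficient error by \<open>2 / n\<close> times the norm of the vector
  \<open>(\<Sum>j. \<Psi>\<^sub>\<alpha> (x\<^sub>j) e (x\<^sub>j))\<^sub>\<alpha>\<close> (\<open>least_squares_error\<close>), whose second moment is at most
  \<open>n K \<parallel>e\<parallel>\<^sup>2\<close> because its summands are independent and centred (\<open>noise_second_moment\<close>). The
  hypothesis on \<open>K\<close> forces \<open>20 K \<le> n\<close> (\<open>kappa_numerics\<close>), so the mean square error is at most
  \<open>(1 + 4 K / n) \<parallel>e\<parallel>\<^sup>2 \<le> 1.2 \<parallel>e\<parallel>\<^sup>2\<close>. On the complementary event the indices differ by at most 1.

  The complementary event has probability at most \<open>N exp (- 0.12 n / K) \<le> n\<^sup>-\<^sup>r\<close>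
  (\<open>coercive_tail\<close>). This is a matrix Chernoff bound for the lower tail, obtained here without the
  matrix exponential: the potential \<open>tr T\<^sup>p\<close> with \<open>T = I - \<epsilon> S\<close>, a large even \<open>p\<close> and
  \<open>\<epsilon> = 1 / (2 p K)\<close> plays the role of \<open>tr exp (- S / (2 K))\<close>. Subtracting a rank-one matrix
  \<open>v v\<^sup>T\<close> from \<open>T\<close> changes \<open>tr T\<^sup>p\<close> by an expression in the moments \<open>m\<^sub>j = v\<^sup>T T\<^sup>j v\<close>, and the
  log-convexity of \<open>j \<mapsto> m\<^sub>j\<close> gives
  \<open>tr (T - v v\<^sup>T)\<^sup>p \<le> tr T\<^sup>p - p m\<^sub>p\<^sub>-\<^sub>1 + p (p - 1) / 2 m\<^sub>0 m\<^sub>p\<^sub>-\<^sub>2\<close>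
  (\<open>tr_pow_update_le\<close>). Averaging over one sample point turns the moments into traces, so the
  expected potential shrinks by a fixed factor with each sample, while a small eigenvalue of \<open>S\<close>
  makes the potential large.
\<close>

section \<open>Traces of powers of symmetric operators\<close>

text \<open>All Cauchy-Schwarz inequalities below come from this form of the discriminant criterion.\<close>

lemma discriminant_nonneg:
  fixes a b c :: real
  assumes "\<And>s. 0 \<le> a + 2 * s * b + s\<^sup>2 * c"
  shows "b\<^sup>2 \<le> a * c"
proof -
  have a: "0 \<le> a" using assms[of 0] by simp
  show ?thesis
  proof (cases "c = 0")
    case True
    have "b = 0"
    proof (rule ccontr)
      assume "b \<noteq> 0"
      then show False using assms[of "- (a + 1) / (2 * b)"] True by (simp add: field_simps)
    qed
    then show ?thesis using True by simp
  next
    case c: False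
    have "0 \<le> c"
    proof (rule ccontr)
      assume "\<not> 0 \<le> c"
      define s where "s = 1 + (a + 2 * \<bar>b\<bar> + 1) / - c"
      have s: "s \<ge> 1" "s * - c \<ge> a + 2 * \<bar>b\<bar> + 1"
        using \<open>\<not> 0 \<le> c\<close> a by (auto simp: s_def field_simps)
      have "s * (a + 2 * \<bar>b\<bar> + 1) \<le> s * (s * - c)"
        using s by (intro mult_left_mono) auto
      moreover have "a + 2 * (s * b) + s \<le> s * (a + 2 * \<bar>b\<bar> + 1)"
      proof -
        have "a \<le> s * a" using mult_right_mono[OF s(1) a] by simp
        moreover have "s * b \<le> s * \<bar>b\<bar>" using s(1) by (intro mult_left_mono) auto
        ultimately show ?thesis by (simp add: algebra_simps)
      qed
      moreover have "s\<^sup>2 * c = - (s * (s * - c))" by (simp add: power2_eq_square)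
      ultimately show False using assms[of s] s(1) by linarith
    qed
    then show ?thesis
      using assms[of "- b / c"] c by (simp add: field_simps power2_eq_square split: if_splits)
  qed
qed

text \<open>Vectors indexed by a finite set \<open>A\<close> are represented by functions of which only the values on
  \<open>A\<close> matter, and matrices by the operators that they induce. This is the Euclidean inner product
  over \<open>A\<close>; it also keeps the dimension \<open>card A\<close> a variable.\<close>

definition ip :: "'b set \<Rightarrow> ('b \<Rightarrow> real) \<Rightarrow> ('b \<Rightarrow> real) \<Rightarrow> real" where
  "ip A x y = (\<Sum>a\<in>A. x a * y a)"

lemma ip_commute: "ip A x y = ip A y x"
  by (simp add: ip_def mult.commute)

lemma ip_nonneg: "0 \<le> ip A x x"
  by (auto simp: ip_def intro: sum_nonneg)

lemma ip_add_scale_left: "ip A (\<lambda>a. x a + c * y a) z = ip A x z + c * ip A y z"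
  by (simp add: ip_def algebra_simps sum.distrib sum_distrib_left)

lemma ip_add_scale_right: "ip A z (\<lambda>a. x a + c * y a) = ip A z x + c * ip A z y"
  by (simp add: ip_def algebra_simps sum.distrib sum_distrib_left)

lemma ip_sum_left: "ip A (\<lambda>a. \<Sum>i\<in>I. c i * w i a) z = (\<Sum>i\<in>I. c i * ip A (w i) z)"
  unfolding ip_def sum_distrib_right sum_distrib_left
  by (subst sum.swap) (simp add: mult.assoc)

lemma ip_cauchy_schwarz: "(ip A x y)\<^sup>2 \<le> ip A x x * ip A y y"
proof (rule discriminant_nonneg)
  fix s
  have "0 \<le> ip A (\<lambda>a. x a + s * y a) (\<lambda>a. x a + s * y a)" by (rule ip_nonneg)
  also have "\<dots> = ip A x x + 2 * s * ip A x y + s\<^sup>2 * ip A y y"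
    unfolding ip_add_scale_left ip_add_scale_right
    by (simp add: ip_commute[of A y x] power2_eq_square algebra_simps)
  finally show "0 \<le> ip A x x + 2 * s * ip A x y + s\<^sup>2 * ip A y y" .
qed

text \<open>The standard basis vectors.\<close>

abbreviation unit_fun :: "'b \<Rightarrow> 'b \<Rightarrow> real" where
  "unit_fun a \<equiv> (\<lambda>c. of_bool (c = a))"

lemma ip_unit_right: "finite A \<Longrightarrow> a \<in> A \<Longrightarrow> ip A w (unit_fun a) = w a"
  by (simp add: ip_def of_bool_def if_distrib[of "(*) _"] cong: if_cong)

lemma ip_unit_left: "finite A \<Longrightarrow> a \<in> A \<Longrightarrow> ip A (unit_fun a) w = w a"
  using ip_unit_right ip_commute by metis

text \<open>The trace of the \<open>p\<close>-th power of \<open>T\<close> on the coordinates in \<open>A\<close>.\<close>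

definition tr_pow :: "'b set \<Rightarrow> (('b \<Rightarrow> real) \<Rightarrow> 'b \<Rightarrow> real) \<Rightarrow> nat \<Rightarrow> real" where
  "tr_pow A T p = (\<Sum>a\<in>A. (T ^^ p) (unit_fun a) a)"

locale sym_op =
  fixes A :: "'b set" and T :: "('b \<Rightarrow> real) \<Rightarrow> 'b \<Rightarrow> real"
  assumes fin: "finite A"
    and lin: "T (\<lambda>a. x a + c * y a) = (\<lambda>a. T x a + c * T y a)"
    and sym: "ip A (T x) y = ip A x (T y)"
begin

lemma zero: "T (\<lambda>_. 0) = (\<lambda>_. 0)"
  using lin[of "\<lambda>_. 0" "-1" "\<lambda>_. 0"] by simp

lemma lin_sum: "finite I \<Longrightarrow> T (\<lambda>a. \<Sum>i\<in>I. c i * w i a) = (\<lambda>a. \<Sum>i\<in>I. c i * T (w i) a)"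
proof (induction rule: finite_induct)
  case empty then show ?case by (simp add: zero)
next
  case (insert i I)
  then show ?case
    using lin[of "\<lambda>a. \<Sum>i\<in>I. c i * w i a" "c i" "w i"] by (simp add: add.commute)
qed

lemma pow_lin_sum:
  "finite I \<Longrightarrow> (T ^^ j) (\<lambda>a. \<Sum>i\<in>I. c i * w i a) = (\<lambda>a. \<Sum>i\<in>I. c i * (T ^^ j) (w i) a)"
  by (induction j) (simp_all add: lin_sum)

lemma pow_sym: "ip A ((T ^^ j) x) y = ip A x ((T ^^ j) y)"
  by (induction j arbitrary: x y) (simp_all add: sym funpow_swap1)

lemma ip_pow_pow: "ip A ((T ^^ i) x) ((T ^^ j) y) = ip A x ((T ^^ (i + j)) y)"
  by (simp add: pow_sym funpow_add)

lemma tr_pow_even: "tr_pow A T (q + q) = (\<Sum>a\<in>A. ip A ((T ^^ q) (unit_fun a)) ((T ^^ q) (unit_fun a)))"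
  unfolding tr_pow_def ip_pow_pow by (intro sum.cong) (simp_all add: ip_unit_left fin)

text \<open>The spectral radius is bounded by the trace, via the Frobenius norm of \<open>T\<^sup>q\<close>.\<close>

lemma ip_pow_le_tr: "ip A x ((T ^^ (q + q)) x) \<le> tr_pow A T (q + q) * ip A x x"
proof -
  have "ip A x ((T ^^ (q + q)) x) = ip A ((T ^^ q) x) ((T ^^ q) x)"
    by (simp add: ip_pow_pow)
  also have "\<dots> = (\<Sum>a\<in>A. (ip A ((T ^^ q) (unit_fun a)) x)\<^sup>2)"
    unfolding ip_def[of A "(T ^^ q) x"]
    by (intro sum.cong) (simp_all add: pow_sym ip_unit_left fin power2_eq_square)
  also have "\<dots> \<le> (\<Sum>a\<in>A. ip A ((T ^^ q) (unit_fun a)) ((T ^^ q) (unit_fun a)) * ip A x x)"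
    by (intro sum_mono ip_cauchy_schwarz)
  also have "\<dots> = tr_pow A T (q + q) * ip A x x"
    unfolding tr_pow_even by (simp add: sum_distrib_right)
  finally show ?thesis .
qed

lemma ip_pow_expand:
  "ip A v ((T ^^ j) v) = (\<Sum>a\<in>A. \<Sum>c\<in>A. v a * v c * (T ^^ j) (unit_fun c) a)"
proof -
  have "ip A v ((T ^^ j) v) = ip A v ((T ^^ j) (\<lambda>a. \<Sum>c\<in>A. v c * unit_fun c a))"
  proof -
    have "ip A v ((T ^^ j) v) = ip A ((T ^^ j) v) v" by (simp add: ip_commute)
    also have "\<dots> = ip A ((T ^^ j) v) (\<lambda>a. \<Sum>c\<in>A. v c * unit_fun c a)"
      unfolding ip_def
      by (intro sum.cong) (simp_all add: fin of_bool_def if_distrib[of "(*) _"] cong: if_cong)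
    finally show ?thesis by (simp add: pow_sym)
  qed
  also have "\<dots> = (\<Sum>a\<in>A. \<Sum>c\<in>A. v a * v c * (T ^^ j) (unit_fun c) a)"
    unfolding pow_lin_sum[OF fin] by (simp add: ip_def sum_distrib_left mult.assoc)
  finally show ?thesis .
qed

end

text \<open>Symmetric operators with spectrum in \<open>[b, 1]\<close>, where \<open>b > 0\<close>.\<close>

locale pos_op = sym_op +
  fixes b :: real
  assumes b_pos: "0 < b"
    and lower: "b * ip A x x \<le> ip A x (T x)"
    and upper: "ip A x (T x) \<le> ip A x x"
begin

lemma form_nonneg: "0 \<le> ip A x (T x)"
  using lower[of x] b_pos ip_nonneg[of A x] by (meson order_trans mult_nonneg_nonneg less_imp_le)

lemma form_cauchy_schwarz: "(ip A x (T y))\<^sup>2 \<le> ip A x (T x) * ip A y (T y)"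
proof (rule discriminant_nonneg)
  fix s
  have "0 \<le> ip A (\<lambda>a. x a + s * y a) (T (\<lambda>a. x a + s * y a))" by (rule form_nonneg)
  also have "\<dots> = ip A x (T x) + 2 * s * ip A x (T y) + s\<^sup>2 * ip A y (T y)"
    unfolding ip_add_scale_left ip_add_scale_right lin
    by (simp add: ip_commute[of A y "T x"] sym power2_eq_square algebra_simps)
  finally show "0 \<le> ip A x (T x) + 2 * s * ip A x (T y) + s\<^sup>2 * ip A y (T y)" .
qed

lemma contraction: "ip A (T x) (T x) \<le> ip A x x"
proof -
  let ?n = "ip A (T x) (T x)"
  have "?n\<^sup>2 = (ip A x (T (T x)))\<^sup>2" by (simp add: sym)
  also have "\<dots> \<le> ip A x (T x) * ip A (T x) (T (T x))" by (rule form_cauchy_schwarz)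
  also have "\<dots> \<le> ip A x x * ?n"
    by (intro mult_mono upper form_nonneg ip_nonneg)
  finally have "?n * ?n \<le> ip A x x * ?n" by (simp add: power2_eq_square)
  then show ?thesis
    using ip_nonneg[of A "T x"] ip_nonneg[of A x] by (cases "?n = 0") auto
qed

lemma tr_pow_even_antimono: "tr_pow A T (Suc q + Suc q) \<le> tr_pow A T (q + q)"
  unfolding tr_pow_even by (intro sum_mono) (simp add: contraction)

lemma tr_pow_even_bounds: "0 \<le> tr_pow A T (q + q)" "tr_pow A T (q + q) \<le> real (card A)"
proof -
  show "0 \<le> tr_pow A T (q + q)"
    unfolding tr_pow_even by (intro sum_nonneg ip_nonneg)
  show "tr_pow A T (q + q) \<le> real (card A)"
  proof (induction q)
    case 0 show ?case by (simp add: tr_pow_def)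
  next
    case (Suc q) then show ?case using tr_pow_even_antimono[of q] by simp
  qed
qed

text \<open>The sequence \<open>j \<mapsto> \<langle>v, T\<^sup>j v\<rangle>\<close> is a moment sequence, hence log-convex. For even \<open>j\<close> this is the
  Cauchy-Schwarz inequality for the inner product, for odd \<open>j\<close> the one for the form given by \<open>T\<close>.\<close>

lemma moment_nonneg: "0 \<le> ip A v ((T ^^ j) v)"
proof (cases "even j")
  case True
  then obtain i where "j = i + i" by (auto elim!: evenE simp: mult_2)
  then show ?thesis using ip_nonneg by (simp add: ip_pow_pow[symmetric])
next
  case False
  then obtain i where i: "j = i + (1 + i)" by (auto elim!: oddE simp: mult_2)
  show ?thesis unfolding i ip_pow_pow[symmetric]
    using form_nonneg[of "(T ^^ i) v"] by (simp add: ip_commute)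
qed

lemma moment_log_convex:
  "(ip A v ((T ^^ Suc j) v))\<^sup>2 \<le> ip A v ((T ^^ j) v) * ip A v ((T ^^ Suc (Suc j)) v)"
proof (cases "even j")
  case True
  then obtain i where "j = 2 * i" by (rule evenE)
  then have i: "j = i + i" "Suc j = i + Suc i" "Suc (Suc j) = Suc i + Suc i" by auto
  show ?thesis unfolding i(3) unfolding i(2) unfolding i(1) unfolding ip_pow_pow[symmetric]
    by (rule ip_cauchy_schwarz)
next
  case False
  then obtain i where "j = 2 * i + 1" by (rule oddE)
  then have i: "j = i + Suc i" "Suc j = i + Suc (Suc i)" "Suc (Suc j) = Suc i + Suc (Suc i)" by auto
  show ?thesis unfolding i(3) unfolding i(2) unfolding i(1) unfolding ip_pow_pow[symmetric]
    using form_cauchy_schwarz[of "(T ^^ i) v" "(T ^^ Suc i) v"] by simp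
qed

lemma moment_lower_Suc:
  assumes "even j"
  shows "b * ip A v ((T ^^ j) v) \<le> ip A v ((T ^^ Suc j) v)"
proof -
  obtain i where "j = i + i" using assms by (auto elim!: evenE simp: mult_2)
  then have i: "j = i + i" "Suc j = i + Suc i" by auto
  show ?thesis unfolding i(2) unfolding i(1) unfolding ip_pow_pow[symmetric] using lower by simp
qed

lemma moment_pos: "0 < ip A v v \<Longrightarrow> 0 < ip A v ((T ^^ j) v)"
proof (induction j)
  case (Suc j)
  then have j: "0 < ip A v ((T ^^ j) v)" by simp
  show ?case
  proof (cases "even j")
    case True
    then show ?thesis using moment_lower_Suc[of j v] j b_pos by (meson mult_pos_pos order_less_le_trans)
  next
    case False
    then obtain i where i: "j = Suc i" by (cases j) auto
    have "0 < (ip A v ((T ^^ j) v))\<^sup>2" using j by simp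
    also have "\<dots> \<le> ip A v ((T ^^ i) v) * ip A v ((T ^^ Suc j) v)"
      unfolding i by (rule moment_log_convex)
    finally show ?thesis using moment_nonneg[of v i] moment_nonneg[of v "Suc j"]
      by (auto simp: zero_less_mult_iff)
  qed
qed simp

lemma moment_cross_le:
  "i \<le> j \<Longrightarrow> ip A v ((T ^^ Suc i) v) * ip A v ((T ^^ j) v) \<le> ip A v ((T ^^ i) v) * ip A v ((T ^^ Suc j) v)"
proof (induction j rule: dec_induct)
  case base then show ?case by (simp add: mult.commute)
next
  case (step j)
  show ?case
  proof (cases "0 < ip A v v")
    case True
    define m where "m = (\<lambda>j. ip A v ((T ^^ j) v))"
    have pos: "0 < m j" for j unfolding m_def using moment_pos[OF True] .
    have IH: "m (Suc i) * m j \<le> m i * m (Suc j)" using step.IH by (simp add: m_def)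
    have lc: "m (Suc j) * m (Suc j) \<le> m j * m (Suc (Suc j))"
      using moment_log_convex[of v j] by (simp add: m_def power2_eq_square)
    have "m (Suc i) * m (Suc j) * m j \<le> m i * m (Suc (Suc j)) * m j"
      using mult_right_mono[OF IH less_imp_le[OF pos[of "Suc j"]]]
        mult_left_mono[OF lc less_imp_le[OF pos[of i]]] by (simp add: mult_ac)
    then show ?thesis using pos[of j] by (simp add: m_def)
  next
    case False
    then have "ip A v v = 0" using ip_nonneg[of A v] by simp
    then have "(ip A v w)\<^sup>2 \<le> 0" for w using ip_cauchy_schwarz[of A v w] by simp
    then show ?thesis by simp
  qed
qed

lemma moment_prod_le:
  "ip A v ((T ^^ l) v) * ip A v ((T ^^ k) v) \<le> ip A v v * ip A v ((T ^^ (l + k)) v)"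
proof (induction l arbitrary: k)
  case (Suc l)
  show ?case
  proof (cases "l \<le> k")
    case True
    then show ?thesis using moment_cross_le[OF True, of v] Suc[of "Suc k"] by simp
  next
    case False
    have "ip A v ((T ^^ l') v) * ip A v ((T ^^ k) v) \<le> ip A v v * ip A v ((T ^^ (l' + k)) v)"
      if "k \<le> l'" for l'
      using that
    proof (induction k arbitrary: l')
      case (Suc k)
      then show ?case using moment_cross_le[of k l' v] Suc.IH[of "Suc l'"] by (simp add: mult.commute)
    qed (simp add: mult.commute)
    from this[of "Suc l"] show ?thesis using False by simp
  qed
qed simp

text \<open>The power mean inequality for the spectral measure of \<open>v\<close>: the ratios of successive moments
  increase, so they are all at least the first one.\<close>

lemma moment_ratio:
  assumes "\<rho> * ip A v v \<le> ip A v (T v)" "0 \<le> \<rho>"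
  shows "\<rho> ^ p * ip A v v \<le> ip A v ((T ^^ p) v)"
proof (cases "0 < ip A v v")
  case True
  show ?thesis
  proof (induction p)
    case (Suc p)
    have "ip A v (T v) * ip A v ((T ^^ p) v) \<le> ip A v v * ip A v ((T ^^ Suc p) v)"
      using moment_cross_le[of 0 p v] by simp
    moreover have "\<rho> * ip A v v * (\<rho> ^ p * ip A v v) \<le> ip A v (T v) * ip A v ((T ^^ p) v)"
      using Suc assms True form_nonneg by (intro mult_mono) auto
    ultimately have "ip A v v * (\<rho> ^ Suc p * ip A v v) \<le> ip A v v * ip A v ((T ^^ Suc p) v)"
      by (simp add: mult_ac)
    then show ?case using True by simp
  qed simp
next
  case False
  then have "ip A v v = 0" using ip_nonneg[of A v] by simp
  then show ?thesis using moment_nonneg[of v p] by simp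
qed

end

text \<open>The operator \<open>T' = T - v v\<^sup>T\<close>, assumed to stay positive.\<close>

locale rank_one_update = pos_op A T b + U: pos_op A T' b'
  for A :: "'b set" and T T' b b' +
  fixes v :: "'b \<Rightarrow> real"
  assumes T': "T' w = (\<lambda>a. T w a + (- ip A v w) * v a)"
begin

text \<open>Telescoping \<open>T'\<^sup>j - T\<^sup>j\<close>, with all factors \<open>T'\<close> to the right of the removed \<open>v v\<^sup>T\<close>.\<close>

lemma update_pow:
  "(T' ^^ j) w a = (T ^^ j) w a - (\<Sum>l<j. ip A v ((T' ^^ l) w) * (T ^^ (j - 1 - l)) v a)"
proof (induction j arbitrary: a)
  case (Suc j)
  have eq: "(T' ^^ j) w = (\<lambda>a. (T ^^ j) w a + (-1) * (\<Sum>l<j. ip A v ((T' ^^ l) w) * (T ^^ (j - 1 - l)) v a))"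
    using Suc by (intro ext) simp
  have "(T' ^^ Suc j) w a = T ((T' ^^ j) w) a - ip A v ((T' ^^ j) w) * v a"
    by (simp add: T')
  also have "T ((T' ^^ j) w) a = T ((T ^^ j) w) a
      + (-1) * T (\<lambda>a. \<Sum>l<j. ip A v ((T' ^^ l) w) * (T ^^ (j - 1 - l)) v a) a"
    unfolding eq lin ..
  also have "T (\<lambda>a. \<Sum>l<j. ip A v ((T' ^^ l) w) * (T ^^ (j - 1 - l)) v a) a
      = (\<Sum>l<j. ip A v ((T' ^^ l) w) * (T ^^ (j - l)) v a)"
    unfolding lin_sum[OF finite_lessThan]
    by (intro sum.cong) (auto simp: Suc_diff_Suc simp flip: funpow.simps(2) comp_apply[of T])
  finally show ?case by simp
qed simp

lemma update_moment:
  "ip A ((T' ^^ l) v) ((T ^^ i) v) = ip A v ((T ^^ (l + i)) v)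
     - (\<Sum>k<l. ip A v ((T' ^^ k) v) * ip A v ((T ^^ (l - 1 - k + i)) v))"
proof -
  have "(T' ^^ l) v = (\<lambda>a. (T ^^ l) v a
      + (-1) * (\<Sum>k<l. ip A v ((T' ^^ k) v) * (T ^^ (l - 1 - k)) v a))"
    by (rule ext) (simp add: update_pow)
  then have "ip A ((T' ^^ l) v) ((T ^^ i) v) = ip A ((T ^^ l) v) ((T ^^ i) v)
     + (-1) * (\<Sum>k<l. ip A v ((T' ^^ k) v) * ip A ((T ^^ (l - 1 - k)) v) ((T ^^ i) v))"
    by (simp only: ip_add_scale_left ip_sum_left)
  then show ?thesis by (simp add: ip_pow_pow)
qed

lemma update_moment_le: "ip A v ((T' ^^ l) v) \<le> ip A v ((T ^^ l) v)"
  using update_moment[of l 0]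
    sum_nonneg[of "{..<l}" "\<lambda>k. ip A v ((T' ^^ k) v) * ip A v ((T ^^ (l - 1 - k)) v)"]
  by (simp add: ip_commute[of A _ v] moment_nonneg U.moment_nonneg)

lemma update_moment_ge:
  assumes "l + i = Suc q"
  shows "ip A v ((T ^^ Suc q) v) - real l * (ip A v v * ip A v ((T ^^ q) v))
    \<le> ip A ((T' ^^ l) v) ((T ^^ i) v)"
proof -
  have "(\<Sum>k<l. ip A v ((T' ^^ k) v) * ip A v ((T ^^ (l - 1 - k + i)) v))
     \<le> (\<Sum>k<l. ip A v v * ip A v ((T ^^ q) v))"
  proof (rule sum_mono)
    fix k assume "k \<in> {..<l}"
    then have q: "q = k + (l - 1 - k + i)" using assms by auto
    have "ip A v ((T' ^^ k) v) * ip A v ((T ^^ (l - 1 - k + i)) v)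
       \<le> ip A v ((T ^^ k) v) * ip A v ((T ^^ (l - 1 - k + i)) v)"
      by (intro mult_right_mono update_moment_le moment_nonneg)
    also have "\<dots> \<le> ip A v v * ip A v ((T ^^ (k + (l - 1 - k + i))) v)" by (rule moment_prod_le)
    finally show "ip A v ((T' ^^ k) v) * ip A v ((T ^^ (l - 1 - k + i)) v)
      \<le> ip A v v * ip A v ((T ^^ q) v)" using q by simp
  qed
  then show ?thesis using assms by (simp add: update_moment)
qed

text \<open>A second-order Taylor bound for the trace of a power under a rank-one perturbation. It
  replaces the Golden-Thompson inequality, which rank-one summands make unnecessary.\<close>

lemma tr_pow_update_le:
  "tr_pow A T' (Suc (Suc q)) \<le> tr_pow A T (Suc (Suc q))
     - real (q + 2) * ip A v ((T ^^ Suc q) v)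
     + real (q + 2) * real (q + 1) / 2 * ip A v v * ip A v ((T ^^ q) v)"
proof -
  let ?p = "Suc (Suc q)"
  let ?S = "\<Sum>l<?p. ip A ((T' ^^ l) v) ((T ^^ (Suc q - l)) v)"
  have "tr_pow A T' ?p = tr_pow A T ?p
      - (\<Sum>a\<in>A. \<Sum>l<?p. ip A v ((T' ^^ l) (unit_fun a)) * (T ^^ (Suc q - l)) v a)"
    unfolding tr_pow_def sum_subtractf[symmetric] by (intro sum.cong refl) (subst update_pow, simp)
  also have "(\<Sum>a\<in>A. \<Sum>l<?p. ip A v ((T' ^^ l) (unit_fun a)) * (T ^^ (Suc q - l)) v a) = ?S"
    by (subst sum.swap)
      (auto simp: ip_def[of A "(T' ^^ _) v"] U.pow_sym[symmetric] ip_unit_right fin intro!: sum.cong)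
  finally have tr: "tr_pow A T' ?p = tr_pow A T ?p - ?S" .
  have "(\<Sum>l<?p. ip A v ((T ^^ Suc q) v) - real l * (ip A v v * ip A v ((T ^^ q) v))) \<le> ?S"
    by (intro sum_mono update_moment_ge) auto
  moreover have "(\<Sum>l<?p. ip A v ((T ^^ Suc q) v) - real l * (ip A v v * ip A v ((T ^^ q) v)))
     = real ?p * ip A v ((T ^^ Suc q) v) - (\<Sum>l<?p. real l) * (ip A v v * ip A v ((T ^^ q) v))"
    by (simp only: sum_subtractf sum_distrib_right[symmetric] sum_constant card_lessThan)
  moreover have "(\<Sum>l<?p. real l) = real (q + 2) * real (q + 1) / 2"
    by (induction q) (simp_all add: field_simps)
  ultimately show ?thesis unfolding tr by (simp only: mult.assoc) simp
qed

lemma tr_pow_update_even: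
  assumes "even q"
  shows "tr_pow A T' (Suc (Suc q)) \<le> tr_pow A T (Suc (Suc q))
     - (real (q + 2) * b - real (q + 2) * real (q + 1) / 2 * ip A v v) * ip A v ((T ^^ q) v)"
proof -
  have "real (q + 2) * (b * ip A v ((T ^^ q) v)) \<le> real (q + 2) * ip A v ((T ^^ Suc q) v)"
    by (intro mult_left_mono moment_lower_Suc assms) simp
  with tr_pow_update_le[of q] show ?thesis
    unfolding left_diff_distrib mult.assoc by linarith
qed

end

section \<open>Square-integrable functions\<close>

lemma L2_measurable: "f \<in> L2 M \<Longrightarrow> f \<in> borel_measurable M"
  by (simp add: L2_def)

lemma L2_square_integrable: "f \<in> L2 M \<Longrightarrow> integrable M (\<lambda>x. (f x)\<^sup>2)"
  by (simp add: L2_def)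

lemma L2_mult_integrable:
  assumes "f \<in> L2 M" "g \<in> L2 M"
  shows "integrable M (\<lambda>x. f x * g x)"
proof (rule Bochner_Integration.integrable_bound)
  show "integrable M (\<lambda>x. (f x)\<^sup>2 + (g x)\<^sup>2)" using assms by (simp add: L2_def)
  show "(\<lambda>x. f x * g x) \<in> borel_measurable M" using assms by (auto simp: L2_def)
  have "\<bar>a * b\<bar> \<le> a\<^sup>2 + b\<^sup>2" for a b :: real
  proof -
    have "2 * (\<bar>a\<bar> * \<bar>b\<bar>) \<le> a\<^sup>2 + b\<^sup>2" using sum_squares_bound[of "\<bar>a\<bar>" "\<bar>b\<bar>"] by simp
    moreover have "0 \<le> \<bar>a\<bar> * \<bar>b\<bar>" by simp
    ultimately show ?thesis unfolding abs_mult by linarith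
  qed
  then show "AE x in M. norm (f x * g x) \<le> norm ((f x)\<^sup>2 + (g x)\<^sup>2)" by simp
qed

lemma L2_scale: "f \<in> L2 M \<Longrightarrow> (\<lambda>x. c * f x) \<in> L2 M"
  by (auto simp: L2_def power_mult_distrib)

lemma L2_add: "f \<in> L2 M \<Longrightarrow> g \<in> L2 M \<Longrightarrow> (\<lambda>x. f x + g x) \<in> L2 M"
  using L2_mult_integrable[of f M g] by (auto simp: L2_def power2_sum mult.assoc)

lemma L2_diff: "f \<in> L2 M \<Longrightarrow> g \<in> L2 M \<Longrightarrow> (\<lambda>x. f x - g x) \<in> L2 M"
  using L2_add[of f M "\<lambda>x. -1 * g x"] L2_scale[of g M "-1"] by simp

lemma L2_zero: "(\<lambda>_. 0) \<in> L2 M"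
  by (simp add: L2_def)

lemma L2_sum: "(\<And>i. i \<in> I \<Longrightarrow> F i \<in> L2 M) \<Longrightarrow> (\<lambda>x. \<Sum>i\<in>I. F i x) \<in> L2 M"
  by (induction I rule: infinite_finite_induct) (simp_all add: L2_zero L2_add)

lemma L2_const: "finite_measure M \<Longrightarrow> (\<lambda>_. c) \<in> L2 M"
  by (simp add: L2_def finite_measure.integrable_const)

lemma L2_integrable: "finite_measure M \<Longrightarrow> f \<in> L2 M \<Longrightarrow> integrable M f"
  using L2_mult_integrable[of f M "\<lambda>_. 1"] L2_const[of M 1] by simp

lemma L2_cauchy_schwarz:
  assumes "f \<in> L2 M" "g \<in> L2 M"
  shows "(\<integral>x. f x * g x \<partial>M)\<^sup>2 \<le> (\<integral>x. (f x)\<^sup>2 \<partial>M) * (\<integral>x. (g x)\<^sup>2 \<partial>M)"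
proof (rule discriminant_nonneg)
  fix s
  have "0 \<le> (\<integral>x. (f x + s * g x)\<^sup>2 \<partial>M)" by simp
  also have "(\<integral>x. (f x + s * g x)\<^sup>2 \<partial>M)
      = (\<integral>x. (f x)\<^sup>2 + 2 * s * (f x * g x) + s\<^sup>2 * (g x)\<^sup>2 \<partial>M)"
    by (simp add: power2_eq_square algebra_simps)
  also have "\<dots> = (\<integral>x. (f x)\<^sup>2 \<partial>M) + 2 * s * (\<integral>x. f x * g x \<partial>M) + s\<^sup>2 * (\<integral>x. (g x)\<^sup>2 \<partial>M)"
    using assms by (simp add: L2_square_integrable L2_mult_integrable)
  finally show "0 \<le> (\<integral>x. (f x)\<^sup>2 \<partial>M) + 2 * s * (\<integral>x. f x * g x \<partial>M) + s\<^sup>2 * (\<integral>x. (g x)\<^sup>2 \<partial>M)" .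
qed

section \<open>Existence of the Sobol-Hoeffding decomposition\<close>

text \<open>The point with the coordinates of \<open>x\<close> in \<open>U\<close> and those of \<open>y\<close> elsewhere.\<close>

definition mix :: "'i set \<Rightarrow> ('i \<Rightarrow> 'b) \<Rightarrow> ('i \<Rightarrow> 'b) \<Rightarrow> 'i \<Rightarrow> 'b" where
  "mix U x y = (\<lambda>j. if j \<in> U then x j else y j)"

locale marginals =
  fixes \<mu> :: "'i::finite \<Rightarrow> real measure"
  assumes \<mu>_prob: "\<And>i. prob_space (\<mu> i)"
begin

sublocale product_prob_space \<mu> "UNIV :: 'i set"
  by (rule product_prob_spaceI) (rule \<mu>_prob)

sublocale pair_sigma_finite "prodm \<mu>" "prodm \<mu>" ..

lemma pair_sigma_finite_coord: "pair_sigma_finite (prodm \<mu>) (\<mu> i)" ..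

lemma prodm_finite: "finite_measure (prodm \<mu>)"
  by (rule P.finite_measure_axioms)

lemma measurable_mix [measurable]:
  "(\<lambda>(x, y). mix U x y) \<in> prodm \<mu> \<Otimes>\<^sub>M prodm \<mu> \<rightarrow>\<^sub>M prodm \<mu>"
  unfolding mix_def case_prod_beta
  by (rule measurable_PiM_single') (auto simp: space_pair_measure space_PiM PiE_def Pi_def)

text \<open>Mixing two independent points, or resampling one coordinate, preserves the product measure.\<close>

lemma distr_mix: "distr (prodm \<mu> \<Otimes>\<^sub>M prodm \<mu>) (prodm \<mu>) (\<lambda>(x, y). mix U x y) = prodm \<mu>"
proof (rule PiM_eqI)
  fix A :: "'i \<Rightarrow> real set" assume A: "\<And>i. i \<in> UNIV \<Longrightarrow> A i \<in> sets (\<mu> i)"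
  define B where "B = (\<lambda>i. if i \<in> U then A i else space (\<mu> i))"
  define C where "C = (\<lambda>i. if i \<in> U then space (\<mu> i) else A i)"
  have BC: "B i \<in> sets (\<mu> i)" "C i \<in> sets (\<mu> i)" for i using A by (auto simp: B_def C_def)
  have sub: "A i \<subseteq> space (\<mu> i)" for i using A sets.sets_into_space by blast
  have "(\<lambda>(x, y). mix U x y) -` Pi\<^sub>E UNIV A \<inter> space (prodm \<mu> \<Otimes>\<^sub>M prodm \<mu>)
      = Pi\<^sub>E UNIV B \<times> Pi\<^sub>E UNIV C"
    using sub by (auto simp: space_pair_measure space_PiM PiE_def Pi_def mix_def B_def C_def
      split: if_splits)
  then have "emeasure (distr (prodm \<mu> \<Otimes>\<^sub>M prodm \<mu>) (prodm \<mu>) (\<lambda>(x, y). mix U x y)) (Pi\<^sub>E UNIV A)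
      = emeasure (prodm \<mu> \<Otimes>\<^sub>M prodm \<mu>) (Pi\<^sub>E UNIV B \<times> Pi\<^sub>E UNIV C)"
    using A by (subst emeasure_distr) (auto intro!: sets_PiM_I_finite)
  also have "\<dots> = emeasure (prodm \<mu>) (Pi\<^sub>E UNIV B) * emeasure (prodm \<mu>) (Pi\<^sub>E UNIV C)"
    using BC by (intro sigma_finite_measure.emeasure_pair_measure_Times[OF prob_space_imp_sigma_finite[OF P.prob_space_axioms]] sets_PiM_I_finite) auto
  also have "\<dots> = (\<Prod>i\<in>UNIV. emeasure (\<mu> i) (B i)) * (\<Prod>i\<in>UNIV. emeasure (\<mu> i) (C i))"
    using BC by (simp add: emeasure_PiM)
  also have "\<dots> = (\<Prod>i\<in>UNIV. emeasure (\<mu> i) (A i))"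
    unfolding prod.distrib[symmetric]
    by (rule prod.cong) (simp_all add: B_def C_def prob_space.emeasure_space_1[OF \<mu>_prob])
  finally show "emeasure (distr (prodm \<mu> \<Otimes>\<^sub>M prodm \<mu>) (prodm \<mu>) (\<lambda>(x, y). mix U x y)) (Pi\<^sub>E UNIV A)
      = (\<Prod>i\<in>UNIV. emeasure (\<mu> i) (A i))" .
qed auto

lemma measurable_update: "(\<lambda>(x, t). x(i := t)) \<in> prodm \<mu> \<Otimes>\<^sub>M \<mu> i \<rightarrow>\<^sub>M prodm \<mu>"
  using measurable_add_dim[of i UNIV \<mu>] by simp

lemma distr_update: "distr (prodm \<mu> \<Otimes>\<^sub>M \<mu> i) (prodm \<mu>) (\<lambda>(x, t). x(i := t)) = prodm \<mu>"
proof (rule PiM_eqI)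
  interpret C: pair_sigma_finite "prodm \<mu>" "\<mu> i" by (rule pair_sigma_finite_coord)
  fix A :: "'i \<Rightarrow> real set" assume A: "\<And>i. i \<in> UNIV \<Longrightarrow> A i \<in> sets (\<mu> i)"
  define B where "B = A(i := space (\<mu> i))"
  have B: "B j \<in> sets (\<mu> j)" for j using A by (auto simp: B_def)
  have sub: "A i \<subseteq> space (\<mu> i)" for i using A sets.sets_into_space by blast
  have "(\<lambda>(x, t). x(i := t)) -` Pi\<^sub>E UNIV A \<inter> space (prodm \<mu> \<Otimes>\<^sub>M \<mu> i) = Pi\<^sub>E UNIV B \<times> A i"
    using sub by (auto simp: space_pair_measure space_PiM PiE_def Pi_def B_def split: if_splits)
      (metis subsetD)+
  then have "emeasure (distr (prodm \<mu> \<Otimes>\<^sub>M \<mu> i) (prodm \<mu>) (\<lambda>(x, t). x(i := t))) (Pi\<^sub>E UNIV A)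
      = emeasure (prodm \<mu> \<Otimes>\<^sub>M \<mu> i) (Pi\<^sub>E UNIV B \<times> A i)"
    using A by (subst emeasure_distr) (auto intro!: sets_PiM_I_finite measurable_update)
  also have "\<dots> = emeasure (prodm \<mu>) (Pi\<^sub>E UNIV B) * emeasure (\<mu> i) (A i)"
    using B A by (intro sigma_finite_measure.emeasure_pair_measure_Times[OF prob_space_imp_sigma_finite[OF \<mu>_prob]] sets_PiM_I_finite) auto
  also have "\<dots> = (\<Prod>j\<in>UNIV. emeasure (\<mu> j) (B j)) * emeasure (\<mu> i) (A i)"
    using B by (simp add: emeasure_PiM)
  also have "\<dots> = (\<Prod>j\<in>UNIV. emeasure (\<mu> j) (A j))"
    by (subst (1 2) prod.remove[of UNIV i])
      (auto simp: B_def prob_space.emeasure_space_1[OF \<mu>_prob] mult.commute intro!: prod.cong)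
  finally show "emeasure (distr (prodm \<mu> \<Otimes>\<^sub>M \<mu> i) (prodm \<mu>) (\<lambda>(x, t). x(i := t))) (Pi\<^sub>E UNIV A)
      = (\<Prod>i\<in>UNIV. emeasure (\<mu> i) (A i))" .
qed auto

lemma integrable_update_pair:
  assumes "integrable (prodm \<mu>) g"
  shows "integrable (prodm \<mu> \<Otimes>\<^sub>M \<mu> i) (\<lambda>(x, t). g (x(i := t)) :: real)"
  using assms integrable_distr[OF measurable_update, of i g] unfolding distr_update
  by (simp add: case_prod_unfold)

lemma integral_update_pair:
  assumes "g \<in> borel_measurable (prodm \<mu>)"
  shows "(\<integral>z. (case z of (x, t) \<Rightarrow> g (x(i := t))) \<partial>(prodm \<mu> \<Otimes>\<^sub>M \<mu> i)) = (\<integral>x. g x \<partial>prodm \<mu> :: real)"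
  using integral_distr[OF measurable_update, of g i] assms unfolding distr_update
  by (simp add: case_prod_unfold)

lemma integral_update:
  assumes "integrable (prodm \<mu>) (g :: _ \<Rightarrow> real)"
  shows "(\<integral>x. (\<integral>t. g (x(i := t)) \<partial>\<mu> i) \<partial>prodm \<mu>) = (\<integral>x. g x \<partial>prodm \<mu>)"
proof -
  interpret C: pair_sigma_finite "prodm \<mu>" "\<mu> i" by (rule pair_sigma_finite_coord)
  show ?thesis
    using C.integral_fst'[OF integrable_update_pair[OF assms, of i]] assms
    by (simp add: integral_update_pair)
qed

lemma integral_update_swap:
  assumes "integrable (prodm \<mu>) (g :: _ \<Rightarrow> real)"
  shows "(\<integral>t. (\<integral>x. g (x(i := t)) \<partial>prodm \<mu>) \<partial>\<mu> i) = (\<integral>x. g x \<partial>prodm \<mu>)"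
    "integrable (\<mu> i) (\<lambda>t. \<integral>x. g (x(i := t)) \<partial>prodm \<mu>)"
proof -
  interpret C: pair_sigma_finite "prodm \<mu>" "\<mu> i" by (rule pair_sigma_finite_coord)
  show "(\<integral>t. (\<integral>x. g (x(i := t)) \<partial>prodm \<mu>) \<partial>\<mu> i) = (\<integral>x. g x \<partial>prodm \<mu>)"
    using C.integral_snd[OF integrable_update_pair[OF assms, of i]] assms
    by (simp add: integral_update_pair)
  show "integrable (\<mu> i) (\<lambda>t. \<integral>x. g (x(i := t)) \<partial>prodm \<mu>)"
    using C.integrable_snd[OF integrable_update_pair[OF assms, of i]] .
qed

text \<open>A version of the conditional mean of \<open>f\<close> given the coordinates in \<open>U\<close>. At points where the
  inner integral does not exist it is zero, which affects a null set only.\<close>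

definition cond_mean :: "(('i \<Rightarrow> real) \<Rightarrow> real) \<Rightarrow> 'i set \<Rightarrow> ('i \<Rightarrow> real) \<Rightarrow> real" where
  "cond_mean f U x = (\<integral>y. f (mix U x y) \<partial>prodm \<mu>)"

lemma integrable_mix_pair:
  assumes "integrable (prodm \<mu>) g"
  shows "integrable (prodm \<mu> \<Otimes>\<^sub>M prodm \<mu>) (\<lambda>(x, y). g (mix U x y) :: real)"
  using assms integrable_distr[OF measurable_mix, of U g] unfolding distr_mix
  by (simp add: case_prod_unfold)

lemma AE_integrable_mix:
  assumes "integrable (prodm \<mu>) (g :: _ \<Rightarrow> real)"
  shows "AE x in prodm \<mu>. integrable (prodm \<mu>) (\<lambda>y. g (mix U x y))"
  using AE_integrable_fst'[OF integrable_mix_pair[OF assms, of U]] by simp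

lemma cond_mean_L2:
  assumes "f \<in> L2 (prodm \<mu>)"
  shows "cond_mean f U \<in> L2 (prodm \<mu>)"
proof -
  note [measurable] = L2_measurable[OF assms]
  note int = L2_integrable[OF prodm_finite assms]
  note sq = L2_square_integrable[OF assms]
  have meas [measurable]: "cond_mean f U \<in> borel_measurable (prodm \<mu>)"
    unfolding cond_mean_def by measurable
  have "integrable (prodm \<mu>) (\<lambda>x. (cond_mean f U x)\<^sup>2)"
  proof (rule Bochner_Integration.integrable_bound)
    show "integrable (prodm \<mu>) (\<lambda>x. \<integral>y. (f (mix U x y))\<^sup>2 \<partial>prodm \<mu>)"
      using integrable_fst'[OF integrable_mix_pair[OF sq, of U]] by simp
    show "AE x in prodm \<mu>. norm ((cond_mean f U x)\<^sup>2) \<le> norm (\<integral>y. (f (mix U x y))\<^sup>2 \<partial>prodm \<mu>)"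
      using AE_integrable_mix[OF int, of U] AE_integrable_mix[OF sq, of U]
    proof eventually_elim
      case (elim x)
      then have "(\<lambda>y. f (mix U x y)) \<in> L2 (prodm \<mu>)" by (simp add: L2_def)
      from L2_cauchy_schwarz[OF this L2_const[OF prodm_finite, of 1]]
      show ?case by (simp add: cond_mean_def P.prob_space)
    qed
  qed measurable
  then show ?thesis by (simp add: L2_def)
qed

lemma cond_mean_UNIV: "cond_mean f UNIV x = f x"
  by (simp add: cond_mean_def mix_def P.prob_space)

lemma cond_mean_empty: "cond_mean f {} x = (\<integral>y. f y \<partial>prodm \<mu>)"
  by (simp add: cond_mean_def mix_def)

lemma cond_mean_cong: "(\<And>i. i \<in> U \<Longrightarrow> x i = y i) \<Longrightarrow> cond_mean f U x = cond_mean f U y"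
proof -
  assume "\<And>i. i \<in> U \<Longrightarrow> x i = y i"
  then have "mix U x = mix U y" by (auto simp: mix_def fun_eq_iff)
  then show ?thesis by (simp add: cond_mean_def)
qed

text \<open>Tower property: averaging over one more coordinate.\<close>

lemma cond_mean_insert:
  assumes f: "integrable (prodm \<mu>) f" and i: "i \<notin> V"
  shows "AE x in prodm \<mu>. (\<integral>t. cond_mean f (insert i V) (x(i := t)) \<partial>\<mu> i) = cond_mean f V x
    \<and> integrable (\<mu> i) (\<lambda>t. cond_mean f (insert i V) (x(i := t)))"
  using AE_integrable_mix[OF f, of V]
proof eventually_elim
  case (elim x)
  have "mix (insert i V) (x(i := t)) y = mix V x (y(i := t))" for y t
    using i by (auto simp: mix_def fun_eq_iff)
  then show ?case using integral_update_swap[OF elim, of i] by (simp add: cond_mean_def)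
qed

text \<open>The component for \<open>U\<close> as an alternating sum of conditional means; the sign
  \<open>(-1) ^ (card U - card V)\<close> is split into two factors.\<close>

definition anova :: "(('i \<Rightarrow> real) \<Rightarrow> real) \<Rightarrow> 'i set \<Rightarrow> ('i \<Rightarrow> real) \<Rightarrow> real" where
  "anova f U x = (-1) ^ card U * (\<Sum>V\<in>Pow U. (-1) ^ card V * cond_mean f V x)"

text \<open>Moebius inversion over the subsets of \<open>S\<close>.\<close>

lemma anova_sum: "cond_mean f S x = (\<Sum>U\<in>Pow S. anova f U x)"
  unfolding anova_def
  by (rule inclusion_exclusion_symmetric) auto

lemma anova_decomposition:
  assumes f: "f \<in> L2 (prodm \<mu>)"
  shows "sobol_decomposition \<mu> f (anova f)"
  unfolding sobol_decomposition_def
proof (intro conjI allI ballI impI)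
  fix U
  show "anova f U \<in> L2 (prodm \<mu>)"
    unfolding anova_def by (intro L2_scale L2_sum cond_mean_L2 f)
next
  show "AE x in prodm \<mu>. f x = (\<Sum>U\<in>UNIV. anova f U x)"
    using anova_sum[of f UNIV] by (simp add: cond_mean_UNIV)
next
  fix U :: "'i set" and x y assume "\<forall>i\<in>U. x i = (y i :: real)"
  then have "cond_mean f V x = cond_mean f V y" if "V \<in> Pow U" for V
    using that by (intro cond_mean_cong) auto
  then show "anova f U x = anova f U y" by (simp add: anova_def)
next
  fix x show "anova f {} x = (\<integral>y. f y \<partial>prodm \<mu>)" by (simp add: anova_def cond_mean_empty)
next
  fix U :: "'i set" and i assume "i \<in> U"
  define W where "W = U - {i}"
  have W: "U = insert i W" "i \<notin> W" using \<open>i \<in> U\<close> by (auto simp: W_def)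
  note int = L2_integrable[OF prodm_finite f]
  \<comment> \<open>pair each subset \<open>V\<close> of \<open>U - {i}\<close> with \<open>insert i V\<close>: averaging over coordinate \<open>i\<close> makes
    the two terms equal, and they carry opposite signs\<close>
  have "AE x in prodm \<mu>. \<forall>V\<in>Pow W. (\<integral>t. cond_mean f (insert i V) (x(i := t)) \<partial>\<mu> i) = cond_mean f V x
    \<and> integrable (\<mu> i) (\<lambda>t. cond_mean f (insert i V) (x(i := t)))"
    using W by (intro AE_finite_allI cond_mean_insert int) auto
  then show "AE x in prodm \<mu>. (\<integral>t. anova f U (x(i := t)) \<partial>\<mu> i) = 0"
  proof eventually_elim
    case (elim x)
    have V: "cond_mean f V (x(i := t)) = cond_mean f V x" if "V \<in> Pow W" for V t
      using that W by (intro cond_mean_cong) auto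
    have "anova f U (x(i := t)) = (-1) ^ card U *
        (\<Sum>V\<in>Pow W. (-1) ^ card V * (cond_mean f V x - cond_mean f (insert i V) (x(i := t))))" for t
    proof -
      have fin: "finite V" for V :: "'i set" by simp
      have "(\<Sum>V\<in>Pow U. (-1) ^ card V * cond_mean f V (x(i := t)))
         = (\<Sum>V\<in>Pow W. (-1) ^ card V * cond_mean f V (x(i := t)))
           + (\<Sum>V\<in>insert i ` Pow W. (-1) ^ card V * cond_mean f V (x(i := t)))"
        unfolding W(1) Pow_insert using W(2) by (intro sum.union_disjoint) auto
      also have "(\<Sum>V\<in>insert i ` Pow W. (-1) ^ card V * cond_mean f V (x(i := t)))
         = (\<Sum>V\<in>Pow W. (-1) ^ card (insert i V) * cond_mean f (insert i V) (x(i := t)))"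
        using W(2) by (subst sum.reindex) (auto simp: inj_on_def)
      also have "\<dots> = (\<Sum>V\<in>Pow W. - ((-1) ^ card V * cond_mean f (insert i V) (x(i := t))))"
        using W(2) by (intro sum.cong refl) (auto simp: card_insert_if[OF fin])
      finally have "(\<Sum>V\<in>Pow U. (-1) ^ card V * cond_mean f V (x(i := t)))
         = (\<Sum>V\<in>Pow W. (-1) ^ card V * cond_mean f V (x(i := t))
             + - ((-1) ^ card V * cond_mean f (insert i V) (x(i := t))))"
        by (simp only: sum.distrib)
      also have "\<dots> = (\<Sum>V\<in>Pow W. (-1) ^ card V * (cond_mean f V x - cond_mean f (insert i V) (x(i := t))))"
        by (rule sum.cong[OF refl]) (simp only: V right_diff_distrib add_uminus_conv_diff)
      finally show ?thesis by (simp only: anova_def)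
    qed
    then show ?case
      using elim by (simp add: prob_space.prob_space[OF \<mu>_prob] finite_measure.integrable_const[OF prob_space.axioms(1)[OF \<mu>_prob]])
  qed
qed

lemma sobol_component_decomposition:
  "f \<in> L2 (prodm \<mu>) \<Longrightarrow> sobol_decomposition \<mu> f (sobol_component \<mu> f)"
  unfolding sobol_component_def by (rule someI[of _ "anova f"]) (rule anova_decomposition)

end

section \<open>Stability of Sobol' indices\<close>

text \<open>\<open>A1, A2\<close> and \<open>B1, B2\<close> are the squared norms of the parts of two vectors in a subspace and in
  its orthogonal complement, \<open>c1, c2\<close> the inner products of corresponding parts and \<open>D\<close> a bound for
  the squared distance. In the proof \<open>x\<close> and \<open>y\<close> are the sines of the difference and of the sum
  of the angles that the two vectors, reduced to the norms of their parts, make with the subspace;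
  the difference of the squared cosines is \<open>x * y\<close>.\<close>

lemma angle_comparison:
  fixes A1 A2 B1 B2 c1 c2 D :: real
  assumes nonneg: "0 \<le> A1" "0 \<le> A2" "0 \<le> B1" "0 \<le> B2"
    and A: "0 < A1 + A2" and B: "0 < B1 + B2"
    and c: "c1\<^sup>2 \<le> A1 * B1" "c2\<^sup>2 \<le> A2 * B2"
    and D: "(A1 + B1 - 2 * c1) + (A2 + B2 - 2 * c2) \<le> D"
  defines "s \<equiv> A1 / (A1 + A2)" and "t \<equiv> B1 / (B1 + B2)" and "\<delta> \<equiv> D / (A1 + A2)"
  shows "(s - t)\<^sup>2 \<le> \<delta>" "\<bar>s - t\<bar> \<le> \<delta> + 2 * sqrt s * sqrt \<delta>"
proof -
  define a1 where "a1 = sqrt A1"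
  define a2 where "a2 = sqrt A2"
  define b1 where "b1 = sqrt B1"
  define b2 where "b2 = sqrt B2"
  define a where "a = sqrt (A1 + A2)"
  define b where "b = sqrt (B1 + B2)"
  note defs = a1_def a2_def b1_def b2_def a_def b_def
  have sq: "A1 = a1\<^sup>2" "A2 = a2\<^sup>2" "B1 = b1\<^sup>2" "B2 = b2\<^sup>2" "a\<^sup>2 = a1\<^sup>2 + a2\<^sup>2" "b\<^sup>2 = b1\<^sup>2 + b2\<^sup>2"
    using nonneg by (simp_all add: defs)
  have pos: "0 \<le> a1" "0 \<le> a2" "0 \<le> b1" "0 \<le> b2" "0 < a" "0 < b"
    using nonneg A B by (simp_all add: defs)
  define x where "x = (a1 * b2 - a2 * b1) / (a * b)"
  define y where "y = (a1 * b2 + a2 * b1) / (a * b)"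
  have st: "s - t = x * y"
  proof -
    have "s - t = (a1\<^sup>2 * b\<^sup>2 - b1\<^sup>2 * a\<^sup>2) / (a\<^sup>2 * b\<^sup>2)"
      using pos by (simp add: s_def t_def sq(1-4) sq(5,6)[symmetric] field_simps)
    also have "a1\<^sup>2 * b\<^sup>2 - b1\<^sup>2 * a\<^sup>2 = (a1 * b2 - a2 * b1) * (a1 * b2 + a2 * b1)"
      unfolding sq(5,6) by (simp add: power2_eq_square algebra_simps)
    finally show ?thesis by (simp add: x_def y_def power2_eq_square mult_ac)
  qed
  have c1: "c1 \<le> a1 * b1"
    using c(1) pos unfolding sq by (simp add: power_mult_distrib[symmetric] power2_le_iff_abs_le)
  have c2: "c2 \<le> a2 * b2"
    using c(2) pos unfolding sq by (simp add: power_mult_distrib[symmetric] power2_le_iff_abs_le)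
  have x: "x\<^sup>2 \<le> \<delta>"
  proof -
    define g where "g = a1 * b1 + a2 * b2"
    have "(a1 * b2 - a2 * b1)\<^sup>2 = a\<^sup>2 * b\<^sup>2 - g\<^sup>2"
      unfolding sq(5,6) g_def by (simp add: power2_eq_square algebra_simps)
    also have "\<dots> \<le> b\<^sup>2 * (a\<^sup>2 + b\<^sup>2 - 2 * g)"
      using zero_le_power2[of "b\<^sup>2 - g"] by (simp add: power2_eq_square algebra_simps)
    also have "\<dots> \<le> b\<^sup>2 * D"
      using D c1 c2 unfolding sq by (intro mult_left_mono) (auto simp: g_def)
    finally show ?thesis
      using pos unfolding x_def \<delta>_def sq(1,2) sq(5)[symmetric]
      by (simp add: power_divide power_mult_distrib divide_simps)
        (simp add: power2_eq_square mult_ac)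
  qed
  have y0: "0 \<le> y" using pos by (simp add: y_def)
  have y1: "y \<le> 1"
  proof -
    have "(a1 * b2 + a2 * b1)\<^sup>2 + (a1 * b1 - a2 * b2)\<^sup>2 = (a * b)\<^sup>2"
      unfolding power_mult_distrib sq(5,6) by (simp add: power2_eq_square algebra_simps)
    then have "(a1 * b2 + a2 * b1)\<^sup>2 \<le> (a * b)\<^sup>2"
      using zero_le_power2[of "a1 * b1 - a2 * b2"] by linarith
    then have "a1 * b2 + a2 * b1 \<le> a * b" using pos by (simp add: power2_le_iff_abs_le)
    then show ?thesis using pos by (simp add: y_def)
  qed
  have "(s - t)\<^sup>2 \<le> x\<^sup>2 * 1"
    unfolding st power_mult_distrib using y0 y1 by (intro mult_left_mono) (auto simp: power_le_one)
  then show "(s - t)\<^sup>2 \<le> \<delta>" using x by simp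
  have "b2 \<le> b" using nonneg by (simp add: defs)
  then have "a1 * b2 / (a * b) \<le> a1 / a" using pos by (simp add: divide_simps mult_left_mono)
  moreover have "y = 2 * (a1 * b2 / (a * b)) - x" by (simp add: x_def y_def add_divide_distrib diff_divide_distrib)
  moreover have "sqrt s = a1 / a" by (simp add: s_def a1_def a_def real_sqrt_divide)
  ultimately have y2: "y \<le> 2 * sqrt s + \<bar>x\<bar>" by linarith
  have x1: "\<bar>x\<bar> \<le> sqrt \<delta>" using x real_le_rsqrt[of "\<bar>x\<bar>" \<delta>] by simp
  have \<delta>0: "0 \<le> \<delta>" using x zero_le_power2[of x] by linarith
  have s0: "0 \<le> s" using nonneg by (simp add: s_def)
  have "\<bar>s - t\<bar> = \<bar>x\<bar> * y" using y0 by (simp add: st abs_mult)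
  also have "\<dots> \<le> \<bar>x\<bar> * (2 * sqrt s + \<bar>x\<bar>)" using y2 by (intro mult_left_mono) auto
  also have "\<dots> \<le> sqrt \<delta> * (2 * sqrt s + sqrt \<delta>)"
    using x1 s0 \<delta>0 by (intro mult_mono) auto
  also have "\<dots> = \<delta> + 2 * sqrt s * sqrt \<delta>" using \<delta>0 by (simp add: algebra_simps)
  finally show "\<bar>s - t\<bar> \<le> \<delta> + 2 * sqrt s * sqrt \<delta>" .
qed

text \<open>Sobol' indices and total-effect indices are both shares of variance of the components indexed
  by some family \<open>W\<close> of coordinate sets, with the same convention for vanishing variance.\<close>

definition group_index ::
  "('i::finite \<Rightarrow> real measure) \<Rightarrow> 'i set set \<Rightarrow> (('i \<Rightarrow> real) \<Rightarrow> real) \<Rightarrow> real" where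
  "group_index \<mu> W f =
     (if Var (prodm \<mu>) f = 0 then 1 / 2 ^ CARD('i)
      else (\<Sum>V\<in>W. Var (prodm \<mu>) (sobol_component \<mu> f V)) / Var (prodm \<mu>) f)"

lemma sobol_index_eq_group: "sobol_index \<mu> f U = group_index \<mu> {U} f"
  by (simp add: sobol_index_def group_index_def)

lemma total_effect_index_eq_group:
  "total_effect_index \<mu> f U = group_index \<mu> {V. V \<inter> U \<noteq> {}} f"
  by (simp add: total_effect_index_def group_index_def sobol_index_def sum_divide_distrib)

context marginals
begin

lemma sobolD:
  assumes "sobol_decomposition \<mu> f F"
  shows "F U \<in> L2 (prodm \<mu>)" "AE x in prodm \<mu>. f x = (\<Sum>U\<in>UNIV. F U x)"
    "x \<in> space (prodm \<mu>) \<Longrightarrow> y \<in> space (prodm \<mu>) \<Longrightarrow> (\<And>i. i \<in> U \<Longrightarrow> x i = y i) \<Longrightarrow> F U x = F U y"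
    "x \<in> space (prodm \<mu>) \<Longrightarrow> F {} x = (\<integral>y. f y \<partial>prodm \<mu>)"
    "i \<in> U \<Longrightarrow> AE x in prodm \<mu>. (\<integral>t. F U (x(i := t)) \<partial>\<mu> i) = 0"
  using assms unfolding sobol_decomposition_def by blast+

text \<open>Components of two possibly different functions are orthogonal unless they belong to the same
  coordinate set: integrate first over a coordinate that only one of them depends on.\<close>

lemma sobol_orthogonal_aux:
  assumes F: "sobol_decomposition \<mu> f F" and G: "sobol_decomposition \<mu> g G"
    and i: "i \<in> U" "i \<notin> V"
  shows "(\<integral>x. F U x * G V x \<partial>prodm \<mu>) = 0"
proof -
  have "(\<integral>x. F U x * G V x \<partial>prodm \<mu>)
      = (\<integral>x. (\<integral>t. F U (x(i := t)) * G V (x(i := t)) \<partial>\<mu> i) \<partial>prodm \<mu>)"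
    by (rule integral_update[symmetric]) (intro L2_mult_integrable sobolD(1)[OF F] sobolD(1)[OF G])
  also have "\<dots> = (\<integral>x. 0 \<partial>prodm \<mu>)"
  proof (rule Bochner_Integration.integral_cong_AE)
    have "integrable (prodm \<mu>) (\<lambda>x. F U x * G V x)"
      by (intro L2_mult_integrable sobolD(1)[OF F] sobolD(1)[OF G])
    from integrable_update_pair[OF this, of i]
    have m: "(\<lambda>(x, t). F U (x(i := t)) * G V (x(i := t))) \<in> borel_measurable (prodm \<mu> \<Otimes>\<^sub>M \<mu> i)"
      by measurable
    show "(\<lambda>x. \<integral>t. F U (x(i := t)) * G V (x(i := t)) \<partial>\<mu> i) \<in> borel_measurable (prodm \<mu>)"
      using m by (rule sigma_finite_measure.borel_measurable_lebesgue_integral[OF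
          prob_space_imp_sigma_finite[OF \<mu>_prob]])
    show "AE x in prodm \<mu>. (\<integral>t. F U (x(i := t)) * G V (x(i := t)) \<partial>\<mu> i) = 0"
      using sobolD(5)[OF F i(1)] AE_space
    proof eventually_elim
      case (elim x)
      have "G V (x(i := t)) = G V x" if "t \<in> space (\<mu> i)" for t
        using elim(2) that i(2) by (intro sobolD(3)[OF G]) (auto simp: space_PiM PiE_def Pi_def)
      then have "(\<integral>t. F U (x(i := t)) * G V (x(i := t)) \<partial>\<mu> i) = (\<integral>t. F U (x(i := t)) * G V x \<partial>\<mu> i)"
        by (intro Bochner_Integration.integral_cong) auto
      then show ?case using elim(1) by simp
    qed
  qed simp
  finally show ?thesis by simp
qed

lemma sobol_orthogonal:
  assumes F: "sobol_decomposition \<mu> f F" and G: "sobol_decomposition \<mu> g G" and "U \<noteq> V"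
  shows "(\<integral>x. F U x * G V x \<partial>prodm \<mu>) = 0"
proof -
  consider i where "i \<in> U" "i \<notin> V" | i where "i \<in> V" "i \<notin> U" using \<open>U \<noteq> V\<close> by blast
  then show ?thesis
  proof cases
    case 1 then show ?thesis using sobol_orthogonal_aux[OF F G] by blast
  next
    case 2 then show ?thesis using sobol_orthogonal_aux[OF G F] by (simp add: mult.commute)
  qed
qed

lemma sobol_sum_inner:
  assumes F: "sobol_decomposition \<mu> f F" and G: "sobol_decomposition \<mu> g G"
  shows "(\<integral>x. (\<Sum>U\<in>W. F U x) * (\<Sum>V\<in>W'. G V x) \<partial>prodm \<mu>)
    = (\<Sum>U\<in>W \<inter> W'. \<integral>x. F U x * G U x \<partial>prodm \<mu>)"
proof -
  have int: "integrable (prodm \<mu>) (\<lambda>x. F U x * G V x)" for U V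
    by (intro L2_mult_integrable sobolD(1)[OF F] sobolD(1)[OF G])
  have "(\<integral>x. (\<Sum>U\<in>W. F U x) * (\<Sum>V\<in>W'. G V x) \<partial>prodm \<mu>)
      = (\<Sum>U\<in>W. \<Sum>V\<in>W'. \<integral>x. F U x * G V x \<partial>prodm \<mu>)"
    by (simp add: sum_product int)
  also have "\<dots> = (\<Sum>U\<in>W. \<Sum>V\<in>W'. if V = U then (\<integral>x. F U x * G U x \<partial>prodm \<mu>) else 0)"
    by (intro sum.cong refl) (simp add: sobol_orthogonal[OF F G])
  also have "\<dots> = (\<Sum>U\<in>W. if U \<in> W' then (\<integral>x. F U x * G U x \<partial>prodm \<mu>) else 0)"
    by (simp add: sum.delta')
  also have "\<dots> = (\<Sum>U\<in>W \<inter> W'. \<integral>x. F U x * G U x \<partial>prodm \<mu>)"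
    by (simp add: sum.inter_restrict)
  finally show ?thesis .
qed

lemma variance_component:
  assumes F: "sobol_decomposition \<mu> f F"
  shows "Var (prodm \<mu>) (F U) = (if U = {} then 0 else (\<integral>x. (F U x)\<^sup>2 \<partial>prodm \<mu>))"
proof (cases "U = {}")
  case True
  have "(\<integral>x. F {} x \<partial>prodm \<mu>) = (\<integral>x. (\<integral>y. f y \<partial>prodm \<mu>) \<partial>prodm \<mu>)"
    by (intro Bochner_Integration.integral_cong refl sobolD(4)[OF F])
  then have E: "(\<integral>x. F {} x \<partial>prodm \<mu>) = (\<integral>y. f y \<partial>prodm \<mu>)" by (simp add: P.prob_space)
  have "Var (prodm \<mu>) (F {}) = (\<integral>x. 0 \<partial>prodm \<mu>)"
    unfolding E by (intro Bochner_Integration.integral_cong refl) (simp add: sobolD(4)[OF F])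
  then show ?thesis using True by simp
next
  case False
  then obtain i where i: "i \<in> U" by blast
  have one: "sobol_decomposition \<mu> (\<lambda>_. 1) (anova (\<lambda>_. 1))"
    by (intro anova_decomposition L2_const prodm_finite)
  have "anova (\<lambda>_. 1) {} = (\<lambda>_. 1)" by (rule ext) (simp add: anova_def cond_mean_def P.prob_space)
  then have "(\<integral>x. F U x \<partial>prodm \<mu>) = 0" using sobol_orthogonal[OF F one False] by simp
  then show ?thesis using False by simp
qed

text \<open>For two decompositions \<open>F, G\<close> of \<open>f\<close>, testing \<open>f\<close> against \<open>F U\<close> and \<open>G U\<close> shows that
  both squared norms equal the inner product of \<open>F U\<close> and \<open>G U\<close>.\<close>

lemma component_energy_unique:
  assumes f: "f \<in> L2 (prodm \<mu>)" and F: "sobol_decomposition \<mu> f F" and G: "sobol_decomposition \<mu> f G"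
  shows "(\<integral>x. (F U x)\<^sup>2 \<partial>prodm \<mu>) = (\<integral>x. (G U x)\<^sup>2 \<partial>prodm \<mu>)"
proof -
  have eq: "(\<integral>x. H U x * f x \<partial>prodm \<mu>) = (\<integral>x. H U x * H' U x \<partial>prodm \<mu>)"
    if H: "sobol_decomposition \<mu> f H" and H': "sobol_decomposition \<mu> f H'" for H H'
  proof -
    have "(\<integral>x. H U x * f x \<partial>prodm \<mu>) = (\<integral>x. (\<Sum>V\<in>{U}. H V x) * (\<Sum>V\<in>UNIV. H' V x) \<partial>prodm \<mu>)"
    proof (rule Bochner_Integration.integral_cong_AE)
      show "(\<lambda>x. H U x * f x) \<in> borel_measurable (prodm \<mu>)"
        using L2_measurable[OF sobolD(1)[OF H]] L2_measurable[OF f] by measurable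
      show "(\<lambda>x. (\<Sum>V\<in>{U}. H V x) * (\<Sum>V\<in>UNIV. H' V x)) \<in> borel_measurable (prodm \<mu>)"
        using L2_measurable[OF sobolD(1)[OF H]] L2_measurable[OF sobolD(1)[OF H']] by measurable
      show "AE x in prodm \<mu>. H U x * f x = (\<Sum>V\<in>{U}. H V x) * (\<Sum>V\<in>UNIV. H' V x)"
        using sobolD(2)[OF H'] by eventually_elim simp
    qed
    also have "\<dots> = (\<integral>x. H U x * H' U x \<partial>prodm \<mu>)"
      unfolding sobol_sum_inner[OF H H'] by simp
    finally show ?thesis .
  qed
  show ?thesis
    using eq[OF F F] eq[OF F G] eq[OF G F] eq[OF G G] by (simp add: power2_eq_square mult.commute)
qed

lemma variance_component_unique:
  assumes "f \<in> L2 (prodm \<mu>)" "sobol_decomposition \<mu> f F" "sobol_decomposition \<mu> f G"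
  shows "Var (prodm \<mu>) (F U) = Var (prodm \<mu>) (G U)"
  unfolding variance_component[OF assms(2)] variance_component[OF assms(3)]
  by (simp only: component_energy_unique[OF assms])

lemma covariance_sum:
  assumes f: "f \<in> L2 (prodm \<mu>)" and g: "g \<in> L2 (prodm \<mu>)"
    and F: "sobol_decomposition \<mu> f F" and G: "sobol_decomposition \<mu> g G"
  shows "(\<integral>x. (f x - (\<integral>y. f y \<partial>prodm \<mu>)) * (g x - (\<integral>y. g y \<partial>prodm \<mu>)) \<partial>prodm \<mu>)
     = (\<Sum>U\<in>-{{}}. \<integral>x. F U x * G U x \<partial>prodm \<mu>)"
proof -
  have c: "AE x in prodm \<mu>. h x - (\<integral>y. h y \<partial>prodm \<mu>) = (\<Sum>U\<in>-{{}}. H U x)"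
    if H: "sobol_decomposition \<mu> h H" for h H
    using sobolD(2)[OF H] AE_space
  proof eventually_elim
    case (elim x)
    have "(\<Sum>U\<in>UNIV. H U x) = H {} x + (\<Sum>U\<in>-{{}}. H U x)"
      by (subst sum.remove[of _ "{}"]) (auto simp: Compl_eq_Diff_UNIV)
    then show ?case using elim sobolD(4)[OF H] by simp
  qed
  have "(\<integral>x. (f x - (\<integral>y. f y \<partial>prodm \<mu>)) * (g x - (\<integral>y. g y \<partial>prodm \<mu>)) \<partial>prodm \<mu>)
    = (\<integral>x. (\<Sum>U\<in>-{{}}. F U x) * (\<Sum>V\<in>-{{}}. G V x) \<partial>prodm \<mu>)"
  proof (rule Bochner_Integration.integral_cong_AE)
    note [measurable] = L2_measurable[OF f] L2_measurable[OF g]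
      L2_measurable[OF sobolD(1)[OF F]] L2_measurable[OF sobolD(1)[OF G]]
    show "(\<lambda>x. (f x - (\<integral>y. f y \<partial>prodm \<mu>)) * (g x - (\<integral>y. g y \<partial>prodm \<mu>))) \<in> borel_measurable (prodm \<mu>)"
      by measurable
    show "(\<lambda>x. (\<Sum>U\<in>-{{}}. F U x) * (\<Sum>V\<in>-{{}}. G V x)) \<in> borel_measurable (prodm \<mu>)" by measurable
    show "AE x in prodm \<mu>. (f x - (\<integral>y. f y \<partial>prodm \<mu>)) * (g x - (\<integral>y. g y \<partial>prodm \<mu>))
        = (\<Sum>U\<in>-{{}}. F U x) * (\<Sum>V\<in>-{{}}. G V x)"
      using c[OF F] c[OF G] by eventually_elim simp
  qed
  then show ?thesis by (simp add: sobol_sum_inner[OF F G])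
qed

lemma variance_sum:
  assumes "f \<in> L2 (prodm \<mu>)" "sobol_decomposition \<mu> f F"
  shows "Var (prodm \<mu>) f = (\<Sum>U\<in>-{{}}. \<integral>x. (F U x)\<^sup>2 \<partial>prodm \<mu>)"
  using covariance_sum[OF assms(1,1,2,2)] by (simp add: power2_eq_square)

lemma variance_le_square: "f \<in> L2 (prodm \<mu>) \<Longrightarrow> Var (prodm \<mu>) f \<le> (\<integral>x. (f x)\<^sup>2 \<partial>prodm \<mu>)"
  using P.variance_eq[OF L2_integrable[OF prodm_finite] L2_square_integrable] by simp

lemma variance_diff:
  assumes f: "f \<in> L2 (prodm \<mu>)" and g: "g \<in> L2 (prodm \<mu>)"
  shows "Var (prodm \<mu>) (\<lambda>x. f x - g x) = Var (prodm \<mu>) f + Var (prodm \<mu>) g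
    - 2 * (\<integral>x. (f x - (\<integral>y. f y \<partial>prodm \<mu>)) * (g x - (\<integral>y. g y \<partial>prodm \<mu>)) \<partial>prodm \<mu>)"
proof -
  let ?f = "\<lambda>x. f x - (\<integral>y. f y \<partial>prodm \<mu>)" and ?g = "\<lambda>x. g x - (\<integral>y. g y \<partial>prodm \<mu>)"
  have fg: "?f \<in> L2 (prodm \<mu>)" "?g \<in> L2 (prodm \<mu>)"
    by (intro L2_diff L2_const prodm_finite f g)+
  have "(\<integral>y. f y - g y \<partial>prodm \<mu>) = (\<integral>y. f y \<partial>prodm \<mu>) - (\<integral>y. g y \<partial>prodm \<mu>)"
    using L2_integrable[OF prodm_finite f] L2_integrable[OF prodm_finite g] by simp
  then have "Var (prodm \<mu>) (\<lambda>x. f x - g x) = (\<integral>x. (?f x)\<^sup>2 + (?g x)\<^sup>2 - 2 * (?f x * ?g x) \<partial>prodm \<mu>)"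
    by (intro Bochner_Integration.integral_cong refl)
      (simp only:, simp add: power2_eq_square algebra_simps)
  also have "\<dots> = (\<integral>x. (?f x)\<^sup>2 \<partial>prodm \<mu>) + (\<integral>x. (?g x)\<^sup>2 \<partial>prodm \<mu>) - 2 * (\<integral>x. ?f x * ?g x \<partial>prodm \<mu>)"
    using L2_square_integrable[OF fg(1)] L2_square_integrable[OF fg(2)] L2_mult_integrable[OF fg]
    by (simp only: Bochner_Integration.integral_diff Bochner_Integration.integral_add
        Bochner_Integration.integrable_add integral_mult_right_zero integrable_mult_right)
  finally show ?thesis .
qed

text \<open>The part of the variance of \<open>f\<close> carried by the family \<open>W\<close>; the constant component is left
  out.\<close>

definition energy :: "(('i \<Rightarrow> real) \<Rightarrow> real) \<Rightarrow> 'i set set \<Rightarrow> real" where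
  "energy f W = (\<Sum>U\<in>W - {{}}. \<integral>x. (sobol_component \<mu> f U x)\<^sup>2 \<partial>prodm \<mu>)"

lemma energy_nonneg: "0 \<le> energy f W"
  by (auto simp: energy_def intro!: sum_nonneg)

lemma variance_energy: "f \<in> L2 (prodm \<mu>) \<Longrightarrow> Var (prodm \<mu>) f = energy f W + energy f (- W)"
proof -
  assume f: "f \<in> L2 (prodm \<mu>)"
  have "- {{}} = (W - {{}}) \<union> (- W - {{}})" by auto
  then show ?thesis
    unfolding variance_sum[OF f sobol_component_decomposition[OF f]] energy_def
    by (simp only:) (rule sum.union_disjoint, auto)
qed

lemma group_index_energy:
  assumes f: "f \<in> L2 (prodm \<mu>)" and "Var (prodm \<mu>) f \<noteq> 0"
  shows "group_index \<mu> W f = energy f W / (energy f W + energy f (- W))"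
proof -
  have "(\<Sum>V\<in>W. Var (prodm \<mu>) (sobol_component \<mu> f V)) = energy f W"
    unfolding energy_def variance_component[OF sobol_component_decomposition[OF f]]
    by (intro sum.mono_neutral_cong_right) auto
  then show ?thesis using assms by (simp add: group_index_def variance_energy[OF f, of W])
qed

lemma group_index_bounds:
  assumes f: "f \<in> L2 (prodm \<mu>)"
  shows "0 \<le> group_index \<mu> W f" "group_index \<mu> W f \<le> 1"
proof -
  have "0 \<le> group_index \<mu> W f \<and> group_index \<mu> W f \<le> 1"
  proof (cases "Var (prodm \<mu>) f = 0")
    case True then show ?thesis by (simp add: group_index_def)
  next
    case False
    then have "0 < energy f W + energy f (- W)"
      using energy_nonneg[of f W] energy_nonneg[of f "-W"] variance_energy[OF f, of W] by simp
    then show ?thesis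
      using energy_nonneg[of f W] energy_nonneg[of f "-W"]
      by (simp add: group_index_energy[OF f False])
  qed
  then show "0 \<le> group_index \<mu> W f" "group_index \<mu> W f \<le> 1" by auto
qed

lemma group_covariance:
  fixes W :: "'i set set"
  assumes f: "f \<in> L2 (prodm \<mu>)" and g: "g \<in> L2 (prodm \<mu>)"
  defines "c \<equiv> \<lambda>W. \<Sum>U\<in>W - {{}}. \<integral>x. sobol_component \<mu> f U x * sobol_component \<mu> g U x \<partial>prodm \<mu>"
  shows "(c W)\<^sup>2 \<le> energy f W * energy g W"
    and "energy f W + energy g W - 2 * c W + (energy f (- W) + energy g (- W) - 2 * c (- W))
      = Var (prodm \<mu>) (\<lambda>x. f x - g x)"
proof -
  note F = sobol_component_decomposition[OF f] and G = sobol_component_decomposition[OF g]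
  have "(c W)\<^sup>2 = (\<integral>x. (\<Sum>U\<in>W - {{}}. sobol_component \<mu> f U x)
      * (\<Sum>U\<in>W - {{}}. sobol_component \<mu> g U x) \<partial>prodm \<mu>)\<^sup>2"
    by (simp add: c_def sobol_sum_inner[OF F G])
  also have "\<dots> \<le> (\<integral>x. (\<Sum>U\<in>W - {{}}. sobol_component \<mu> f U x)\<^sup>2 \<partial>prodm \<mu>)
      * (\<integral>x. (\<Sum>U\<in>W - {{}}. sobol_component \<mu> g U x)\<^sup>2 \<partial>prodm \<mu>)"
    by (intro L2_cauchy_schwarz L2_sum sobolD(1)[OF F] sobolD(1)[OF G])
  also have "\<dots> = energy f W * energy g W"
    unfolding power2_eq_square sobol_sum_inner[OF F F] sobol_sum_inner[OF G G]
    by (simp add: energy_def power2_eq_square)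
  finally show "(c W)\<^sup>2 \<le> energy f W * energy g W" .
  have "- {{}} = (W - {{}}) \<union> (- W - {{}})" by auto
  then have "(\<Sum>U\<in>-{{}}. \<integral>x. sobol_component \<mu> f U x * sobol_component \<mu> g U x \<partial>prodm \<mu>) = c W + c (- W)"
    unfolding c_def by (simp only:) (rule sum.union_disjoint, auto)
  then show "energy f W + energy g W - 2 * c W + (energy f (- W) + energy g (- W) - 2 * c (- W))
      = Var (prodm \<mu>) (\<lambda>x. f x - g x)"
    unfolding variance_diff[OF f g] covariance_sum[OF f g F G]
      variance_energy[OF f, of W] variance_energy[OF g, of W] by simp
qed

theorem group_index_stable:
  assumes f: "f \<in> L2 (prodm \<mu>)" and g: "g \<in> L2 (prodm \<mu>)" and V: "0 < Var (prodm \<mu>) f"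
  defines "\<delta> \<equiv> (\<integral>x. (f x - g x)\<^sup>2 \<partial>prodm \<mu>) / Var (prodm \<mu>) f"
  shows "(group_index \<mu> W f - group_index \<mu> W g)\<^sup>2 \<le> \<delta>"
    and "\<bar>group_index \<mu> W f - group_index \<mu> W g\<bar> \<le> \<delta> + 2 * sqrt (group_index \<mu> W f) * sqrt \<delta>"
proof -
  have "(group_index \<mu> W f - group_index \<mu> W g)\<^sup>2 \<le> \<delta> \<and>
    \<bar>group_index \<mu> W f - group_index \<mu> W g\<bar> \<le> \<delta> + 2 * sqrt (group_index \<mu> W f) * sqrt \<delta>"
  proof (cases "Var (prodm \<mu>) g = 0")
    case True
    have "Var (prodm \<mu>) f = Var (prodm \<mu>) (\<lambda>x. f x - g x)"
    proof -
      have "energy g W = 0" "energy g (- W) = 0"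
        using True energy_nonneg[of g W] energy_nonneg[of g "- W"]
        unfolding variance_energy[OF g, of W] by linarith+
      then show ?thesis
        using group_covariance[OF f g, of W] group_covariance(1)[OF f g, of "- W"]
        by (simp add: variance_energy[OF f, of W])
    qed
    also have "\<dots> \<le> (\<integral>x. (f x - g x)\<^sup>2 \<partial>prodm \<mu>)" by (intro variance_le_square L2_diff f g)
    finally have \<delta>: "1 \<le> \<delta>" using V by (simp add: \<delta>_def)
    have abs: "\<bar>group_index \<mu> W f - group_index \<mu> W g\<bar> \<le> 1"
      using group_index_bounds[OF f, of W] group_index_bounds[OF g, of W] by linarith
    then have "(group_index \<mu> W f - group_index \<mu> W g)\<^sup>2 \<le> 1" by (simp add: abs_square_le_1)
    moreover have "0 \<le> 2 * sqrt (group_index \<mu> W f) * sqrt \<delta>"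
      using \<delta> group_index_bounds[OF f, of W] by simp
    ultimately show ?thesis using \<delta> abs by linarith
  next
    case False
    have D: "energy f W + energy f (- W) = Var (prodm \<mu>) f" using variance_energy[OF f, of W] by simp
    have "0 < energy g W + energy g (- W)"
      using False variance_energy[OF g, of W] energy_nonneg[of g W] energy_nonneg[of g "-W"] by simp
    moreover have "Var (prodm \<mu>) (\<lambda>x. f x - g x) \<le> (\<integral>x. (f x - g x)\<^sup>2 \<partial>prodm \<mu>)"
      by (intro variance_le_square L2_diff f g)
    moreover note group_covariance[OF f g, of W] group_covariance(1)[OF f g, of "- W"]
    ultimately show ?thesis
      using V D angle_comparison[OF energy_nonneg[of f W] energy_nonneg[of f "-W"]
          energy_nonneg[of g W] energy_nonneg[of g "-W"], of _ _ "\<integral>x. (f x - g x)\<^sup>2 \<partial>prodm \<mu>"]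
      by (simp add: group_index_energy[OF f] group_index_energy[OF g False] \<delta>_def)
  qed
  then show "(group_index \<mu> W f - group_index \<mu> W g)\<^sup>2 \<le> \<delta>"
    "\<bar>group_index \<mu> W f - group_index \<mu> W g\<bar> \<le> \<delta> + 2 * sqrt (group_index \<mu> W f) * sqrt \<delta>" by auto
qed

end

section \<open>Least squares and the normal equations\<close>

lemma mat_inverse_solves:
  fixes G :: "real Matrix.mat"
  assumes G: "G \<in> carrier_mat m m" and b: "b \<in> carrier_vec m" and det: "Determinant.det G \<noteq> 0"
  shows "the (mat_inverse G) *\<^sub>v b \<in> carrier_vec m" "G *\<^sub>v (the (mat_inverse G) *\<^sub>v b) = b"
proof -
  obtain B where B: "mat_inverse G = Some B"
    using mat_inverse(1)[OF G, where b = "()"] det_non_zero_imp_unit[OF G det, where b = "()"] by (cases "mat_inverse G") auto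
  then have GB: "G * B = 1\<^sub>m m" "B \<in> carrier_mat m m" using mat_inverse(2)[OF G] by auto
  show "the (mat_inverse G) *\<^sub>v b \<in> carrier_vec m" using GB b by (simp add: B)
  show "G *\<^sub>v (the (mat_inverse G) *\<^sub>v b) = b"
    using GB G b by (simp add: B assoc_mult_mat_vec[symmetric])
qed

text \<open>The least squares coefficients, indexed by the basis functions instead of their enumeration.\<close>

definition ls_coeff :: "('b \<Rightarrow> 'a \<Rightarrow> real) \<Rightarrow> 'b set \<Rightarrow> nat \<Rightarrow> (nat \<Rightarrow> 'a) \<Rightarrow> (nat \<Rightarrow> real) \<Rightarrow> 'b \<Rightarrow> real" where
  "ls_coeff \<Psi> A n xs ys a
     = vec_index (ls_coeffs \<Psi> A n xs ys) (inv_into {..<card A} (from_nat_into A) a)"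

context
  fixes A :: "'b set"
  assumes fin: "finite A"
begin

lemma from_nat_into_inv: "k < card A \<Longrightarrow> inv_into {..<card A} (from_nat_into A) (from_nat_into A k) = k"
  using bij_betw_from_nat_into_finite[OF fin] by (simp add: bij_betw_def)

lemma sum_from_nat_into: "(\<Sum>k<card A. h (from_nat_into A k)) = (\<Sum>a\<in>A. h a)"
  by (rule sum.reindex_bij_betw[OF bij_betw_from_nat_into_finite[OF fin]])

lemma from_nat_into_cases: "a \<in> A \<Longrightarrow> \<exists>k<card A. a = from_nat_into A k"
  using bij_betw_from_nat_into_finite[OF fin] by (auto simp: bij_betw_def)

lemma ls_approx_eq: "ls_approx \<Psi> A n xs ys = (\<lambda>x. \<Sum>a\<in>A. ls_coeff \<Psi> A n xs ys a * \<Psi> a x)"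
proof
  fix x
  show "ls_approx \<Psi> A n xs ys x = (\<Sum>a\<in>A. ls_coeff \<Psi> A n xs ys a * \<Psi> a x)"
    unfolding ls_approx_def sum_from_nat_into[symmetric]
    by (intro sum.cong) (simp_all add: ls_coeff_def from_nat_into_inv)
qed

text \<open>The \<open>k\<close>-th basis function in the enumeration that orders the columns of the design matrix.\<close>

abbreviation "col_fun \<Psi> k \<equiv> \<Psi> (from_nat_into A k)"

lemma design_gram:
  fixes \<Psi> :: "'b \<Rightarrow> 'a \<Rightarrow> real"
  defines "D \<equiv> \<lambda>n xs. design_matrix \<Psi> A n xs"
  shows "transpose_mat (D n xs) * D n xs
    = Matrix.mat (card A) (card A) (\<lambda>(k, l). \<Sum>j<n. col_fun \<Psi> k (xs j) * col_fun \<Psi> l (xs j))"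
  unfolding D_def
  by (rule eq_matI) (auto simp: design_matrix_def scalar_prod_def atLeast0LessThan)

lemma design_rhs:
  "transpose_mat (design_matrix \<Psi> A n xs) *\<^sub>v Matrix.vec n ys
    = Matrix.vec (card A) (\<lambda>k. \<Sum>j<n. col_fun \<Psi> k (xs j) * ys j)"
  by (rule eq_vecI) (auto simp: design_matrix_def scalar_prod_def atLeast0LessThan)

abbreviation "gram \<Psi> n xs \<equiv> Matrix.mat (card A) (card A)
  (\<lambda>(k, l). \<Sum>j<n. col_fun \<Psi> k (xs j) * col_fun \<Psi> l (xs j))"
abbreviation "moment_vec \<Psi> n xs ys \<equiv> Matrix.vec (card A) (\<lambda>k. \<Sum>j<n. col_fun \<Psi> k (xs j) * ys j)"

lemma ls_coeffs_solve:
  assumes "Determinant.det (gram \<Psi> n xs) \<noteq> 0"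
  shows "ls_coeffs \<Psi> A n xs ys \<in> carrier_vec (card A)"
    "gram \<Psi> n xs *\<^sub>v ls_coeffs \<Psi> A n xs ys = moment_vec \<Psi> n xs ys"
  using assms mat_inverse_solves[of "gram \<Psi> n xs" "card A" "moment_vec \<Psi> n xs ys"]
  unfolding ls_coeffs_def Let_def design_gram design_rhs by auto

lemma gram_mult_index:
  fixes \<Psi> :: "'b \<Rightarrow> 'a \<Rightarrow> real"
  assumes "w \<in> carrier_vec (card A)" "k < card A"
  shows "vec_index (gram \<Psi> n xs *\<^sub>v w) k
    = (\<Sum>j<n. col_fun \<Psi> k (xs j) * (\<Sum>l<card A. vec_index w l * col_fun \<Psi> l (xs j)))"
proof -
  have "vec_index (gram \<Psi> n xs *\<^sub>v w) k
    = (\<Sum>l<card A. (\<Sum>j<n. col_fun \<Psi> k (xs j) * col_fun \<Psi> l (xs j)) * vec_index w l)"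
    using assms by (auto simp: scalar_prod_def atLeast0LessThan)
  also have "\<dots> = (\<Sum>j<n. \<Sum>l<card A. col_fun \<Psi> k (xs j) * col_fun \<Psi> l (xs j) * vec_index w l)"
    unfolding sum_distrib_right by (rule sum.swap)
  also have "\<dots> = (\<Sum>j<n. col_fun \<Psi> k (xs j) * (\<Sum>l<card A. vec_index w l * col_fun \<Psi> l (xs j)))"
    unfolding sum_distrib_left by (intro sum.cong refl) (simp add: mult_ac)
  finally show ?thesis .
qed

text \<open>The assumption \<open>coercive\<close> says that the Gram matrix has smallest eigenvalue at least \<open>lam\<close>.\<close>

lemma gram_det_nonzero:
  fixes \<Psi> :: "'b \<Rightarrow> 'a \<Rightarrow> real" and xs :: "nat \<Rightarrow> 'a"
  assumes lam: "0 < lam"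
    and coercive: "\<And>w. lam * (\<Sum>a\<in>A. (w a)\<^sup>2) \<le> (\<Sum>j<n. (\<Sum>a\<in>A. w a * \<Psi> a (xs j))\<^sup>2)"
  shows "Determinant.det (gram \<Psi> n xs) \<noteq> 0"
proof
  assume "Determinant.det (gram \<Psi> n xs) = 0"
  then obtain v where v: "v \<in> carrier_vec (card A)" "v \<noteq> 0\<^sub>v (card A)"
    "gram \<Psi> n xs *\<^sub>v v = 0\<^sub>v (card A)"
    using det_0_iff_vec_prod_zero_field[of "gram \<Psi> n xs" "card A"] by auto
  define w where "w = (\<lambda>a. vec_index v (inv_into {..<card A} (from_nat_into A) a))"
  have w: "w (from_nat_into A k) = vec_index v k" if "k < card A" for k
    using that by (simp add: w_def from_nat_into_inv)
  have ws: "(\<Sum>a\<in>A. w a * \<Psi> a (xs j)) = (\<Sum>l<card A. vec_index v l * col_fun \<Psi> l (xs j))" for j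
    unfolding sum_from_nat_into[symmetric] by (intro sum.cong) (simp_all add: w)
  have "(\<Sum>j<n. (\<Sum>a\<in>A. w a * \<Psi> a (xs j))\<^sup>2)
      = (\<Sum>k<card A. vec_index v k * vec_index (gram \<Psi> n xs *\<^sub>v v) k)"
  proof -
    have "(\<Sum>k<card A. vec_index v k * vec_index (gram \<Psi> n xs *\<^sub>v v) k)
      = (\<Sum>k<card A. \<Sum>j<n. vec_index v k * col_fun \<Psi> k (xs j)
          * (\<Sum>l<card A. vec_index v l * col_fun \<Psi> l (xs j)))"
      by (intro sum.cong refl) (simp only: gram_mult_index[OF v(1)] lessThan_iff sum_distrib_left mult.assoc)
    also have "\<dots> = (\<Sum>j<n. (\<Sum>k<card A. vec_index v k * col_fun \<Psi> k (xs j))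
          * (\<Sum>l<card A. vec_index v l * col_fun \<Psi> l (xs j)))"
      by (subst sum.swap) (simp only: sum_distrib_right)
    finally show ?thesis by (simp add: ws power2_eq_square)
  qed
  also have "\<dots> = 0" unfolding v(3) by simp
  finally have "lam * (\<Sum>a\<in>A. (w a)\<^sup>2) \<le> 0" using coercive[of w] by simp
  then have "(\<Sum>a\<in>A. (w a)\<^sup>2) \<le> 0" using lam by (simp add: mult_le_0_iff)
  then have "(\<Sum>a\<in>A. (w a)\<^sup>2) = 0" by (meson antisym sum_nonneg zero_le_power2)
  then have "(\<Sum>k<card A. (vec_index v k)\<^sup>2) = 0"
    unfolding sum_from_nat_into[symmetric] by (simp add: w)
  then have "vec_index v k = 0" if "k < card A" for k
    using that by (simp add: sum_nonneg_eq_0_iff)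
  then have "v = 0\<^sub>v (card A)" using v(1) by (intro eq_vecI) auto
  with v(2) show False by simp
qed

lemma normal_equations:
  fixes \<Psi> :: "'b \<Rightarrow> 'a \<Rightarrow> real" and xs :: "nat \<Rightarrow> 'a"
  assumes lam: "0 < lam"
    and coercive: "\<And>w. lam * (\<Sum>a\<in>A. (w a)\<^sup>2) \<le> (\<Sum>j<n. (\<Sum>a\<in>A. w a * \<Psi> a (xs j))\<^sup>2)"
    and a: "a \<in> A"
  shows "(\<Sum>j<n. \<Psi> a (xs j) * ls_approx \<Psi> A n xs ys (xs j)) = (\<Sum>j<n. \<Psi> a (xs j) * ys j)"
proof -
  obtain k where k: "k < card A" "a = from_nat_into A k" using from_nat_into_cases[OF a] by blast
  note det = gram_det_nonzero[where \<Psi> = \<Psi> and xs = xs and n = n, OF lam coercive]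
  have "vec_index (gram \<Psi> n xs *\<^sub>v ls_coeffs \<Psi> A n xs ys) k = (\<Sum>j<n. col_fun \<Psi> k (xs j) * ys j)"
    using k by (simp add: ls_coeffs_solve(2)[where \<Psi> = \<Psi> and xs = xs and n = n, OF det])
  then show ?thesis
    unfolding gram_mult_index[OF ls_coeffs_solve(1)[where \<Psi> = \<Psi> and xs = xs and n = n, OF det] k(1)] ls_approx_def k(2) .
qed

lemma least_squares_error:
  fixes \<Psi> :: "'b \<Rightarrow> 'a \<Rightarrow> real" and xs :: "nat \<Rightarrow> 'a"
  assumes lam: "0 < lam"
    and coercive: "\<And>w. lam * (\<Sum>a\<in>A. (w a)\<^sup>2) \<le> (\<Sum>j<n. (\<Sum>a\<in>A. w a * \<Psi> a (xs j))\<^sup>2)"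
    and ys: "\<And>j. j < n \<Longrightarrow> ys j = (\<Sum>a\<in>A. c a * \<Psi> a (xs j)) + e j"
  shows "lam\<^sup>2 * (\<Sum>a\<in>A. (ls_coeff \<Psi> A n xs ys a - c a)\<^sup>2) \<le> (\<Sum>a\<in>A. (\<Sum>j<n. \<Psi> a (xs j) * e j)\<^sup>2)"
proof -
  define w where "w = (\<lambda>a. ls_coeff \<Psi> A n xs ys a - c a)"
  define b where "b = (\<lambda>a. \<Sum>j<n. \<Psi> a (xs j) * e j)"
  have eq: "(\<Sum>j<n. \<Psi> a (xs j) * (\<Sum>a\<in>A. w a * \<Psi> a (xs j))) = b a" if a: "a \<in> A" for a
  proof -
    have "(\<Sum>j<n. \<Psi> a (xs j) * (\<Sum>a\<in>A. w a * \<Psi> a (xs j)))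
       = (\<Sum>j<n. \<Psi> a (xs j) * ls_approx \<Psi> A n xs ys (xs j))
         - (\<Sum>j<n. \<Psi> a (xs j) * (\<Sum>a\<in>A. c a * \<Psi> a (xs j)))"
      unfolding ls_approx_eq w_def by (simp add: left_diff_distrib sum_subtractf right_diff_distrib)
    also have "\<dots> = (\<Sum>j<n. \<Psi> a (xs j) * ys j) - (\<Sum>j<n. \<Psi> a (xs j) * (\<Sum>a\<in>A. c a * \<Psi> a (xs j)))"
      by (simp only: normal_equations[where \<Psi> = \<Psi> and xs = xs and n = n, OF lam coercive a])
    also have "\<dots> = b a"
      unfolding sum_subtractf[symmetric] b_def by (intro sum.cong refl) (simp add: ys algebra_simps)
    finally show ?thesis .
  qed
  have "lam * ip A w w \<le> (\<Sum>j<n. (\<Sum>a\<in>A. w a * \<Psi> a (xs j))\<^sup>2)"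
    using coercive[of w] by (simp add: ip_def power2_eq_square)
  also have "\<dots> = (\<Sum>j<n. \<Sum>a\<in>A. w a * (\<Psi> a (xs j) * (\<Sum>a\<in>A. w a * \<Psi> a (xs j))))"
    unfolding power2_eq_square by (simp add: sum_distrib_right mult.assoc)
  also have "\<dots> = (\<Sum>a\<in>A. w a * (\<Sum>j<n. \<Psi> a (xs j) * (\<Sum>a\<in>A. w a * \<Psi> a (xs j))))"
    by (subst sum.swap) (simp only: sum_distrib_left)
  also have "\<dots> = ip A w b" unfolding ip_def by (intro sum.cong refl) (simp only: eq)
  finally have 1: "lam * ip A w w \<le> ip A w b" .
  have 0: "0 \<le> lam * ip A w w" using lam ip_nonneg[of A w] by simp
  have "(lam * ip A w w)\<^sup>2 \<le> (ip A w b)\<^sup>2" using 0 1 by (rule power_mono[rotated])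
  also have "\<dots> \<le> ip A w w * ip A b b" by (rule ip_cauchy_schwarz)
  finally have "ip A w w * (lam\<^sup>2 * ip A w w) \<le> ip A w w * ip A b b"
    by (simp add: power2_eq_square mult_ac)
  then have "lam\<^sup>2 * ip A w w \<le> ip A b b"
    using ip_nonneg[of A w] ip_nonneg[of A b] by (cases "ip A w w = 0") auto
  then show ?thesis by (simp add: ip_def w_def b_def power2_eq_square)
qed

lemma measurable_det:
  assumes "\<And>k l. k < m \<Longrightarrow> l < m \<Longrightarrow> (\<lambda>\<omega>. h \<omega> k l) \<in> borel_measurable M"
  shows "(\<lambda>\<omega>. Determinant.det (Matrix.mat m m (\<lambda>(k, l). h \<omega> k l :: real))) \<in> borel_measurable M"
proof -
  have "(\<lambda>\<omega>. Determinant.det (Matrix.mat m m (\<lambda>(k, l). h \<omega> k l)))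
    = (\<lambda>\<omega>. \<Sum>p\<in>{p. p permutes {0..<m}}. signof p * (\<Prod>k=0..<m. h \<omega> k (p k)))"
  proof (rule ext)
    fix \<omega>
    have "(\<Prod>k=0..<m. Matrix.mat m m (\<lambda>(k, l). h \<omega> k l) $$ (k, p k)) = (\<Prod>k=0..<m. h \<omega> k (p k))"
      if "p permutes {0..<m}" for p
      using permutes_in_image[OF that] by (intro prod.cong) auto
    then show "Determinant.det (Matrix.mat m m (\<lambda>(k, l). h \<omega> k l))
      = (\<Sum>p\<in>{p. p permutes {0..<m}}. signof p * (\<Prod>k=0..<m. h \<omega> k (p k)))"
      by (subst det_def'[of _ m]) (auto intro!: sum.cong)
  qed
  moreover have "(\<lambda>\<omega>. h \<omega> k (p k)) \<in> borel_measurable M" if "p permutes {0..<m}" "k \<in> {0..<m}" for k p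
    using assms[of k "p k"] permutes_in_image[OF that(1), of k] that(2) by auto
  ultimately show ?thesis
    by (auto intro!: borel_measurable_sum borel_measurable_times borel_measurable_prod)
qed

text \<open>By Cramer's rule the coefficients are quotients of determinants in the sample.\<close>

lemma measurable_ls_coeff:
  assumes \<Psi>: "\<And>a j. a \<in> A \<Longrightarrow> j < n \<Longrightarrow> (\<lambda>\<omega>. \<Psi> a (xs \<omega> j)) \<in> borel_measurable M"
    and ys: "\<And>j. j < n \<Longrightarrow> (\<lambda>\<omega>. ys \<omega> j) \<in> borel_measurable M"
    and a: "a \<in> A"
  shows "(\<lambda>\<omega>. ls_coeff \<Psi> A n (xs \<omega>) (ys \<omega>) a) \<in> borel_measurable M"
proof -
  obtain k where k: "k < card A" "a = from_nat_into A k" using from_nat_into_cases[OF a] by blast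
  have \<Psi>': "(\<lambda>\<omega>. col_fun \<Psi> k (xs \<omega> j)) \<in> borel_measurable M" if "k < card A" "j < n" for j k
    using that bij_betw_from_nat_into_finite[OF fin] by (intro \<Psi>) (auto simp: bij_betw_def)
  define g where "g = (\<lambda>\<omega> k l. \<Sum>j<n. col_fun \<Psi> k (xs \<omega> j) * col_fun \<Psi> l (xs \<omega> j))"
  define b where "b = (\<lambda>\<omega> k. \<Sum>j<n. col_fun \<Psi> k (xs \<omega> j) * ys \<omega> j)"
  define h where "h = (\<lambda>\<omega> k' l. if l = k then b \<omega> k' else g \<omega> k' l)"
  let ?det = "\<lambda>h \<omega>. Determinant.det (Matrix.mat (card A) (card A) (\<lambda>(k, l). h \<omega> k l :: real))"
  have g: "(\<lambda>\<omega>. g \<omega> k l) \<in> borel_measurable M" if "k < card A" "l < card A" for k l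
    unfolding g_def using that by (auto intro!: borel_measurable_sum borel_measurable_times \<Psi>')
  have b: "(\<lambda>\<omega>. b \<omega> k) \<in> borel_measurable M" if "k < card A" for k
    unfolding b_def using that by (auto intro!: borel_measurable_sum borel_measurable_times \<Psi>' ys)
  have "(\<lambda>\<omega>. ls_coeff \<Psi> A n (xs \<omega>) (ys \<omega>) a)
    = (\<lambda>\<omega>. if ?det g \<omega> \<noteq> 0 then ?det h \<omega> / ?det g \<omega> else 0)"
  proof
    fix \<omega>
    let ?c = "ls_coeffs \<Psi> A n (xs \<omega>) (ys \<omega>)"
    have c: "ls_coeff \<Psi> A n (xs \<omega>) (ys \<omega>) a = vec_index ?c k"
      using k by (simp add: ls_coeff_def from_nat_into_inv)
    show "ls_coeff \<Psi> A n (xs \<omega>) (ys \<omega>) a = (if ?det g \<omega> \<noteq> 0 then ?det h \<omega> / ?det g \<omega> else 0)"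
    proof (cases "?det g \<omega> = 0")
      case True
      then show ?thesis unfolding c unfolding ls_coeffs_def Let_def design_gram g_def
        using k(1) by simp
    next
      case False
      note sol = ls_coeffs_solve[where \<Psi> = \<Psi> and xs = "xs \<omega>" and n = n and ys = "ys \<omega>",
          OF False[unfolded g_def]]
      have "Determinant.det (replace_col (gram \<Psi> n (xs \<omega>)) (gram \<Psi> n (xs \<omega>) *\<^sub>v ?c) k)
          = vec_index ?c k * Determinant.det (gram \<Psi> n (xs \<omega>))"
        using sol(1) k(1) by (intro cramer_lemma_mat) auto
      moreover have "replace_col (gram \<Psi> n (xs \<omega>)) (moment_vec \<Psi> n (xs \<omega>) (ys \<omega>)) k
          = Matrix.mat (card A) (card A) (\<lambda>(k, l). h \<omega> k l)"
        by (rule eq_matI) (auto simp: replace_col_def h_def g_def b_def)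
      ultimately show ?thesis using False unfolding c sol(2) by (simp add: g_def field_simps)
    qed
  qed
  moreover have "?det g \<in> borel_measurable M" by (intro measurable_det g)
  moreover have "?det h \<in> borel_measurable M"
    using g b k(1) by (intro measurable_det) (auto simp: h_def)
  ultimately show ?thesis by simp
qed

end

section \<open>Tensor products of orthonormal families\<close>

locale tensor_basis = marginals \<mu> for \<mu> :: "'i::finite \<Rightarrow> real measure" +
  fixes \<psi> :: "'i \<Rightarrow> nat \<Rightarrow> real \<Rightarrow> real"
  assumes orthonormal: "\<And>i. orthonormal_family (\<mu> i) (\<psi> i)"
    and const: "\<And>i t. t \<in> space (\<mu> i) \<Longrightarrow> \<psi> i 0 t = 1"
begin

lemma factor_L2: "\<psi> i a \<in> L2 (\<mu> i)"
  using orthonormal[of i] by (simp add: orthonormal_family_def)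

lemma factor_inner: "(\<integral>t. \<psi> i a t * \<psi> i b t \<partial>\<mu> i) = (if a = b then 1 else 0)"
  using orthonormal[of i] by (simp add: orthonormal_family_def)

lemma factor_mean: "a \<noteq> 0 \<Longrightarrow> (\<integral>t. \<psi> i a t \<partial>\<mu> i) = 0"
proof -
  assume "a \<noteq> 0"
  have "(\<integral>t. \<psi> i a t \<partial>\<mu> i) = (\<integral>t. \<psi> i a t * \<psi> i 0 t \<partial>\<mu> i)"
    by (intro Bochner_Integration.integral_cong) (simp_all add: const)
  then show ?thesis using \<open>a \<noteq> 0\<close> by (simp add: factor_inner)
qed

lemma tensor_measurable: "tensor \<psi> \<alpha> \<in> borel_measurable (prodm \<mu>)"
proof -
  have "(\<lambda>x. \<psi> i (\<alpha> i) (x i)) \<in> borel_measurable (prodm \<mu>)" for i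
    using L2_measurable[OF factor_L2] by (intro measurable_compose[OF measurable_component_singleton]) auto
  then show ?thesis unfolding tensor_def by (intro borel_measurable_prod) auto
qed

lemma tensor_L2: "tensor \<psi> \<alpha> \<in> L2 (prodm \<mu>)"
proof -
  have "integrable (prodm \<mu>) (\<lambda>x. \<Prod>i\<in>UNIV. (\<psi> i (\<alpha> i) (x i))\<^sup>2)"
    by (intro product_integrable_prod) (auto intro: L2_square_integrable factor_L2)
  then show ?thesis
    using tensor_measurable[of \<alpha>] by (simp add: L2_def tensor_def prod_power_distrib)
qed

lemma tensor_inner: "(\<integral>x. tensor \<psi> \<alpha> x * tensor \<psi> \<beta> x \<partial>prodm \<mu>) = (if \<alpha> = \<beta> then 1 else 0)"
proof -
  have "(\<integral>x. tensor \<psi> \<alpha> x * tensor \<psi> \<beta> x \<partial>prodm \<mu>)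
      = (\<integral>x. (\<Prod>i\<in>UNIV. \<psi> i (\<alpha> i) (x i) * \<psi> i (\<beta> i) (x i)) \<partial>prodm \<mu>)"
    by (simp add: tensor_def prod.distrib)
  also have "\<dots> = (\<Prod>i\<in>UNIV. (\<integral>t. \<psi> i (\<alpha> i) t * \<psi> i (\<beta> i) t \<partial>\<mu> i))"
    by (intro product_integral_prod) (auto intro: L2_mult_integrable factor_L2)
  also have "\<dots> = (if \<alpha> = \<beta> then 1 else 0)"
    by (auto simp: factor_inner fun_eq_iff intro!: prod_zero)
  finally show ?thesis .
qed

lemma tensor_sum_L2: "(\<lambda>x. \<Sum>\<alpha>\<in>B. c \<alpha> * tensor \<psi> \<alpha> x) \<in> L2 (prodm \<mu>)"
  by (intro L2_sum L2_scale tensor_L2)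

lemma tensor_sum_square:
  assumes "finite B"
  shows "(\<integral>x. (\<Sum>\<alpha>\<in>B. c \<alpha> * tensor \<psi> \<alpha> x)\<^sup>2 \<partial>prodm \<mu>) = (\<Sum>\<alpha>\<in>B. (c \<alpha>)\<^sup>2)"
proof -
  have int: "integrable (prodm \<mu>) (\<lambda>x. tensor \<psi> \<alpha> x * tensor \<psi> \<beta> x)" for \<alpha> \<beta>
    by (intro L2_mult_integrable tensor_L2)
  have "(\<integral>x. (\<Sum>\<alpha>\<in>B. c \<alpha> * tensor \<psi> \<alpha> x)\<^sup>2 \<partial>prodm \<mu>)
     = (\<integral>x. (\<Sum>\<alpha>\<in>B. \<Sum>\<beta>\<in>B. c \<alpha> * c \<beta> * (tensor \<psi> \<alpha> x * tensor \<psi> \<beta> x)) \<partial>prodm \<mu>)"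
    by (simp add: power2_eq_square sum_product mult_ac)
  also have "\<dots> = (\<Sum>\<alpha>\<in>B. \<Sum>\<beta>\<in>B. c \<alpha> * c \<beta> * (\<integral>x. tensor \<psi> \<alpha> x * tensor \<psi> \<beta> x \<partial>prodm \<mu>))"
    by (simp add: int)
  also have "\<dots> = (\<Sum>\<alpha>\<in>B. (c \<alpha>)\<^sup>2)"
    using assms by (simp add: tensor_inner power2_eq_square if_distrib[of "(*) _"] cong: if_cong)
  finally show ?thesis .
qed

lemma tensor_mean: "(\<integral>x. tensor \<psi> \<alpha> x \<partial>prodm \<mu>) = (if \<alpha> = (\<lambda>_. 0) then 1 else 0)"
proof -
  have "(\<integral>x. tensor \<psi> \<alpha> x \<partial>prodm \<mu>) = (\<integral>x. tensor \<psi> \<alpha> x * tensor \<psi> (\<lambda>_. 0) x \<partial>prodm \<mu>)"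
    by (intro Bochner_Integration.integral_cong)
      (simp_all add: tensor_def[of \<psi> "\<lambda>_. 0"] const space_PiM PiE_def Pi_def)
  then show ?thesis by (simp add: tensor_inner)
qed

text \<open>The coordinates on which the basis function for \<open>\<alpha>\<close> genuinely depends.\<close>

definition supp :: "('i \<Rightarrow> nat) \<Rightarrow> 'i set" where
  "supp \<alpha> = {i. \<alpha> i \<noteq> 0}"

text \<open>The component for \<open>U\<close> of a finite expansion collects the terms whose multi-index is supported
  exactly on \<open>U\<close>.\<close>

definition tensor_part :: "('i \<Rightarrow> nat) set \<Rightarrow> (('i \<Rightarrow> nat) \<Rightarrow> real) \<Rightarrow> 'i set \<Rightarrow> ('i \<Rightarrow> real) \<Rightarrow> real" where
  "tensor_part A c U x = (\<Sum>\<alpha>\<in>{\<alpha>\<in>A. supp \<alpha> = U}. c \<alpha> * tensor \<psi> \<alpha> x)"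

lemma supp_empty_iff: "supp \<alpha> = {} \<longleftrightarrow> \<alpha> = (\<lambda>_. 0)"
  by (auto simp: supp_def fun_eq_iff)

lemma tensor_update:
  "tensor \<psi> \<alpha> (x(i := t)) = \<psi> i (\<alpha> i) t * (\<Prod>j\<in>UNIV - {i}. \<psi> j (\<alpha> j) (x j))"
  unfolding tensor_def by (subst prod.remove[of _ i]) (auto intro!: prod.cong)

lemma tensor_decomposition:
  assumes A: "finite A"
  shows "sobol_decomposition \<mu> (\<lambda>x. \<Sum>\<alpha>\<in>A. c \<alpha> * tensor \<psi> \<alpha> x) (tensor_part A c)"
  unfolding sobol_decomposition_def
proof (intro conjI allI ballI impI)
  fix U show "tensor_part A c U \<in> L2 (prodm \<mu>)" unfolding tensor_part_def by (rule tensor_sum_L2)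
next
  have "(\<Sum>\<alpha>\<in>A. c \<alpha> * tensor \<psi> \<alpha> x) = (\<Sum>U\<in>UNIV. tensor_part A c U x)" for x
    unfolding tensor_part_def using A by (intro sum.group[symmetric]) auto
  then show "AE x in prodm \<mu>. (\<Sum>\<alpha>\<in>A. c \<alpha> * tensor \<psi> \<alpha> x) = (\<Sum>U\<in>UNIV. tensor_part A c U x)" by simp
next
  fix U x y assume xy: "x \<in> space (prodm \<mu>)" "y \<in> space (prodm \<mu>)" "\<forall>i\<in>U. x i = y i"
  have "tensor \<psi> \<alpha> x = tensor \<psi> \<alpha> y" if "supp \<alpha> = U" for \<alpha>
    unfolding tensor_def
  proof (intro prod.cong refl)
    fix i
    show "\<psi> i (\<alpha> i) (x i) = \<psi> i (\<alpha> i) (y i)"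
    proof (cases "i \<in> U")
      case False
      then have "\<alpha> i = 0" using that by (auto simp: supp_def)
      then show ?thesis using xy by (simp add: const space_PiM PiE_def Pi_def)
    qed (use xy in simp)
  qed
  then show "tensor_part A c U x = tensor_part A c U y" unfolding tensor_part_def by (auto intro!: sum.cong)
next
  fix x assume x: "x \<in> space (prodm \<mu>)"
  have "tensor \<psi> (\<lambda>_. 0) x = 1" using x by (simp add: tensor_def const space_PiM PiE_def Pi_def)
  moreover have "{\<alpha>\<in>A. supp \<alpha> = {}} = (if (\<lambda>_. 0) \<in> A then {\<lambda>_. 0} else {})"
    by (auto simp: supp_empty_iff)
  moreover have "(\<integral>y. (\<Sum>\<alpha>\<in>A. c \<alpha> * tensor \<psi> \<alpha> y) \<partial>prodm \<mu>) = (\<Sum>\<alpha>\<in>A. c \<alpha> * (if \<alpha> = (\<lambda>_. 0) then 1 else 0))"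
    by (simp add: L2_integrable[OF prodm_finite tensor_L2] tensor_mean)
  ultimately show "tensor_part A c {} x = (\<integral>y. (\<Sum>\<alpha>\<in>A. c \<alpha> * tensor \<psi> \<alpha> y) \<partial>prodm \<mu>)"
    using A unfolding tensor_part_def by (simp add: if_distrib[of "(*) _"] cong: if_cong)
next
  fix U :: "'i set" and i assume i: "i \<in> U"
  have int: "integrable (\<mu> i) (\<psi> i a)" for a
    by (intro L2_integrable factor_L2 prob_space.axioms(1)[OF \<mu>_prob])
  have "(\<integral>t. tensor_part A c U (x(i := t)) \<partial>\<mu> i) = 0" for x
  proof -
    have "(\<integral>t. tensor_part A c U (x(i := t)) \<partial>\<mu> i)
      = (\<Sum>\<alpha>\<in>{\<alpha>\<in>A. supp \<alpha> = U}. c \<alpha> * ((\<integral>t. \<psi> i (\<alpha> i) t \<partial>\<mu> i) * (\<Prod>j\<in>UNIV - {i}. \<psi> j (\<alpha> j) (x j))))"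
      unfolding tensor_part_def tensor_update by (simp add: int)
    also have "\<dots> = 0" using i by (intro sum.neutral) (auto simp: supp_def factor_mean)
    finally show ?thesis .
  qed
  then show "AE x in prodm \<mu>. (\<integral>t. tensor_part A c U (x(i := t)) \<partial>\<mu> i) = 0" by simp
qed

end

section \<open>The lower tail of the smallest eigenvalue of the Gram matrix\<close>

text \<open>A finite orthonormal family whose sum of squares is bounded pointwise by \<open>K\<close>.\<close>

locale bounded_frame = Q: prob_space Q for Q :: "'a measure" +
  fixes A :: "'b set" and \<Psi> :: "'b \<Rightarrow> 'a \<Rightarrow> real" and K :: real
  assumes fin: "finite A"
    and meas: "a \<in> A \<Longrightarrow> \<Psi> a \<in> L2 Q"
    and inner: "a \<in> A \<Longrightarrow> b \<in> A \<Longrightarrow> (\<integral>x. \<Psi> a x * \<Psi> b x \<partial>Q) = (if a = b then 1 else 0)"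
    and K_bound: "x \<in> space Q \<Longrightarrow> (\<Sum>a\<in>A. (\<Psi> a x)\<^sup>2) \<le> K"
    and K_pos: "0 < K"
begin

text \<open>The vector of values of all basis functions at \<open>x\<close>, a row of the design matrix.\<close>

definition feature :: "'a \<Rightarrow> 'b \<Rightarrow> real" where
  "feature x = (\<lambda>a. \<Psi> a x)"

lemma ip_feature: "x \<in> space Q \<Longrightarrow> ip A (feature x) (feature x) \<le> K"
  using K_bound[of x] by (simp add: ip_def feature_def power2_eq_square)

lemma card_le_K: "real (card A) \<le> K"
proof -
  have "real (card A) = (\<Sum>a\<in>A. (\<integral>x. \<Psi> a x * \<Psi> a x \<partial>Q))" by (simp add: inner)
  also have "\<dots> = (\<integral>x. (\<Sum>a\<in>A. \<Psi> a x * \<Psi> a x) \<partial>Q)"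
    by (subst Bochner_Integration.integral_sum) (auto intro: L2_mult_integrable meas)
  also have "\<dots> \<le> (\<integral>x. K \<partial>Q)"
    using K_bound K_pos by (intro integral_mono') (auto simp: power2_eq_square)
  finally show ?thesis by (simp add: Q.prob_space)
qed

text \<open>The operator \<open>I - \<epsilon> S\<close>, where \<open>S\<close> is the Gram matrix of the first \<open>k\<close> sample points.\<close>

definition gram_op :: "real \<Rightarrow> (nat \<Rightarrow> 'a) \<Rightarrow> nat \<Rightarrow> ('b \<Rightarrow> real) \<Rightarrow> 'b \<Rightarrow> real" where
  "gram_op \<epsilon> xs k w = (\<lambda>a. w a - \<epsilon> * (\<Sum>j<k. ip A (feature (xs j)) w * feature (xs j) a))"

lemma gram_op_form: "ip A y (gram_op \<epsilon> xs k w)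
    = ip A y w - \<epsilon> * (\<Sum>j<k. ip A (feature (xs j)) y * ip A (feature (xs j)) w)"
proof -
  have "ip A y (\<lambda>a. \<Sum>j<k. ip A (feature (xs j)) w * feature (xs j) a)
      = (\<Sum>j<k. ip A (feature (xs j)) y * ip A (feature (xs j)) w)"
    unfolding ip_commute[of A y] ip_sum_left by (simp add: mult.commute)
  then show ?thesis
    using ip_add_scale_right[of A y w "- \<epsilon>" "\<lambda>a. \<Sum>j<k. ip A (feature (xs j)) w * feature (xs j) a"]
    by (simp add: gram_op_def)
qed

lemma gram_op_Suc: "gram_op \<epsilon> xs (Suc k) w
    = (\<lambda>a. gram_op \<epsilon> xs k w a - \<epsilon> * ip A (feature (xs k)) w * feature (xs k) a)"
  by (rule ext) (simp add: gram_op_def algebra_simps)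

lemma gram_op_cong: "(\<And>j. j < k \<Longrightarrow> xs j = ys j) \<Longrightarrow> gram_op \<epsilon> xs k = gram_op \<epsilon> ys k"
  by (intro ext) (simp add: gram_op_def)

lemma gram_op_sym: "sym_op A (gram_op \<epsilon> xs k)"
proof
  show "finite A" by (rule fin)
  show "gram_op \<epsilon> xs k (\<lambda>a. x a + c * y a) = (\<lambda>a. gram_op \<epsilon> xs k x a + c * gram_op \<epsilon> xs k y a)" for x c y
    by (rule ext)
      (simp add: gram_op_def ip_add_scale_right distrib_right sum.distrib sum_distrib_left algebra_simps)
  show "ip A (gram_op \<epsilon> xs k x) y = ip A x (gram_op \<epsilon> xs k y)" for x y
    by (subst ip_commute) (simp add: gram_op_form ip_commute[of A y x] mult.commute)
qed

lemma gram_op_pos: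
  assumes "0 < \<epsilon>" "\<epsilon> * K * real n < 1" "k \<le> n" "\<And>j. j < k \<Longrightarrow> xs j \<in> space Q"
  shows "pos_op A (gram_op \<epsilon> xs k) (1 - \<epsilon> * K * real n)"
proof -
  interpret sym_op A "gram_op \<epsilon> xs k" by (rule gram_op_sym)
  show ?thesis
  proof
    show "0 < 1 - \<epsilon> * K * real n" using assms by simp
    show "(1 - \<epsilon> * K * real n) * ip A w w \<le> ip A w (gram_op \<epsilon> xs k w)" for w
    proof -
      have "(\<Sum>j<k. ip A (feature (xs j)) w * ip A (feature (xs j)) w) \<le> (\<Sum>j<k. K * ip A w w)"
      proof (rule sum_mono)
        fix j assume "j \<in> {..<k}"
        then have "ip A (feature (xs j)) (feature (xs j)) * ip A w w \<le> K * ip A w w"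
          using assms by (intro mult_right_mono ip_feature ip_nonneg) auto
        then show "ip A (feature (xs j)) w * ip A (feature (xs j)) w \<le> K * ip A w w"
          using ip_cauchy_schwarz[of A "feature (xs j)" w] by (simp add: power2_eq_square)
      qed
      also have "\<dots> = real k * (K * ip A w w)" by simp
      also have "\<dots> \<le> real n * (K * ip A w w)"
        using assms K_pos ip_nonneg[of A w] by (intro mult_right_mono) auto
      finally have "\<epsilon> * (\<Sum>j<k. ip A (feature (xs j)) w * ip A (feature (xs j)) w) \<le> \<epsilon> * (real n * (K * ip A w w))"
        using assms by (intro mult_left_mono) auto
      then show ?thesis unfolding gram_op_form by (simp add: algebra_simps)
    qed
    show "ip A w (gram_op \<epsilon> xs k w) \<le> ip A w w" for w
    proof -
      have "0 \<le> (\<Sum>j<k. ip A (feature (xs j)) w * ip A (feature (xs j)) w)" by (intro sum_nonneg) simp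
      then show ?thesis using assms unfolding gram_op_form by simp
    qed
  qed
qed

text \<open>By orthonormality the expectation of \<open>v v\<^sup>T\<close> is the identity.\<close>

lemma expected_moment:
  assumes "sym_op A T"
  shows "integrable Q (\<lambda>x. ip A (feature x) ((T ^^ q) (feature x)))"
    "(\<integral>x. ip A (feature x) ((T ^^ q) (feature x)) \<partial>Q) = tr_pow A T q"
proof -
  have int: "integrable Q (\<lambda>x. \<Psi> a x * \<Psi> c x)" if "a \<in> A" "c \<in> A" for a c
    using that by (intro L2_mult_integrable meas)
  have expand: "ip A (feature x) ((T ^^ q) (feature x)) = (\<Sum>a\<in>A. \<Sum>c\<in>A. \<Psi> a x * \<Psi> c x * (T ^^ q) (unit_fun c) a)" for x
    using sym_op.ip_pow_expand[OF assms, of "feature x" q] by (simp add: feature_def)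
  show "integrable Q (\<lambda>x. ip A (feature x) ((T ^^ q) (feature x)))"
    unfolding expand by (intro Bochner_Integration.integrable_sum integrable_mult_left int)
  have "(\<integral>x. ip A (feature x) ((T ^^ q) (feature x)) \<partial>Q)
      = (\<Sum>a\<in>A. \<Sum>c\<in>A. (\<integral>x. \<Psi> a x * \<Psi> c x \<partial>Q) * (T ^^ q) (unit_fun c) a)"
    unfolding expand
    by (subst Bochner_Integration.integral_sum)
      (auto intro!: Bochner_Integration.integrable_sum integrable_mult_left int sum.cong
        simp: Bochner_Integration.integral_sum int)
  also have "\<dots> = (\<Sum>a\<in>A. \<Sum>c\<in>A. if c = a then (T ^^ q) (unit_fun a) a else 0)"
    by (intro sum.cong refl) (simp add: inner)
  also have "\<dots> = tr_pow A T q" using fin by (simp add: tr_pow_def)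
  finally show "(\<integral>x. ip A (feature x) ((T ^^ q) (feature x)) \<partial>Q) = tr_pow A T q" .
qed

lemma ip_scale: "ip A (\<lambda>a. c * x a) y = c * ip A x y" "ip A y (\<lambda>a. c * x a) = c * ip A y x"
  by (simp_all add: ip_def sum_distrib_left mult_ac)

lemma gram_op_step:
  assumes \<epsilon>: "0 < \<epsilon>" "\<epsilon> * K * real n < 1" and k: "k < n" and xs: "\<And>j. j \<le> k \<Longrightarrow> xs j \<in> space Q"
    and q: "even q"
  shows "tr_pow A (gram_op \<epsilon> xs (Suc k)) (q + 2) \<le> tr_pow A (gram_op \<epsilon> xs k) (q + 2)
    - \<epsilon> * (real (q + 2) * (1 - \<epsilon> * K * real n) - real (q + 2) * real (q + 1) / 2 * (\<epsilon> * K))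
      * ip A (feature (xs k)) ((gram_op \<epsilon> xs k ^^ q) (feature (xs k)))"
proof -
  let ?T = "gram_op \<epsilon> xs k" and ?T' = "gram_op \<epsilon> xs (Suc k)" and ?b = "1 - \<epsilon> * K * real n"
  define v where "v = (\<lambda>a. sqrt \<epsilon> * feature (xs k) a)"
  interpret T: pos_op A ?T ?b using assms by (intro gram_op_pos) auto
  interpret T': pos_op A ?T' ?b using assms by (intro gram_op_pos) auto
  interpret rank_one_update A ?T ?T' ?b ?b v
  proof
    show "?T' w = (\<lambda>a. ?T w a + (- ip A v w) * v a)" for w
      unfolding gram_op_Suc v_def ip_scale using \<epsilon> by (auto simp: fun_eq_iff)
  qed
  let ?m = "ip A (feature (xs k)) ((?T ^^ q) (feature (xs k)))"
  have "(?T ^^ q) v = (\<lambda>a. sqrt \<epsilon> * (?T ^^ q) (feature (xs k)) a)"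
    using T.pow_lin_sum[of "{()}" q "\<lambda>_. sqrt \<epsilon>" "\<lambda>_. feature (xs k)"] by (simp add: v_def)
  then have mv: "ip A v ((?T ^^ q) v) = \<epsilon> * ?m" using \<epsilon> by (simp add: v_def ip_scale)
  have vv: "ip A v v \<le> \<epsilon> * K"
    using \<epsilon> ip_feature[OF xs[of k]] by (simp add: v_def ip_scale flip: mult.assoc)
  have "(real (q + 2) * ?b - real (q + 2) * real (q + 1) / 2 * (\<epsilon> * K)) * (\<epsilon> * ?m)
      \<le> (real (q + 2) * ?b - real (q + 2) * real (q + 1) / 2 * ip A v v) * (\<epsilon> * ?m)"
    using \<epsilon> T.moment_nonneg[of "feature (xs k)" q] vv
    by (intro mult_right_mono diff_left_mono mult_left_mono) auto
  with tr_pow_update_even[OF q] show ?thesis unfolding mv by (simp add: mult_ac)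
qed

lemma measurable_gram_op:
  assumes "\<And>a. a \<in> A \<Longrightarrow> (\<lambda>xs. W xs a) \<in> borel_measurable M'"
    and X: "\<And>j. j < k \<Longrightarrow> (\<lambda>xs. X xs j) \<in> M' \<rightarrow>\<^sub>M Q" and a: "a \<in> A"
  shows "(\<lambda>xs. gram_op \<epsilon> (X xs) k (W xs) a) \<in> borel_measurable M'"
proof -
  have feature: "(\<lambda>xs. feature (X xs j) a) \<in> borel_measurable M'" if "j < k" "a \<in> A" for j a
    unfolding feature_def using that by (intro measurable_compose[OF X] L2_measurable meas)
  show ?thesis
    unfolding gram_op_def ip_def using assms feature
    by (intro borel_measurable_diff borel_measurable_times borel_measurable_sum borel_measurable_const) auto
qed

lemma measurable_tr_pow:
  assumes X: "\<And>j. j < k \<Longrightarrow> (\<lambda>xs. X xs j) \<in> M' \<rightarrow>\<^sub>M Q"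
  shows "(\<lambda>xs. tr_pow A (gram_op \<epsilon> (X xs) k) p) \<in> borel_measurable M'"
proof -
  have "(\<lambda>xs. (gram_op \<epsilon> (X xs) k ^^ p) w a) \<in> borel_measurable M'" if "a \<in> A" for w a
    using that by (induction p arbitrary: a) (auto intro!: measurable_gram_op X)
  then show ?thesis unfolding tr_pow_def by (intro borel_measurable_sum) auto
qed

lemma tr_pow_gram_bounds:
  assumes "0 < \<epsilon>" "\<epsilon> * K * real n < 1" "k \<le> n" "\<And>j. j < k \<Longrightarrow> xs j \<in> space Q" "even p"
  shows "0 \<le> tr_pow A (gram_op \<epsilon> xs k) p" "tr_pow A (gram_op \<epsilon> xs k) p \<le> real (card A)"
proof -
  interpret pos_op A "gram_op \<epsilon> xs k" "1 - \<epsilon> * K * real n" using assms by (intro gram_op_pos) auto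
  obtain i where "p = i + i" using assms(5) by (auto elim!: evenE simp: mult_2)
  then show "0 \<le> tr_pow A (gram_op \<epsilon> xs k) p" "tr_pow A (gram_op \<epsilon> xs k) p \<le> real (card A)"
    using tr_pow_even_bounds[of i] by auto
qed

text \<open>Each sample point shrinks the expected potential by the factor \<open>1 - \<gamma>\<close>, because a power of
  the operator with a smaller even exponent has a larger trace.\<close>

lemma expected_tr_pow:
  fixes n q :: nat and \<epsilon> :: real
  defines "\<gamma> \<equiv> \<epsilon> * (real (q + 2) * (1 - \<epsilon> * K * real n) - real (q + 2) * real (q + 1) / 2 * (\<epsilon> * K))"
  assumes \<epsilon>: "0 < \<epsilon>" "\<epsilon> * K * real n < 1" and q: "even q" and \<gamma>: "0 \<le> \<gamma>" "\<gamma> \<le> 1" and k: "k \<le> n"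
  shows "(\<integral>xs. tr_pow A (gram_op \<epsilon> xs k) (q + 2) \<partial>PiM {..<k} (\<lambda>_. Q)) \<le> real (card A) * (1 - \<gamma>) ^ k"
  using k
proof (induction k)
  case 0
  interpret P0: product_prob_space "\<lambda>_::nat. Q" "{..<0}" by (intro product_prob_spaceI Q.prob_space_axioms)
  define T0 where "T0 = gram_op \<epsilon> undefined 0"
  have "gram_op \<epsilon> xs 0 = T0" for xs unfolding T0_def by (rule gram_op_cong) simp
  then have "(\<integral>xs. tr_pow A (gram_op \<epsilon> xs 0) (q + 2) \<partial>PiM {..<0} (\<lambda>_. Q)) = tr_pow A T0 (q + 2)"
    using P0.P.prob_space by simp
  also have "\<dots> \<le> real (card A)"
    unfolding T0_def using q by (intro tr_pow_gram_bounds(2)[OF \<epsilon>]) auto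
  finally show ?case by simp
next
  case (Suc k)
  interpret Pk: product_prob_space "\<lambda>_::nat. Q" "{..<k}" by (intro product_prob_spaceI Q.prob_space_axioms)
  let ?Z = "\<lambda>xs k. tr_pow A (gram_op \<epsilon> xs k) (q + 2)"
  let ?P = "\<lambda>k. PiM {..<k} (\<lambda>_. Q)"
  have sp: "xs j \<in> space Q" if "xs \<in> space (?P l)" "j < l" for xs j l
    using that by (auto simp: space_PiM PiE_def Pi_def)
  have Zint: "integrable (?P l) (\<lambda>xs. ?Z xs l)" if "l \<le> n" for l
  proof -
    interpret Pl: product_prob_space "\<lambda>_::nat. Q" "{..<l}" by (intro product_prob_spaceI Q.prob_space_axioms)
    show ?thesis
    proof (rule Pl.P.integrable_const_bound[where B = "real (card A)"])
      show "AE xs in ?P l. norm (?Z xs l) \<le> real (card A)"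
      proof (rule AE_I2)
        fix xs assume xs: "xs \<in> space (?P l)"
        have "0 \<le> ?Z xs l" "?Z xs l \<le> real (card A)"
          by (rule tr_pow_gram_bounds[OF \<epsilon> that]; use sp[OF xs] q in simp)+
        then show "norm (?Z xs l) \<le> real (card A)" by simp
      qed
      show "(\<lambda>xs. ?Z xs l) \<in> borel_measurable (?P l)"
        by (rule measurable_tr_pow) (auto intro: measurable_component_singleton)
    qed
  qed
  have ins: "insert k {..<k} = {..<Suc k}" by auto
  have "(\<integral>xs. ?Z xs (Suc k) \<partial>?P (Suc k)) = (\<integral>xs. (\<integral>x. ?Z (xs(k := x)) (Suc k) \<partial>Q) \<partial>?P k)"
    using Pk.product_integral_insert[of "{..<k}" k "\<lambda>xs. ?Z xs (Suc k)"] Zint[OF Suc.prems]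
    unfolding ins by simp
  also have "\<dots> \<le> (\<integral>xs. (1 - \<gamma>) * ?Z xs k \<partial>?P k)"
  proof (rule integral_mono')
    show "integrable (?P k) (\<lambda>xs. (1 - \<gamma>) * ?Z xs k)" using Zint Suc.prems by simp
    fix xs assume xs: "xs \<in> space (?P k)"
    let ?T = "gram_op \<epsilon> xs k"
    interpret T: pos_op A ?T "1 - \<epsilon> * K * real n"
      using xs Suc.prems by (intro gram_op_pos \<epsilon>) (auto intro: sp)
    have q2: "tr_pow A ?T (q + 2) \<le> tr_pow A ?T q"
    proof -
      obtain i where i: "q = i + i" using q by (auto elim!: evenE simp: mult_2)
      show ?thesis using T.tr_pow_even_antimono[of i] by (simp add: i)
    qed
    have Tx: "gram_op \<epsilon> (xs(k := x)) k = ?T" for x by (rule gram_op_cong) simp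
    have m: "integrable Q (\<lambda>x. ip A (feature x) ((?T ^^ q) (feature x)))"
      "(\<integral>x. ip A (feature x) ((?T ^^ q) (feature x)) \<partial>Q) = tr_pow A ?T q"
      by (rule expected_moment[OF T.sym_op_axioms])+
    have "(\<integral>x. ?Z (xs(k := x)) (Suc k) \<partial>Q)
        \<le> (\<integral>x. ?Z xs k - \<gamma> * ip A (feature x) ((?T ^^ q) (feature x)) \<partial>Q)"
    proof (rule integral_mono')
      show "integrable Q (\<lambda>x. ?Z xs k - \<gamma> * ip A (feature x) ((?T ^^ q) (feature x)))"
        using m by simp
      fix x assume x: "x \<in> space Q"
      have sp': "(xs(k := x)) j \<in> space Q" if "j \<le> k" for j
        using that x sp[OF xs, of j] by auto
      show "?Z (xs(k := x)) (Suc k) \<le> ?Z xs k - \<gamma> * ip A (feature x) ((?T ^^ q) (feature x))"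
        using gram_op_step[OF \<epsilon> _ _ q, of k "xs(k := x)"] sp' Suc.prems unfolding Tx \<gamma>_def by simp
      moreover have "0 \<le> ?Z (xs(k := x)) (Suc k)"
        using sp' Suc.prems q by (intro tr_pow_gram_bounds(1)[OF \<epsilon>]) auto
      ultimately show "0 \<le> ?Z xs k - \<gamma> * ip A (feature x) ((?T ^^ q) (feature x))" by linarith
    qed
    also have "\<dots> = ?Z xs k - \<gamma> * tr_pow A ?T q" using m by (simp add: Q.prob_space)
    also have "\<dots> \<le> ?Z xs k - \<gamma> * ?Z xs k" using q2 \<gamma> by (intro diff_left_mono mult_left_mono)
    finally show "(\<integral>x. ?Z (xs(k := x)) (Suc k) \<partial>Q) \<le> (1 - \<gamma>) * ?Z xs k" by (simp add: algebra_simps)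
    show "0 \<le> (1 - \<gamma>) * ?Z xs k"
      using \<gamma> xs Suc.prems q by (intro mult_nonneg_nonneg tr_pow_gram_bounds(1)[OF \<epsilon>]) (auto intro: sp)
  qed
  also have "\<dots> = (1 - \<gamma>) * (\<integral>xs. ?Z xs k \<partial>?P k)" by simp
  also have "\<dots> \<le> (1 - \<gamma>) * (real (card A) * (1 - \<gamma>) ^ k)"
    using Suc \<gamma> by (intro mult_left_mono) auto
  finally show ?case by (simp add: mult_ac)
qed

text \<open>If \<open>\<langle>w, S w\<rangle> < lam \<parallel>w\<parallel>\<^sup>2\<close>, then \<open>\<langle>w, (I - \<epsilon> S) w\<rangle> > (1 - \<epsilon> lam) \<parallel>w\<parallel>\<^sup>2\<close> and the
  trace of the \<open>p\<close>-th power exceeds \<open>(1 - \<epsilon> lam)\<^sup>p\<close>.\<close>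

lemma small_trace_coercive:
  assumes \<epsilon>: "0 < \<epsilon>" "\<epsilon> * K * real n < 1" and xs: "\<And>j. j < n \<Longrightarrow> xs j \<in> space Q" and p: "even p"
    and small: "tr_pow A (gram_op \<epsilon> xs n) p < (1 - \<epsilon> * lam) ^ p" and lam: "\<epsilon> * lam \<le> 1"
  shows "lam * (\<Sum>a\<in>A. (w a)\<^sup>2) \<le> (\<Sum>j<n. (\<Sum>a\<in>A. w a * \<Psi> a (xs j))\<^sup>2)"
proof (rule ccontr)
  assume neg: "\<not> ?thesis"
  interpret pos_op A "gram_op \<epsilon> xs n" "1 - \<epsilon> * K * real n" using xs by (intro gram_op_pos \<epsilon>) auto
  let ?S = "\<Sum>j<n. ip A (feature (xs j)) w * ip A (feature (xs j)) w"
  have r: "ip A (feature x) w = (\<Sum>a\<in>A. w a * \<Psi> a x)" for x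
    by (simp add: ip_def feature_def mult.commute)
  have ww: "ip A w w = (\<Sum>a\<in>A. (w a)\<^sup>2)" by (simp add: ip_def power2_eq_square)
  have S: "?S < lam * ip A w w"
    using neg unfolding r ww power2_eq_square[symmetric] by simp
  have "0 \<le> ?S" by (intro sum_nonneg) auto
  then have "ip A w w \<noteq> 0" using S by auto
  then have w: "0 < ip A w w" using ip_nonneg[of A w] by simp
  have "(1 - \<epsilon> * lam) * ip A w w \<le> ip A w (gram_op \<epsilon> xs n w)"
    using mult_left_mono[OF less_imp_le[OF S], of \<epsilon>] \<epsilon> by (simp add: gram_op_form algebra_simps)
  then have "(1 - \<epsilon> * lam) ^ p * ip A w w \<le> ip A w ((gram_op \<epsilon> xs n ^^ p) w)"
    using lam by (intro moment_ratio) auto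
  also obtain i where i: "p = i + i" using p by (auto elim!: evenE simp: mult_2)
  have "ip A w ((gram_op \<epsilon> xs n ^^ p) w) \<le> tr_pow A (gram_op \<epsilon> xs n) p * ip A w w"
    unfolding i by (rule ip_pow_le_tr)
  finally show False using w small by simp
qed

lemma iid_distr:
  assumes M: "prob_space M" and n: "0 < (n::nat)"
    and indep: "prob_space.indep_vars M (\<lambda>_. Q) \<xi> {..<n}"
    and distr: "\<And>j. j < n \<Longrightarrow> distr M Q (\<xi> j) = Q"
  shows "distr M (PiM {..<n} (\<lambda>_. Q)) (\<lambda>\<omega>. \<lambda>j\<in>{..<n}. \<xi> j \<omega>) = PiM {..<n} (\<lambda>_. Q)"
    "\<And>j. j < n \<Longrightarrow> \<xi> j \<in> M \<rightarrow>\<^sub>M Q"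
proof -
  interpret M: prob_space M by (rule M)
  show rv: "\<xi> j \<in> M \<rightarrow>\<^sub>M Q" if "j < n" for j
    using indep that unfolding M.indep_vars_def by auto
  have "distr M (PiM {..<n} (\<lambda>_. Q)) (\<lambda>\<omega>. \<lambda>j\<in>{..<n}. \<xi> j \<omega>) = (\<Pi>\<^sub>M j\<in>{..<n}. distr M Q (\<xi> j))"
    using indep n rv by (subst (asm) M.indep_vars_iff_distr_eq_PiM') auto
  also have "\<dots> = PiM {..<n} (\<lambda>_. Q)" by (intro PiM_cong) (auto simp: distr)
  finally show "distr M (PiM {..<n} (\<lambda>_. Q)) (\<lambda>\<omega>. \<lambda>j\<in>{..<n}. \<xi> j \<omega>) = PiM {..<n} (\<lambda>_. Q)" .
qed

text \<open>Markov's inequality for the potential. For small \<open>\<epsilon>\<close> the exponent of the expected potential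
  is \<open>- \<theta> (1 - \<theta> / 2) n / K\<close> with \<open>\<theta> = \<epsilon> p K\<close>, and the threshold for smallest eigenvalue
  \<open>n / 2\<close> is about \<open>exp (- \<theta> n / (2 K))\<close>. The choice \<open>\<theta> = 1 / 2\<close> optimises the quotient and gives the
  rate \<open>1 / 8\<close>; taking \<open>p = 100 n\<close> costs a little of it and leaves \<open>0.12\<close>.\<close>

theorem coercive_tail:
  assumes M: "prob_space M" and n: "0 < (n::nat)" and K1: "1 \<le> K" 
    and indep: "prob_space.indep_vars M (\<lambda>_. Q) \<xi> {..<n}"
    and distr: "\<And>j. j < n \<Longrightarrow> distr M Q (\<xi> j) = Q"
  obtains B where "B \<in> sets M" "measure M B \<le> real (card A) * exp (- 0.12 * (real n / K))"
    "\<And>\<omega> w. \<omega> \<in> space M - B \<Longrightarrow> real n / 2 * (\<Sum>a\<in>A. (w a)\<^sup>2) \<le> (\<Sum>j<n. (\<Sum>a\<in>A. w a * \<Psi> a (\<xi> j \<omega>))\<^sup>2)"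
proof -
  interpret M: prob_space M by (rule M)
  have rv: "\<xi> j \<in> M \<rightarrow>\<^sub>M Q" if "j < n" for j
    using iid_distr(2)[OF M n indep distr] that by simp
  have D: "distr M (PiM {..<n} (\<lambda>_. Q)) (\<lambda>\<omega>. \<lambda>j\<in>{..<n}. \<xi> j \<omega>) = PiM {..<n} (\<lambda>_. Q)"
    by (rule iid_distr(1)[OF M n indep]) (rule distr)
  define p where "p = 100 * n"
  define q where "q = p - 2"
  have p: "p = q + 2" "even q" "even p" using n by (auto simp: p_def q_def)
  define \<epsilon> where "\<epsilon> = 1 / (2 * real p * K)"
  have \<epsilon>0: "0 < \<epsilon>" using n K1 by (simp add: \<epsilon>_def p_def)
  have \<epsilon>K: "\<epsilon> * K * real n = 1 / 200" using n K1 by (simp add: \<epsilon>_def p_def)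
  have \<epsilon>p: "\<epsilon> * real p = 1 / (2 * K)" using n by (simp add: \<epsilon>_def p_def)
  have \<epsilon>n: "\<epsilon> * (real n / 2) = 1 / (400 * K)" using n by (simp add: \<epsilon>_def p_def)
  define \<gamma> where "\<gamma> = \<epsilon> * (real (q + 2) * (1 - \<epsilon> * K * real n) - real (q + 2) * real (q + 1) / 2 * (\<epsilon> * K))"
  have \<gamma>: "\<gamma> = (1 / (2 * K)) * (199 / 200 - real (q + 1) * \<epsilon> * K / 2)"
  proof -
    have "\<gamma> = (\<epsilon> * real p) * ((1 - \<epsilon> * K * real n) - real (q + 1) * \<epsilon> * K / 2)"
      unfolding \<gamma>_def p(1) by (simp add: algebra_simps)
    then show ?thesis unfolding \<epsilon>p \<epsilon>K by simp
  qed
  have q1: "0 \<le> real (q + 1) * \<epsilon> * K" "real (q + 1) * \<epsilon> * K \<le> 1 / 2"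
  proof -
    show "0 \<le> real (q + 1) * \<epsilon> * K" using \<epsilon>0 K1 by simp
    have "real (q + 1) * \<epsilon> * K \<le> real p * \<epsilon> * K"
      using \<epsilon>0 K1 by (intro mult_right_mono) (auto simp: p)
    also have "\<dots> = 1 / 2" using \<epsilon>p K1 by (simp add: mult_ac)
    finally show "real (q + 1) * \<epsilon> * K \<le> 1 / 2" .
  qed
  \<comment> \<open>\<open>149 / 400\<close> is \<open>(1 - 1 / 200 - 1 / 4) / 2\<close>, close to \<open>\<theta> (1 - \<theta> / 2) = 3 / 8\<close>\<close>
  have \<gamma>_lower: "149 / (400 * K) \<le> \<gamma>"
  proof -
    have "(1 / (2 * K)) * (149 / 200) \<le> \<gamma>"
      unfolding \<gamma>
    proof (rule mult_left_mono)
      show "149 / 200 \<le> 199 / 200 - real (q + 1) * \<epsilon> * K / 2" using q1(2) by linarith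
    qed (use K1 in auto)
    then show ?thesis by simp
  qed
  have \<gamma>_upper: "\<gamma> \<le> 1"
  proof -
    have "\<gamma> \<le> (1 / (2 * K)) * 1" unfolding \<gamma> using q1 K1 by (intro mult_left_mono) auto
    also have "\<dots> \<le> 1" using K1 by simp
    finally show ?thesis .
  qed
  have \<gamma>0: "0 \<le> \<gamma>" using \<gamma>_lower K1 by (meson divide_nonneg_nonneg mult_nonneg_nonneg order_trans zero_le_numeral zero_le_one)
  define Z where "Z = (\<lambda>\<omega>. tr_pow A (gram_op \<epsilon> (\<lambda>j. \<xi> j \<omega>) n) p)"
  define \<tau> where "\<tau> = (1 - \<epsilon> * (real n / 2)) ^ p"
  have sp: "\<xi> j \<omega> \<in> space Q" if "\<omega> \<in> space M" "j < n" for j \<omega>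
    using measurable_space[OF rv[OF that(2)] that(1)] .
  have Zmeas [measurable]: "Z \<in> borel_measurable M"
    unfolding Z_def by (rule measurable_tr_pow) (rule rv)
  have Zb: "0 \<le> Z \<omega>" "Z \<omega> \<le> real (card A)" if "\<omega> \<in> space M" for \<omega>
    unfolding Z_def using that \<epsilon>K p(3) sp by (auto intro!: tr_pow_gram_bounds[where n = n] \<epsilon>0)
  have Zint: "integrable M Z"
    by (rule M.integrable_const_bound[where B = "real (card A)"]) (auto intro!: AE_I2 simp: Zb)
  have EZ: "(\<integral>\<omega>. Z \<omega> \<partial>M) \<le> real (card A) * (1 - \<gamma>) ^ n"
  proof -
    have "(\<integral>\<omega>. Z \<omega> \<partial>M) = (\<integral>\<omega>. tr_pow A (gram_op \<epsilon> (\<lambda>j\<in>{..<n}. \<xi> j \<omega>) n) p \<partial>M)"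
      unfolding Z_def
      by (intro Bochner_Integration.integral_cong refl arg_cong[of _ _ "\<lambda>T. tr_pow A T p"] gram_op_cong) simp
    also have "\<dots> = (\<integral>xs. tr_pow A (gram_op \<epsilon> xs n) p
        \<partial>distr M (PiM {..<n} (\<lambda>_. Q)) (\<lambda>\<omega>. \<lambda>j\<in>{..<n}. \<xi> j \<omega>))"
    proof (rule integral_distr[symmetric])
      show "(\<lambda>\<omega>. \<lambda>j\<in>{..<n}. \<xi> j \<omega>) \<in> M \<rightarrow>\<^sub>M PiM {..<n} (\<lambda>_. Q)"
        by (rule measurable_restrict) (simp add: rv)
      show "(\<lambda>xs. tr_pow A (gram_op \<epsilon> xs n) p) \<in> borel_measurable (PiM {..<n} (\<lambda>_. Q))"
        by (rule measurable_tr_pow) (auto intro: measurable_component_singleton)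
    qed
    also have "\<dots> \<le> real (card A) * (1 - \<gamma>) ^ n"
      unfolding D p(1) \<gamma>_def
      using \<epsilon>K \<gamma>0 \<gamma>_upper p(2) by (intro expected_tr_pow \<epsilon>0) (auto simp: \<gamma>_def)
    finally show ?thesis .
  qed
  define B where "B = {\<omega> \<in> space M. \<tau> \<le> Z \<omega>}"
  define y where "y = 1 / (400 * K)"
  have y: "0 \<le> y" "y \<le> 1 / 2" "y * y \<le> y / 400"
    using K1 mult_left_mono[of y "1/400" y] by (auto simp: y_def divide_simps)
  have \<tau>_lower: "exp (- (101 / 400) * (real n / K)) \<le> \<tau>"
  proof -
    have "- (y + y / 200) \<le> ln (1 - y)"
      using ln_one_minus_pos_lower_bound[OF y(1,2)] y(3) by (simp add: power2_eq_square)
    then have "exp (- (y + y / 200)) \<le> 1 - y"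
      using y(2) by (simp add: ln_ge_iff)
    then have "exp (- (y + y / 200)) ^ p \<le> (1 - y) ^ p" by (intro power_mono) auto
    also have "exp (- (y + y / 200)) ^ p = exp (- (real p * (y + y / 200)))"
      by (simp add: exp_of_nat_mult[symmetric])
    also have "real p * (y + y / 200) = (201 / 800) * (real n / K)"
      using K1 by (simp add: p_def y_def field_simps)
    finally have "exp (- ((201 / 800) * (real n / K))) \<le> \<tau>" unfolding \<tau>_def \<epsilon>n y_def[symmetric] .
    moreover have "exp (- (101 / 400) * (real n / K)) \<le> exp (- ((201 / 800) * (real n / K)))"
    proof -
      have "0 \<le> real n / K" using K1 by simp
      then show ?thesis unfolding exp_le_cancel_iff by linarith
    qed
    ultimately show ?thesis by linarith
  qed
  then have \<tau>0: "0 < \<tau>" by (meson exp_gt_zero order_less_le_trans)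
  have "measure M B \<le> (\<integral>\<omega>. Z \<omega> \<partial>M) / \<tau>"
    unfolding B_def using Zint \<tau>0 Zb by (intro integral_Markov_inequality_measure[where A = "space M"]) auto
  also have "\<dots> \<le> real (card A) * (1 - \<gamma>) ^ n / \<tau>" using EZ \<tau>0 by (intro divide_right_mono) auto
  also have "\<dots> \<le> real (card A) * exp (- (149 / 400) * (real n / K)) / exp (- (101 / 400) * (real n / K))"
  proof (intro frac_le mult_left_mono \<tau>_lower)
    have "(1 - \<gamma>) ^ n \<le> exp (- \<gamma>) ^ n"
      using \<gamma>_upper exp_ge_add_one_self[of "- \<gamma>"] by (intro power_mono) auto
    also have "\<dots> = exp (- (real n * \<gamma>))" by (simp add: exp_of_nat_mult[symmetric])
    also have "\<dots> \<le> exp (- (149 / 400) * (real n / K))"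
      using mult_left_mono[OF \<gamma>_lower, of "real n"] by simp
    finally show "(1 - \<gamma>) ^ n \<le> exp (- (149 / 400) * (real n / K))" .
  qed auto
  also have "\<dots> = real (card A) * exp (- (48 / 400) * (real n / K))"
    by (simp add: exp_diff[symmetric] flip: times_divide_eq_right)
  finally have "measure M B \<le> real (card A) * exp (- 0.12 * (real n / K))" by simp
  show thesis
  proof (rule that)
    show "B \<in> sets M" unfolding B_def by measurable
    show "measure M B \<le> real (card A) * exp (- 0.12 * (real n / K))" by fact
    fix \<omega> w assume \<omega>: "\<omega> \<in> space M - B"
    show "real n / 2 * (\<Sum>a\<in>A. (w a)\<^sup>2) \<le> (\<Sum>j<n. (\<Sum>a\<in>A. w a * \<Psi> a (\<xi> j \<omega>))\<^sup>2)"
    proof (rule small_trace_coercive[OF \<epsilon>0, of n])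
      show "\<epsilon> * K * real n < 1" by (simp add: \<epsilon>K)
      show "tr_pow A (gram_op \<epsilon> (\<lambda>j. \<xi> j \<omega>) n) p < (1 - \<epsilon> * (real n / 2)) ^ p"
        using \<omega> by (auto simp: B_def Z_def \<tau>_def not_le)
      show "\<epsilon> * (real n / 2) \<le> 1" using K1 unfolding \<epsilon>n by (simp add: divide_simps)
    qed (use \<omega> p sp in auto)
  qed
qed

end

section \<open>Expected errors\<close>

lemma (in prob_space) indep_sum_square:
  fixes X :: "nat \<Rightarrow> 'a \<Rightarrow> real"
  assumes indep: "indep_vars (\<lambda>_. borel) X {..<n}"
    and L2: "\<And>j. j < n \<Longrightarrow> X j \<in> L2 M"
    and mean: "\<And>j. j < n \<Longrightarrow> expectation (X j) = 0"
  shows "expectation (\<lambda>\<omega>. (\<Sum>j<n. X j \<omega>)\<^sup>2) = (\<Sum>j<n. expectation (\<lambda>\<omega>. (X j \<omega>)\<^sup>2))"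
proof -
  have int: "integrable M (\<lambda>\<omega>. X i \<omega> * X j \<omega>)" if "i < n" "j < n" for i j
    using that by (intro L2_mult_integrable L2)
  have cross: "expectation (\<lambda>\<omega>. X i \<omega> * X j \<omega>) = (if j = i then expectation (\<lambda>\<omega>. (X i \<omega>)\<^sup>2) else 0)"
    if "i < n" "j < n" for i j
  proof (cases "j = i")
    case False
    have "expectation (\<lambda>\<omega>. \<Prod>k\<in>{i, j}. X k \<omega>) = (\<Prod>k\<in>{i, j}. expectation (X k))"
      using that by (intro indep_vars_lebesgue_integral indep_vars_subset[OF indep])
        (auto intro: L2_integrable[OF finite_measure_axioms] L2)
    then show ?thesis using False that mean by simp
  qed (simp add: power2_eq_square)
  have "expectation (\<lambda>\<omega>. (\<Sum>j<n. X j \<omega>)\<^sup>2) = (\<Sum>i<n. \<Sum>j<n. expectation (\<lambda>\<omega>. X i \<omega> * X j \<omega>))"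
    unfolding power2_eq_square sum_product
    by (subst Bochner_Integration.integral_sum)
      (auto intro!: Bochner_Integration.integrable_sum sum.cong Bochner_Integration.integral_sum int)
  also have "\<dots> = (\<Sum>i<n. \<Sum>j<n. if j = i then expectation (\<lambda>\<omega>. (X i \<omega>)\<^sup>2) else 0)"
    by (intro sum.cong refl) (simp add: cross)
  also have "\<dots> = (\<Sum>j<n. expectation (\<lambda>\<omega>. (X j \<omega>)\<^sup>2))" by simp
  finally show ?thesis .
qed

text \<open>A quantity bounded by 1, controlled by \<open>g\<close> outside an exceptional event \<open>B\<close>.\<close>

lemma (in prob_space) expectation_outside:
  assumes d: "d \<in> borel_measurable M" and d1: "\<And>\<omega>. \<omega> \<in> space M \<Longrightarrow> \<bar>d \<omega>\<bar> \<le> 1"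
    and B: "B \<in> sets M" and g: "integrable M g" and g0: "\<And>\<omega>. 0 \<le> g \<omega>" and s: "0 \<le> s"
    and sq: "\<And>\<omega>. \<omega> \<in> space M - B \<Longrightarrow> (d \<omega>)\<^sup>2 \<le> g \<omega>"
    and ab: "\<And>\<omega>. \<omega> \<in> space M - B \<Longrightarrow> \<bar>d \<omega>\<bar> \<le> g \<omega> + s * sqrt (g \<omega>)"
  shows "integrable M (\<lambda>\<omega>. (d \<omega>)\<^sup>2)" "integrable M (\<lambda>\<omega>. \<bar>d \<omega>\<bar>)"
    "expectation (\<lambda>\<omega>. (d \<omega>)\<^sup>2) \<le> expectation g + prob B"
    "expectation (\<lambda>\<omega>. \<bar>d \<omega>\<bar>) \<le> expectation g + s * sqrt (expectation g) + prob B"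
proof -
  have d2: "(d \<omega>)\<^sup>2 \<le> 1" if "\<omega> \<in> space M" for \<omega> using d1[OF that] by (simp add: abs_square_le_1)
  show int2: "integrable M (\<lambda>\<omega>. (d \<omega>)\<^sup>2)"
    using d d2 by (intro integrable_const_bound[where B = 1] AE_I2) auto
  show int1: "integrable M (\<lambda>\<omega>. \<bar>d \<omega>\<bar>)"
    using d d1 by (intro integrable_const_bound[where B = 1] AE_I2) auto
  have ind: "integrable M (indicator B :: _ \<Rightarrow> real)" using B by (simp add: integrable_indicator_iff less_top[symmetric])
  have EB: "expectation (indicator B :: _ \<Rightarrow> real) = prob B" using B sets.sets_into_space[OF B] by (simp add: Int_absorb2)
  have "expectation (\<lambda>\<omega>. (d \<omega>)\<^sup>2) \<le> expectation (\<lambda>\<omega>. g \<omega> + indicator B \<omega>)"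
  proof (rule integral_mono)
    fix \<omega> assume "\<omega> \<in> space M"
    then show "(d \<omega>)\<^sup>2 \<le> g \<omega> + indicator B \<omega>"
      using d2[of \<omega>] g0[of \<omega>] sq[of \<omega>] by (cases "\<omega> \<in> B") auto
  qed (use g ind int2 in auto)
  then show "expectation (\<lambda>\<omega>. (d \<omega>)\<^sup>2) \<le> expectation g + prob B" using g ind EB by simp
  have sg: "(\<lambda>\<omega>. sqrt (g \<omega>)) \<in> L2 M" using g g0 by (simp add: L2_def)
  note sgi = L2_integrable[OF finite_measure_axioms sg]
  have "(expectation (\<lambda>\<omega>. sqrt (g \<omega>)))\<^sup>2 \<le> expectation g"
    using L2_cauchy_schwarz[OF sg L2_const[OF finite_measure_axioms, of 1]] g0 by (simp add: prob_space)
  then have sqrt_le: "expectation (\<lambda>\<omega>. sqrt (g \<omega>)) \<le> sqrt (expectation g)" by (rule real_le_rsqrt)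
  have "expectation (\<lambda>\<omega>. \<bar>d \<omega>\<bar>) \<le> expectation (\<lambda>\<omega>. g \<omega> + s * sqrt (g \<omega>) + indicator B \<omega>)"
  proof (rule integral_mono)
    fix \<omega> assume "\<omega> \<in> space M"
    moreover have "0 \<le> s * sqrt (g \<omega>)" using s g0 by simp
    ultimately show "\<bar>d \<omega>\<bar> \<le> g \<omega> + s * sqrt (g \<omega>) + indicator B \<omega>"
      using d1[of \<omega>] g0[of \<omega>] ab[of \<omega>] by (cases "\<omega> \<in> B") auto
  qed (use g ind int1 sgi in auto)
  also have "\<dots> = expectation g + s * expectation (\<lambda>\<omega>. sqrt (g \<omega>)) + prob B" using g ind EB sgi by simp
  also have "\<dots> \<le> expectation g + s * sqrt (expectation g) + prob B"
    using mult_left_mono[OF sqrt_le s] by simp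
  finally show "expectation (\<lambda>\<omega>. \<bar>d \<omega>\<bar>) \<le> expectation g + s * sqrt (expectation g) + prob B" .
qed

text \<open>Since \<open>K \<ge> 1\<close>, the bound on \<open>K\<close> rules out small \<open>n\<close>, and doubling the lower bound for \<open>n\<close>
  a few times yields \<open>n \<ge> 16\<close>. The second inequality absorbs the exceptional probability: the
  constant \<open>3 ln (3/2) - 1\<close> is below \<open>0.23\<close>.\<close>

lemma kappa_numerics:
  fixes K r :: real and n :: nat
  assumes n: "n \<ge> 2" and r: "r > 0" and K1: "1 \<le> K"
    and K: "K \<le> (3 * ln (3 / 2) - 1) / (2 + 2 * r) * (real n / ln (real n))"
  shows "20 * K \<le> real n" and "(1 + r) * ln (real n) \<le> 0.12 * (real n / K)"
proof -
  have ln_pos: "0 < ln (real n)" using n by simp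
  have "(3 / 2 :: real) \<le> (1 + 41 / 200 + (41 / 200)\<^sup>2 / 2)\<^sup>2" by (simp add: power2_eq_square)
  also have "\<dots> \<le> (exp (41 / 200))\<^sup>2" by (intro power_mono exp_lower_Taylor_quadratic) auto
  also have "\<dots> = exp (41 / 100)" by (simp add: power2_eq_square exp_add[symmetric])
  finally have "ln (3 / 2 :: real) \<le> ln (exp (41 / 100))" by (subst ln_le_cancel_iff) auto
  then have c: "3 * ln (3 / 2) - 1 \<le> (23 / 100 :: real)" by simp
  have "K * (2 * (1 + r) * ln (real n)) \<le> (3 * ln (3 / 2) - 1) * real n"
  proof -
    have "K \<le> (3 * ln (3 / 2) - 1) * real n / ((2 + 2 * r) * ln (real n))" using K by simp
    moreover have "0 < (2 + 2 * r) * ln (real n)" using r ln_pos by simp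
    ultimately have "K * ((2 + 2 * r) * ln (real n)) \<le> (3 * ln (3 / 2) - 1) * real n"
      by (simp only: pos_le_divide_eq)
    then show ?thesis by (simp add: algebra_simps)
  qed
  also have "\<dots> \<le> 23 / 100 * real n" using c by (intro mult_right_mono) auto
  finally have "2 * (K * ((1 + r) * ln (real n))) \<le> 23 / 100 * real n" by (simp only: mult_ac)
  then have main: "K * ((1 + r) * ln (real n)) \<le> 23 / 200 * real n" by linarith
  then have "(1 + r) * ln (real n) \<le> 23 / 200 * (real n / K)" using K1 by (simp add: field_simps)
  also have "\<dots> \<le> 0.12 * (real n / K)" using K1 by (intro mult_right_mono) auto
  finally show "(1 + r) * ln (real n) \<le> 0.12 * (real n / K)" .
  have "K * ln (real n) \<le> K * ((1 + r) * ln (real n))"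
    using K1 r ln_pos by (intro mult_left_mono) auto
  with main have Kln: "K * ln (real n) \<le> 23 / 200 * real n" by simp
  have "ln (real n) \<le> K * ln (real n)" using K1 ln_pos by simp
  with Kln have lnn: "ln (real n) \<le> 23 / 200 * real n" by linarith
  have ln_ge: "real m * (2 / 3) \<le> ln (real n)" if "2 ^ m \<le> n" for m
  proof -
    have "real m * (2 / 3) \<le> real m * ln 2" using ln2_ge_two_thirds by (intro mult_left_mono) auto
    also have "\<dots> = ln (2 ^ m)" by (simp add: ln_realpow)
    also have "\<dots> \<le> ln (real n)" using that n by (subst ln_le_cancel_iff) (auto dest: of_nat_mono[where 'a = real])
    finally show ?thesis .
  qed
  have n4: "4 \<le> n" using ln_ge[of 1] lnn n by (simp add: field_simps)
  have n8: "8 \<le> n" using ln_ge[of 2] lnn n4 by (simp add: field_simps)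
  have n16: "16 \<le> n" using ln_ge[of 3] lnn n8 by (simp add: field_simps)
  have "K * (8 / 3) \<le> K * ln (real n)" using ln_ge[of 4] n16 K1 by simp
  with Kln show "20 * K \<le> real n" by linarith
qed

lemma (in bounded_frame) noise_second_moment:
  fixes n :: nat
  assumes M: "prob_space M"
    and indep: "prob_space.indep_vars M (\<lambda>_. Q) \<xi> {..<n}"
    and distr: "\<And>j. j < n \<Longrightarrow> distr M Q (\<xi> j) = Q"
    and e: "e \<in> L2 Q" and orth: "\<And>a. a \<in> A \<Longrightarrow> (\<integral>x. \<Psi> a x * e x \<partial>Q) = 0"
  shows "integrable M (\<lambda>\<omega>. \<Sum>a\<in>A. (\<Sum>j<n. \<Psi> a (\<xi> j \<omega>) * e (\<xi> j \<omega>))\<^sup>2)"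
    "(\<integral>\<omega>. (\<Sum>a\<in>A. (\<Sum>j<n. \<Psi> a (\<xi> j \<omega>) * e (\<xi> j \<omega>))\<^sup>2) \<partial>M) \<le> real n * K * (\<integral>x. (e x)\<^sup>2 \<partial>Q)"
proof -
  interpret M: prob_space M by (rule M)
  define h where "h = (\<lambda>a x. \<Psi> a x * e x)"
  have rv: "\<xi> j \<in> M \<rightarrow>\<^sub>M Q" if "j < n" for j
    using indep that unfolding M.indep_vars_def by auto
  have h_meas: "h a \<in> borel_measurable Q" if "a \<in> A" for a
    unfolding h_def using that by (intro borel_measurable_times L2_measurable meas e)
  have hh: "(\<Sum>a\<in>A. (h a x)\<^sup>2) \<le> K * (e x)\<^sup>2" if "x \<in> space Q" for x
    using mult_right_mono[OF K_bound[OF that], of "(e x)\<^sup>2"]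
    by (simp add: h_def power_mult_distrib sum_distrib_right)
  have h_L2: "h a \<in> L2 Q" if a: "a \<in> A" for a
  proof -
    have "integrable Q (\<lambda>x. (h a x)\<^sup>2)"
    proof (rule Bochner_Integration.integrable_bound)
      show "integrable Q (\<lambda>x. K * (e x)\<^sup>2)" using L2_square_integrable[OF e] by simp
      show "(\<lambda>x. (h a x)\<^sup>2) \<in> borel_measurable Q" using h_meas[OF a] by simp
      have "(h a x)\<^sup>2 \<le> K * (e x)\<^sup>2" if "x \<in> space Q" for x
        using hh[OF that] member_le_sum[OF a _ fin, of "\<lambda>a. (h a x)\<^sup>2"] by simp
      then show "AE x in Q. norm ((h a x)\<^sup>2) \<le> norm (K * (e x)\<^sup>2)"
        using K_pos by (intro AE_I2) simp
    qed
    then show ?thesis using h_meas[OF a] by (simp add: L2_def)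
  qed
  have trans: "(\<integral>\<omega>. g (\<xi> j \<omega>) \<partial>M) = (\<integral>x. g x \<partial>Q)" if "j < n" "g \<in> borel_measurable Q" for j and g :: "_ \<Rightarrow> real"
    using integral_distr[OF rv[OF that(1)] that(2)] distr[OF that(1)] by simp
  have trans_int: "integrable M (\<lambda>\<omega>. g (\<xi> j \<omega>))" if "j < n" "integrable Q g" for j and g :: "_ \<Rightarrow> real"
  proof -
    have "integrable (distr M Q (\<xi> j)) g" using distr[OF that(1)] that(2) by simp
    then show ?thesis by (rule integrable_distr[OF rv[OF that(1)]])
  qed
  have X_L2: "(\<lambda>\<omega>. h a (\<xi> j \<omega>)) \<in> L2 M" if "a \<in> A" "j < n" for a j
  proof -
    have "(\<lambda>\<omega>. h a (\<xi> j \<omega>)) \<in> borel_measurable M"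
      by (rule measurable_compose[OF rv[OF that(2)] h_meas[OF that(1)]])
    then show ?thesis
      using trans_int[OF that(2) L2_square_integrable[OF h_L2[OF that(1)]]] by (simp add: L2_def)
  qed
  have sq: "(\<integral>\<omega>. (\<Sum>j<n. h a (\<xi> j \<omega>))\<^sup>2 \<partial>M) = real n * (\<integral>x. (h a x)\<^sup>2 \<partial>Q)" if a: "a \<in> A" for a
  proof -
    have "(\<integral>\<omega>. (\<Sum>j<n. h a (\<xi> j \<omega>))\<^sup>2 \<partial>M) = (\<Sum>j<n. (\<integral>\<omega>. (h a (\<xi> j \<omega>))\<^sup>2 \<partial>M))"
    proof (rule M.indep_sum_square)
      show "M.indep_vars (\<lambda>_. borel) (\<lambda>j \<omega>. h a (\<xi> j \<omega>)) {..<n}"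
        by (rule M.indep_vars_compose2[OF indep]) (rule h_meas[OF a])
      show "(\<integral>\<omega>. h a (\<xi> j \<omega>) \<partial>M) = 0" if "j < n" for j
        using trans[OF that h_meas[OF a]] orth[OF a] by (simp add: h_def)
    qed (rule X_L2[OF a])
    also have "\<dots> = (\<Sum>j<n. (\<integral>x. (h a x)\<^sup>2 \<partial>Q))"
      using h_meas[OF a] by (intro sum.cong refl trans) auto
    finally show ?thesis by simp
  qed
  have int: "integrable M (\<lambda>\<omega>. (\<Sum>j<n. h a (\<xi> j \<omega>))\<^sup>2)" if "a \<in> A" for a
    using that by (intro L2_square_integrable L2_sum X_L2) auto
  then show "integrable M (\<lambda>\<omega>. \<Sum>a\<in>A. (\<Sum>j<n. \<Psi> a (\<xi> j \<omega>) * e (\<xi> j \<omega>))\<^sup>2)"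
    unfolding h_def by (rule Bochner_Integration.integrable_sum)
  have "(\<integral>\<omega>. (\<Sum>a\<in>A. (\<Sum>j<n. h a (\<xi> j \<omega>))\<^sup>2) \<partial>M) = (\<Sum>a\<in>A. real n * (\<integral>x. (h a x)\<^sup>2 \<partial>Q))"
    by (subst Bochner_Integration.integral_sum) (auto intro!: int sum.cong sq)
  also have "\<dots> = real n * (\<integral>x. (\<Sum>a\<in>A. (h a x)\<^sup>2) \<partial>Q)"
    by (subst Bochner_Integration.integral_sum)
      (auto intro!: L2_square_integrable h_L2 simp: sum_distrib_left)
  also have "\<dots> \<le> real n * (\<integral>x. K * (e x)\<^sup>2 \<partial>Q)"
    using L2_square_integrable[OF e] K_pos hh by (intro mult_left_mono integral_mono') auto
  finally show "(\<integral>\<omega>. (\<Sum>a\<in>A. (\<Sum>j<n. \<Psi> a (\<xi> j \<omega>) * e (\<xi> j \<omega>))\<^sup>2) \<partial>M) \<le> real n * K * (\<integral>x. (e x)\<^sup>2 \<partial>Q)"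
    by (simp add: h_def mult.assoc)
qed

context tensor_basis
begin

text \<open>Variances of a finite expansion and of its components are polynomials in the coefficients, so
  its indices depend measurably on them.\<close>

lemma tensor_variances:
  fixes c :: "('i \<Rightarrow> nat) \<Rightarrow> real"
  assumes A: "finite A"
  defines "g \<equiv> \<lambda>x. \<Sum>\<alpha>\<in>A. c \<alpha> * tensor \<psi> \<alpha> x"
  shows "Var (prodm \<mu>) g = (\<Sum>U\<in>-{{}}. \<Sum>\<alpha>\<in>{\<alpha>\<in>A. supp \<alpha> = U}. (c \<alpha>)\<^sup>2)"
    "Var (prodm \<mu>) (sobol_component \<mu> g U) = (if U = {} then 0 else (\<Sum>\<alpha>\<in>{\<alpha>\<in>A. supp \<alpha> = U}. (c \<alpha>)\<^sup>2))"
proof -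
  have g: "g \<in> L2 (prodm \<mu>)" unfolding g_def by (rule tensor_sum_L2)
  have G: "sobol_decomposition \<mu> g (tensor_part A c)" unfolding g_def by (rule tensor_decomposition[OF A])
  have sq: "(\<integral>x. (tensor_part A c U x)\<^sup>2 \<partial>prodm \<mu>) = (\<Sum>\<alpha>\<in>{\<alpha>\<in>A. supp \<alpha> = U}. (c \<alpha>)\<^sup>2)" for U
    unfolding tensor_part_def using A by (intro tensor_sum_square) auto
  show "Var (prodm \<mu>) g = (\<Sum>U\<in>-{{}}. \<Sum>\<alpha>\<in>{\<alpha>\<in>A. supp \<alpha> = U}. (c \<alpha>)\<^sup>2)"
    unfolding variance_sum[OF g G] sq ..
  show "Var (prodm \<mu>) (sobol_component \<mu> g U) = (if U = {} then 0 else (\<Sum>\<alpha>\<in>{\<alpha>\<in>A. supp \<alpha> = U}. (c \<alpha>)\<^sup>2))"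
    unfolding variance_component_unique[OF g sobol_component_decomposition[OF g] G, of U]
      variance_component[OF G] sq ..
qed

lemma measurable_group_index:
  assumes A: "finite A" and c: "\<And>\<alpha>. \<alpha> \<in> A \<Longrightarrow> (\<lambda>\<omega>. c \<omega> \<alpha>) \<in> borel_measurable M"
  shows "(\<lambda>\<omega>. group_index \<mu> W (\<lambda>x. \<Sum>\<alpha>\<in>A. c \<omega> \<alpha> * tensor \<psi> \<alpha> x)) \<in> borel_measurable M"
proof -
  have [measurable]: "(\<lambda>\<omega>. \<Sum>\<alpha>\<in>{\<alpha>\<in>A. supp \<alpha> = U}. (c \<omega> \<alpha>)\<^sup>2) \<in> borel_measurable M" for U
    using c by (intro borel_measurable_sum borel_measurable_power) auto
  show ?thesis unfolding group_index_def tensor_variances[OF A] by measurable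
qed

text \<open>The projection exists because the Fourier coefficients provide one; which function is selected
  plays no role.\<close>

lemma orth_projection_tensor:
  assumes A: "finite A" and f: "f \<in> L2 (prodm \<mu>)"
  obtains c where "orth_projection (prodm \<mu>) (fun_span (tensor \<psi>) A) f = (\<lambda>x. \<Sum>\<alpha>\<in>A. c \<alpha> * tensor \<psi> \<alpha> x)"
    "\<And>\<alpha>. \<alpha> \<in> A \<Longrightarrow> (\<integral>x. tensor \<psi> \<alpha> x * (f x - (\<Sum>\<alpha>\<in>A. c \<alpha> * tensor \<psi> \<alpha> x)) \<partial>prodm \<mu>) = 0"
proof -
  let ?V = "fun_span (tensor \<psi>) A"
  let ?ok = "\<lambda>p. p \<in> ?V \<and> (\<forall>g\<in>?V. (\<integral>x. (f x - p x) * g x \<partial>prodm \<mu>) = 0)"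
  define c0 where "c0 = (\<lambda>\<alpha>. \<integral>x. f x * tensor \<psi> \<alpha> x \<partial>prodm \<mu>)"
  define p0 where "p0 = (\<lambda>x. \<Sum>\<alpha>\<in>A. c0 \<alpha> * tensor \<psi> \<alpha> x)"
  have p0_L2: "p0 \<in> L2 (prodm \<mu>)" unfolding p0_def by (rule tensor_sum_L2)
  have base: "(\<integral>x. (f x - p0 x) * tensor \<psi> \<alpha> x \<partial>prodm \<mu>) = 0" if "\<alpha> \<in> A" for \<alpha>
  proof -
    have "(\<integral>x. p0 x * tensor \<psi> \<alpha> x \<partial>prodm \<mu>)
        = (\<Sum>\<beta>\<in>A. c0 \<beta> * (\<integral>x. tensor \<psi> \<beta> x * tensor \<psi> \<alpha> x \<partial>prodm \<mu>))"
      unfolding p0_def sum_distrib_right mult.assoc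
      by (subst Bochner_Integration.integral_sum) (auto intro!: integrable_mult_right L2_mult_integrable tensor_L2)
    also have "\<dots> = c0 \<alpha>" using that A by (simp add: tensor_inner if_distrib[of "(*) _"] cong: if_cong)
    finally have "(\<integral>x. p0 x * tensor \<psi> \<alpha> x \<partial>prodm \<mu>) = c0 \<alpha>" .
    then show ?thesis
      using L2_mult_integrable[OF f tensor_L2, of \<alpha>] L2_mult_integrable[OF p0_L2 tensor_L2, of \<alpha>]
      by (simp add: left_diff_distrib c0_def)
  qed
  have "?ok p0"
  proof (intro conjI ballI)
    show "p0 \<in> ?V" by (auto simp: fun_span_def p0_def)
    fix g assume "g \<in> ?V"
    then obtain b where g: "g = (\<lambda>x. \<Sum>\<alpha>\<in>A. b \<alpha> * tensor \<psi> \<alpha> x)" by (auto simp: fun_span_def)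
    have "(\<integral>x. (f x - p0 x) * g x \<partial>prodm \<mu>) = (\<integral>x. (\<Sum>\<alpha>\<in>A. b \<alpha> * ((f x - p0 x) * tensor \<psi> \<alpha> x)) \<partial>prodm \<mu>)"
      by (simp add: g sum_distrib_left mult_ac)
    also have "\<dots> = (\<Sum>\<alpha>\<in>A. b \<alpha> * (\<integral>x. (f x - p0 x) * tensor \<psi> \<alpha> x \<partial>prodm \<mu>))"
      by (subst Bochner_Integration.integral_sum)
        (auto intro!: integrable_mult_right L2_mult_integrable tensor_L2 L2_diff f p0_L2)
    also have "\<dots> = 0" by (intro sum.neutral) (simp add: base)
    finally show "(\<integral>x. (f x - p0 x) * g x \<partial>prodm \<mu>) = 0" .
  qed
  then have ok: "?ok (orth_projection (prodm \<mu>) ?V f)" unfolding orth_projection_def by (rule someI[of ?ok p0])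
  then obtain c where c: "orth_projection (prodm \<mu>) ?V f = (\<lambda>x. \<Sum>\<alpha>\<in>A. c \<alpha> * tensor \<psi> \<alpha> x)"
    by (auto simp: fun_span_def)
  have "tensor \<psi> \<alpha> \<in> ?V" if "\<alpha> \<in> A" for \<alpha>
    unfolding fun_span_def using that A
    by (intro CollectI exI[of _ "unit_fun \<alpha>"] ext)
      (simp add: of_bool_def if_distrib[of "\<lambda>z. z * _"] cong: if_cong)
  with ok have "(\<integral>x. (f x - (\<Sum>\<alpha>\<in>A. c \<alpha> * tensor \<psi> \<alpha> x)) * tensor \<psi> \<alpha> x \<partial>prodm \<mu>) = 0" if "\<alpha> \<in> A" for \<alpha>
    using that unfolding c by blast
  then show thesis using c by (intro that[of c]) (simp_all add: mult.commute)
qed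

lemma square_error_split:
  assumes A: "finite A" and e: "e \<in> L2 (prodm \<mu>)"
    and orth: "\<And>\<alpha>. \<alpha> \<in> A \<Longrightarrow> (\<integral>x. tensor \<psi> \<alpha> x * e x \<partial>prodm \<mu>) = 0"
  shows "(\<integral>x. (e x - (\<Sum>\<alpha>\<in>A. w \<alpha> * tensor \<psi> \<alpha> x))\<^sup>2 \<partial>prodm \<mu>)
    = (\<integral>x. (e x)\<^sup>2 \<partial>prodm \<mu>) + (\<Sum>\<alpha>\<in>A. (w \<alpha>)\<^sup>2)"
proof -
  let ?h = "\<lambda>x. \<Sum>\<alpha>\<in>A. w \<alpha> * tensor \<psi> \<alpha> x"
  have h: "?h \<in> L2 (prodm \<mu>)" by (rule tensor_sum_L2)
  have "(\<integral>x. ?h x * e x \<partial>prodm \<mu>) = (\<Sum>\<alpha>\<in>A. w \<alpha> * (\<integral>x. tensor \<psi> \<alpha> x * e x \<partial>prodm \<mu>))"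
    unfolding sum_distrib_right mult.assoc
    by (subst Bochner_Integration.integral_sum) (auto intro!: integrable_mult_right L2_mult_integrable tensor_L2 e)
  then have he: "(\<integral>x. ?h x * e x \<partial>prodm \<mu>) = 0" by (simp add: orth)
  have "(\<integral>x. (e x - ?h x)\<^sup>2 \<partial>prodm \<mu>) = (\<integral>x. (e x)\<^sup>2 + (?h x)\<^sup>2 - 2 * (?h x * e x) \<partial>prodm \<mu>)"
    by (intro Bochner_Integration.integral_cong refl) (simp add: power2_diff)
  also have "\<dots> = (\<integral>x. (e x)\<^sup>2 \<partial>prodm \<mu>) + (\<integral>x. (?h x)\<^sup>2 \<partial>prodm \<mu>) - 2 * (\<integral>x. ?h x * e x \<partial>prodm \<mu>)"
    using L2_square_integrable[OF e] L2_square_integrable[OF h] L2_mult_integrable[OF h e]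
    by (simp only: Bochner_Integration.integral_diff Bochner_Integration.integral_add
        Bochner_Integration.integrable_add integral_mult_right_zero integrable_mult_right)
  finally show ?thesis by (simp add: he tensor_sum_square[OF A])
qed

end

theorem corollary5:
  fixes X :: "'i::finite \<Rightarrow> real set"
    and \<mu> :: "'i \<Rightarrow> real measure"
    and \<psi> :: "'i \<Rightarrow> nat \<Rightarrow> real \<Rightarrow> real"
    and L :: "nat \<Rightarrow> ('i \<Rightarrow> nat) set"
    and f :: "('i \<Rightarrow> real) \<Rightarrow> real"
    and n N :: nat and r :: real
    and M :: "'w measure"
    and \<xi> :: "nat \<Rightarrow> 'w \<Rightarrow> 'i \<Rightarrow> real"
  defines "\<kappa> \<equiv> (3 * ln (3 / 2) - 1) / (2 + 2 * r)"
    and "e \<equiv> (\<lambda>x. f x - orth_projection (prodm \<mu>) (fun_span (tensor \<psi>) (L N)) f x)"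
    and "fhat \<equiv> (\<lambda>\<omega>. ls_approx (tensor \<psi>) (L N) n (\<lambda>j. \<xi> j \<omega>) (\<lambda>j. f (\<xi> j \<omega>)))"
  assumes \<mu>_prob: "\<And>i. prob_space (\<mu> i)"
    and \<mu>_sets: "\<And>i. sets (\<mu> i) = sets (restrict_space borel (X i))"
    and \<psi>_orthonormal: "\<And>i. orthonormal_family (\<mu> i) (\<psi> i)"
    and \<psi>_0: "\<And>i t. t \<in> X i \<Longrightarrow> \<psi> i 0 t = 1"
    and L_1: "L 1 = {\<lambda>_. 0}"
    and L_nested: "\<And>m. m \<ge> 1 \<Longrightarrow> L m \<subset> L (Suc m)"
    and L_card: "\<And>m. m \<ge> 1 \<Longrightarrow> card (L m) = m"
    and f_L2: "f \<in> L2 (prodm \<mu>)"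
    and f_var: "Var (prodm \<mu>) f > 0"
    and M_prob: "prob_space M"
    and design_indep: "prob_space.indep_vars M (\<lambda>_. prodm \<mu>) \<xi> {..<n}"
    and design_distr: "\<And>j. j < n \<Longrightarrow> distr M (prodm \<mu>) (\<xi> j) = prodm \<mu>"
    and n: "n \<ge> 2" and N: "N \<ge> 1" and r: "r > 0"
    and K_bound: "sup_kernel (PiE UNIV X) (tensor \<psi>) (L N) \<le> ereal (\<kappa> * (real n / ln (real n)))"
  shows "\<forall>S \<in> {sobol_index \<mu>, total_effect_index \<mu>}. \<forall>U.
      integrable M (\<lambda>\<omega>. (S f U - S (fhat \<omega>) U)\<^sup>2) \<and>
      integrable M (\<lambda>\<omega>. \<bar>S f U - S (fhat \<omega>) U\<bar>) \<and>
      (\<integral>\<omega>. (S f U - S (fhat \<omega>) U)\<^sup>2 \<partial>M)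
        \<le> 1.2 / Var (prodm \<mu>) f * (L2_norm (prodm \<mu>) e)\<^sup>2 + 2 * real n powr (- r) \<and>
      (\<integral>\<omega>. \<bar>S f U - S (fhat \<omega>) U\<bar> \<partial>M)
        \<le> 1.2 / Var (prodm \<mu>) f * (L2_norm (prodm \<mu>) e)\<^sup>2
          + 2.2 * sqrt (S f U) / sqrt (Var (prodm \<mu>) f) * L2_norm (prodm \<mu>) e
          + 2 * real n powr (- r)"
proof -
  have sp: "space (\<mu> i) = X i" for i
    using sets_eq_imp_space_eq[OF \<mu>_sets[of i]] by (simp add: space_restrict_space)
  interpret marginals \<mu> by (rule marginals.intro) (rule \<mu>_prob)
  interpret tensor_basis \<mu> \<psi>
  proof
    show "orthonormal_family (\<mu> i) (\<psi> i)" for i by (rule \<psi>_orthonormal)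
    show "\<psi> i 0 t = 1" if "t \<in> space (\<mu> i)" for i t by (rule \<psi>_0) (use that sp in simp)
  qed
  interpret D: prob_space M by (rule M_prob)
  define A where "A = L N"
  define K where "K = \<kappa> * (real n / ln (real n))"
  have cardA: "card A = N" using L_card[OF N] by (simp add: A_def)
  have finA: "finite A" using cardA N by (intro card_ge_0_finite) simp
  have zeroA: "(\<lambda>_. 0) \<in> A"
    unfolding A_def using N
  proof (induction N rule: dec_induct)
    case base show ?case unfolding L_1 by simp
  next
    case (step m) then show ?case using L_nested[of m] by auto
  qed
  have spP: "space (prodm \<mu>) = PiE UNIV X" by (simp add: space_PiM sp)
  \<comment> \<open>the hypothesis on the supremum, with \<open>K\<close> the right-hand side instead of the supremum itself\<close>
  have K_bd: "(\<Sum>\<alpha>\<in>A. (tensor \<psi> \<alpha> x)\<^sup>2) \<le> K" if "x \<in> space (prodm \<mu>)" for x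
  proof -
    have "ereal (\<Sum>\<alpha>\<in>A. (tensor \<psi> \<alpha> x)\<^sup>2) \<le> sup_kernel (PiE UNIV X) (tensor \<psi>) (L N)"
      unfolding sup_kernel_def A_def using that spP by (intro SUP_upper) simp
    also have "\<dots> \<le> ereal K" using K_bound by (simp add: K_def)
    finally show ?thesis by simp
  qed
  obtain x0 where x0: "x0 \<in> space (prodm \<mu>)" using P.not_empty by blast
  have "tensor \<psi> (\<lambda>_. 0) x0 = 1" using x0 by (simp add: tensor_def const space_PiM PiE_def Pi_def)
  then have K1: "1 \<le> K"
    using K_bd[OF x0] member_le_sum[OF zeroA _ finA, of "\<lambda>\<alpha>. (tensor \<psi> \<alpha> x0)\<^sup>2"] by simp
  interpret F: bounded_frame "prodm \<mu>" A "tensor \<psi>" K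
    using K1 by unfold_locales (auto intro: finA tensor_L2 K_bd simp: tensor_inner)
  have NK: "real N \<le> K" using F.card_le_K cardA by simp
  have n0: "0 < n" using n by simp
  have Kn: "20 * K \<le> real n" and Kln: "(1 + r) * ln (real n) \<le> 0.12 * (real n / K)"
    using kappa_numerics[OF n r K1] by (auto simp: K_def \<kappa>_def)
  obtain c where c: "orth_projection (prodm \<mu>) (fun_span (tensor \<psi>) A) f = (\<lambda>x. \<Sum>\<alpha>\<in>A. c \<alpha> * tensor \<psi> \<alpha> x)"
    "\<And>\<alpha>. \<alpha> \<in> A \<Longrightarrow> (\<integral>x. tensor \<psi> \<alpha> x * (f x - (\<Sum>\<alpha>\<in>A. c \<alpha> * tensor \<psi> \<alpha> x)) \<partial>prodm \<mu>) = 0"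
    using orth_projection_tensor[OF finA f_L2] by blast
  have e_eq: "e = (\<lambda>x. f x - (\<Sum>\<alpha>\<in>A. c \<alpha> * tensor \<psi> \<alpha> x))" unfolding e_def A_def[symmetric] c(1) ..
  have e_L2: "e \<in> L2 (prodm \<mu>)" unfolding e_eq by (intro L2_diff f_L2 tensor_sum_L2)
  have e_orth: "(\<integral>x. tensor \<psi> \<alpha> x * e x \<partial>prodm \<mu>) = 0" if "\<alpha> \<in> A" for \<alpha>
    unfolding e_eq by (rule c(2)[OF that])
  define R where "R = (\<lambda>\<omega>. \<Sum>\<alpha>\<in>A. (\<Sum>j<n. tensor \<psi> \<alpha> (\<xi> j \<omega>) * e (\<xi> j \<omega>))\<^sup>2)"
  define E where "E = (\<integral>x. (e x)\<^sup>2 \<partial>prodm \<mu>)"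
  have E0: "0 \<le> E" by (simp add: E_def)
  have R: "integrable M R" "(\<integral>\<omega>. R \<omega> \<partial>M) \<le> real n * K * E"
    unfolding R_def E_def
    by (rule F.noise_second_moment[OF M_prob design_indep design_distr e_L2 e_orth]; assumption)+
  have R0: "0 \<le> R \<omega>" for \<omega> by (auto simp: R_def intro!: sum_nonneg)
  let ?V = "Var (prodm \<mu>) f"
  define g where "g = (\<lambda>\<omega>. (E + 4 / (real n)\<^sup>2 * R \<omega>) / ?V)"
  have g: "integrable M g" unfolding g_def using R(1) by simp
  have g0: "0 \<le> g \<omega>" for \<omega> unfolding g_def using E0 R0 f_var by simp
  have Eg: "(\<integral>\<omega>. g \<omega> \<partial>M) \<le> 1.2 / ?V * E"
  proof -
    have "(\<integral>\<omega>. g \<omega> \<partial>M) = (E + 4 / (real n)\<^sup>2 * (\<integral>\<omega>. R \<omega> \<partial>M)) / ?V"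
      unfolding g_def using R(1) by (simp add: D.prob_space)
    also have "\<dots> \<le> (E + 4 / (real n)\<^sup>2 * (real n * K * E)) / ?V"
      using R(2) f_var by (intro divide_right_mono add_left_mono mult_left_mono) auto
    also have "4 / (real n)\<^sup>2 * (real n * K * E) = (4 * K / real n) * E"
      using n0 by (simp add: power2_eq_square)
    also have "(E + (4 * K / real n) * E) / ?V \<le> (E + 0.2 * E) / ?V"
      using Kn n0 E0 f_var by (intro divide_right_mono add_left_mono mult_right_mono) (auto simp: field_simps)
    finally show ?thesis by (simp add: algebra_simps)
  qed
  obtain B where B: "B \<in> sets M" "measure M B \<le> real (card A) * exp (- 0.12 * (real n / K))"
    and coercive: "\<And>\<omega> w. \<omega> \<in> space M - B \<Longrightarrow>
      real n / 2 * (\<Sum>\<alpha>\<in>A. (w \<alpha>)\<^sup>2) \<le> (\<Sum>j<n. (\<Sum>\<alpha>\<in>A. w \<alpha> * tensor \<psi> \<alpha> (\<xi> j \<omega>))\<^sup>2)"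
    using F.coercive_tail[OF M_prob n0 K1 design_indep design_distr] by blast
  have PB: "measure M B \<le> 2 * real n powr (- r)"
  proof -
    have "measure M B \<le> real n * exp (- ((1 + r) * ln (real n)))"
      using B(2) Kln NK Kn K1 cardA by (intro order_trans[OF B(2)] mult_mono) auto
    also have "\<dots> = exp (ln (real n)) * exp (- ((1 + r) * ln (real n)))" using n0 by simp
    also have "\<dots> = exp (ln (real n) - (1 + r) * ln (real n))"
      by (simp only: exp_add[symmetric] add_uminus_conv_diff)
    also have "\<dots> = real n powr (- r)" using n0 by (simp add: powr_def algebra_simps)
    finally show ?thesis using powr_ge_zero[of "real n" "- r"] by linarith
  qed
  define ch where "ch = (\<lambda>\<omega>. ls_coeff (tensor \<psi>) A n (\<lambda>j. \<xi> j \<omega>) (\<lambda>j. f (\<xi> j \<omega>)))"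
  have fhat: "fhat \<omega> = (\<lambda>x. \<Sum>\<alpha>\<in>A. ch \<omega> \<alpha> * tensor \<psi> \<alpha> x)" for \<omega>
    unfolding fhat_def A_def[symmetric] ls_approx_eq[OF finA] ch_def ..
  have fhat_L2: "fhat \<omega> \<in> L2 (prodm \<mu>)" for \<omega> unfolding fhat by (rule tensor_sum_L2)
  have rv: "\<xi> j \<in> M \<rightarrow>\<^sub>M prodm \<mu>" if "j < n" for j
    using design_indep that unfolding D.indep_vars_def by auto
  have ch_meas: "(\<lambda>\<omega>. ch \<omega> \<alpha>) \<in> borel_measurable M" if "\<alpha> \<in> A" for \<alpha>
    unfolding ch_def
    by (rule measurable_ls_coeff[OF finA _ _ that])
      (auto intro: measurable_compose[OF rv tensor_measurable] measurable_compose[OF rv L2_measurable[OF f_L2]])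
  \<comment> \<open>off the exceptional event, Pythagoras splits the error into \<open>e\<close> and the coefficient error\<close>
  have good: "(\<integral>x. (f x - fhat \<omega> x)\<^sup>2 \<partial>prodm \<mu>) / ?V \<le> g \<omega>" if \<omega>: "\<omega> \<in> space M - B" for \<omega>
  proof -
    define w where "w = (\<lambda>\<alpha>. ch \<omega> \<alpha> - c \<alpha>)"
    have "(\<integral>x. (f x - fhat \<omega> x)\<^sup>2 \<partial>prodm \<mu>) = (\<integral>x. (e x - (\<Sum>\<alpha>\<in>A. w \<alpha> * tensor \<psi> \<alpha> x))\<^sup>2 \<partial>prodm \<mu>)"
      unfolding e_eq fhat w_def
      by (intro Bochner_Integration.integral_cong refl) (simp add: left_diff_distrib sum_subtractf)
    also have "\<dots> = E + (\<Sum>\<alpha>\<in>A. (w \<alpha>)\<^sup>2)"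
      unfolding E_def by (rule square_error_split[OF finA e_L2 e_orth])
    also have "(\<Sum>\<alpha>\<in>A. (w \<alpha>)\<^sup>2) \<le> 4 / (real n)\<^sup>2 * R \<omega>"
    proof -
      have "(real n / 2)\<^sup>2 * (\<Sum>\<alpha>\<in>A. (w \<alpha>)\<^sup>2) \<le> R \<omega>"
        unfolding w_def ch_def R_def
      proof (rule least_squares_error[OF finA, where xs = "\<lambda>j. \<xi> j \<omega>" and e = "\<lambda>j. e (\<xi> j \<omega>)"])
        show "0 < real n / 2" using n0 by simp
        show "real n / 2 * (\<Sum>\<alpha>\<in>A. (w \<alpha>)\<^sup>2) \<le> (\<Sum>j<n. (\<Sum>\<alpha>\<in>A. w \<alpha> * tensor \<psi> \<alpha> (\<xi> j \<omega>))\<^sup>2)" for w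
          by (rule coercive[OF \<omega>])
        show "f (\<xi> j \<omega>) = (\<Sum>\<alpha>\<in>A. c \<alpha> * tensor \<psi> \<alpha> (\<xi> j \<omega>)) + e (\<xi> j \<omega>)" for j
          by (simp add: e_eq)
      qed
      then show ?thesis using n0 by (simp add: field_simps power2_eq_square)
    qed
    finally show ?thesis using f_var unfolding g_def by (intro divide_right_mono) auto
  qed
  have main: "integrable M (\<lambda>\<omega>. (group_index \<mu> W f - group_index \<mu> W (fhat \<omega>))\<^sup>2) \<and>
      integrable M (\<lambda>\<omega>. \<bar>group_index \<mu> W f - group_index \<mu> W (fhat \<omega>)\<bar>) \<and>
      (\<integral>\<omega>. (group_index \<mu> W f - group_index \<mu> W (fhat \<omega>))\<^sup>2 \<partial>M)
        \<le> 1.2 / ?V * (L2_norm (prodm \<mu>) e)\<^sup>2 + 2 * real n powr (- r) \<and>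
      (\<integral>\<omega>. \<bar>group_index \<mu> W f - group_index \<mu> W (fhat \<omega>)\<bar> \<partial>M)
        \<le> 1.2 / ?V * (L2_norm (prodm \<mu>) e)\<^sup>2
          + 2.2 * sqrt (group_index \<mu> W f) / sqrt ?V * L2_norm (prodm \<mu>) e
          + 2 * real n powr (- r)" for W
  proof -
    let ?S = "group_index \<mu> W"
    define d where "d = (\<lambda>\<omega>. ?S f - ?S (fhat \<omega>))"
    define s where "s = 2 * sqrt (?S f)"
    have s0: "0 \<le> s" using group_index_bounds[OF f_L2, of W] by (simp add: s_def)
    have nrm: "L2_norm (prodm \<mu>) e = sqrt E" "(L2_norm (prodm \<mu>) e)\<^sup>2 = E"
      using E0 by (simp_all add: L2_norm_def E_def)
    have d_meas: "d \<in> borel_measurable M"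
      unfolding d_def fhat using measurable_group_index[OF finA ch_meas] by measurable
    have d1: "\<bar>d \<omega>\<bar> \<le> 1" for \<omega>
      using group_index_bounds[OF f_L2, of W] group_index_bounds[OF fhat_L2, of W \<omega>]
      unfolding d_def by linarith
    have sq: "(d \<omega>)\<^sup>2 \<le> g \<omega>" if "\<omega> \<in> space M - B" for \<omega>
      using group_index_stable(1)[OF f_L2 fhat_L2 f_var] good[OF that] unfolding d_def by (rule order_trans)
    have ab: "\<bar>d \<omega>\<bar> \<le> g \<omega> + s * sqrt (g \<omega>)" if "\<omega> \<in> space M - B" for \<omega>
    proof -
      let ?\<delta> = "(\<integral>x. (f x - fhat \<omega> x)\<^sup>2 \<partial>prodm \<mu>) / ?V"
      have "\<bar>d \<omega>\<bar> \<le> ?\<delta> + s * sqrt ?\<delta>"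
        unfolding d_def s_def by (rule group_index_stable(2)[OF f_L2 fhat_L2 f_var])
      also have "\<dots> \<le> g \<omega> + s * sqrt (g \<omega>)"
        using good[OF that] s0 by (intro add_mono mult_left_mono) auto
      finally show ?thesis .
    qed
    note fin = D.expectation_outside[OF d_meas d1 B(1) g g0 s0 sq ab]
    have S1: "(\<integral>\<omega>. (d \<omega>)\<^sup>2 \<partial>M) \<le> 1.2 / ?V * E + 2 * real n powr (- r)" using fin(3) Eg PB by linarith
    have S2: "(\<integral>\<omega>. \<bar>d \<omega>\<bar> \<partial>M) \<le> 1.2 / ?V * E + 2.2 * sqrt (?S f) / sqrt ?V * sqrt E + 2 * real n powr (- r)"
    proof -
      have "sqrt (\<integral>\<omega>. g \<omega> \<partial>M) \<le> sqrt (1.2 / ?V * E)" using Eg by simp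
      also have "\<dots> \<le> sqrt ((1.1)\<^sup>2 * (E / ?V))"
      proof (rule real_sqrt_le_mono)
        have "0 \<le> E / ?V" using E0 f_var by simp
        then have "1.2 * (E / ?V) \<le> (1.1)\<^sup>2 * (E / ?V)"
          by (intro mult_right_mono) (simp_all add: power2_eq_square)
        then show "1.2 / ?V * E \<le> (1.1)\<^sup>2 * (E / ?V)" by simp
      qed
      also have "\<dots> = 1.1 * (sqrt E / sqrt ?V)" by (simp add: real_sqrt_mult real_sqrt_divide)
      finally have "s * sqrt (\<integral>\<omega>. g \<omega> \<partial>M) \<le> s * (1.1 * (sqrt E / sqrt ?V))" using s0 by (rule mult_left_mono)
      also have "\<dots> = 2.2 * sqrt (?S f) / sqrt ?V * sqrt E" by (simp add: s_def)
      finally show ?thesis using fin(4) Eg PB by linarith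
    qed
    show ?thesis
      unfolding nrm(2) unfolding nrm(1) by (intro conjI fin(1,2)[unfolded d_def] S1[unfolded d_def] S2[unfolded d_def])
  qed
  show ?thesis
  proof (intro ballI allI)
    fix S and U :: "'i set" assume "S \<in> {sobol_index \<mu>, total_effect_index \<mu>}"
    then consider "S = sobol_index \<mu>" | "S = total_effect_index \<mu>" by auto
    then obtain W where S: "\<And>h. S h U = group_index \<mu> W h"
    proof cases
      case 1
      show thesis by (rule that[of "{U}"]) (simp only: 1 sobol_index_eq_group)
    next
      case 2
      show thesis by (rule that[of "{V. V \<inter> U \<noteq> {}}"]) (simp only: 2 total_effect_index_eq_group)
    qed
    show "integrable M (\<lambda>\<omega>. (S f U - S (fhat \<omega>) U)\<^sup>2) \<and>
      integrable M (\<lambda>\<omega>. \<bar>S f U - S (fhat \<omega>) U\<bar>) \<and>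
      (\<integral>\<omega>. (S f U - S (fhat \<omega>) U)\<^sup>2 \<partial>M)
        \<le> 1.2 / ?V * (L2_norm (prodm \<mu>) e)\<^sup>2 + 2 * real n powr (- r) \<and>
      (\<integral>\<omega>. \<bar>S f U - S (fhat \<omega>) U\<bar> \<partial>M)
        \<le> 1.2 / ?V * (L2_norm (prodm \<mu>) e)\<^sup>2
          + 2.2 * sqrt (S f U) / sqrt ?V * L2_norm (prodm \<mu>) e
          + 2 * real n powr (- r)"
      unfolding S by (rule main)
  qed
qed

end
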